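(* Let $L=(L_t)_{t\in\mathbb{R}}$ be a (two-sided) complex-valued rotationally invariant Lévy process without Gaussian component, let $\nu$ be its Lévy measure on $\mathbb{C}\cong\mathbb{R}^2$, and let $\nu_R$ denote the Lévy measure on $\mathbb{R}$ of the real part of $L$. Let $(\alpha,H)\in(0,2)\times(0,1)$ and $a,b\in\mathbb{R}$, and for $t\in\mathbb{R}$ put $$f_t(s)=\frac{e^{its}-1}{is}\Big(a(s_+)^{-H-1/\alpha+1}+b(s_-)^{-H-1/\alpha+1}\Big),\qquad s\in\mathbb{R}.$$ The harmonizable fractional Lévy motion $X_t=\int_{\mathbb{R}}f_t(s)\,dL_s$, $t\in\mathbb{R}$, exists (that is, $f_t$ is $L$-integrable for every $t\in\mathbb{R}$) if both of the following conditions are satisfied: (a) $\displaystyle\int_{|x|>1}|x|^{\frac{1}{H+1/\alpha}}\,\nu_R(dx)<\infty$; (b) $\displaystyle\int_{|x|\le1}|x|^{\frac{1}{H+1/\alpha-1}}\,\nu_R(dx)<\infty$. Furthermore, if $X=(X_t)_{t\in\mathbb{R}}$ exists, then it has stationary increments, it is rotationally invariant, and for every $t\in\mathbb{R}$ and all $\theta=(\theta_1,\theta_2)\in\mathbb{R}^2$, $$\mathbb{E}\Big[\exp\Big(i\big(\theta_1\operatorname{Re}(X_t)+\theta_2\operatorname{Im}(X_t)\big)\Big)\Big]=\exp\Big(\int_{\mathbb{R}}K\big(\theta_1f_{t,1}(s)+\theta_2f_{t,2}(s),\ \theta_2f_{t,1}(s)-\theta_1f_{t,2}(s)\big)\,ds\Big),$$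 where $f_{t,1}=\operatorname{Re}f_t$, $f_{t,2}=\operatorname{Im}f_t$, and $$K(z)=\int_{\mathbb{R}^2}\Big[e^{i\langle z,x\rangle}-1-i\,\mathbf{1}_{\{\|x\|\le1\}}\langle z,x\rangle\Big]\,\nu(dx),\qquad z\in\mathbb{R}^2 .$$
   Context: Notation: $s_+=\max\{s,0\}$, $s_-=-\min\{s,0\}$; in the integrand $(s_+)^p$ is read as $0$ when $s\le 0$ and $(s_-)^p$ as $0$ when $s\ge0$ (the point $s=0$ is Lebesgue-null). If $H+1/\alpha=1$, condition (b) is regarded as automatically satisfied (exponent $1/0=\infty$). Rotational invariance: a complex-valued random variable $X$ is rotationally invariant if $e^{i\theta}X$ has the same distribution as $X$ for all $\theta\in[0,2\pi)$; a complex-valued process is rotationally invariant if every complex linear combination $\sum_{n=1}^N z_nX_{t_n}$ is rotationally invariant. Stochastic integral: a two-sided complex-valued Lévy process $L$ induces a complex-valued independently scattered infinitely divisible random measure $M$ on the bounded Borel sets of $\mathbb{R}$, determined by $M((s,t])=L_t-L_s$ for $s<t$. For a simple function $g=\sum_{j=1}^n z_j\mathbf{1}_{A_j}$ ($z_j\in\mathbb{C}$, $A_j$ disjoint bounded Borel sets) and a Borel set $A$, $\int_A g\,dL=\sum_j z_jM(A\cap A_j)$. A measurable $g:\mathbb{R}\to\mathbb{C}$ is $L$-integrable if there are simple functions $g_n\to g$ Lebesgue-almost everywhere such that for every Borel set $A$ the sequence $\int_A g_n\,dL$ converges in probability; then $\int_A g\,dL$ is this limit in probability (it does not depend on the approximating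 sequence). Stationary increments means that the finite dimensional distributions of $(X_{t+h}-X_h)_{t\in\mathbb{R}}$ do not depend on $h\in\mathbb{R}$.
   Formalization: When H+1/α = 3/2 the existence claim also assumes that x² ln(1/|x|) is ν_R-integrable over |x| ≤ 1; without it existence fails there, e.g. for α=1, H=1/2, a≠0 and isotropic ν with radial density 1/(r³(ln r)²) on 0<r<1/2. *)

theory Defs
  imports "HOL-Probability.Probability"
begin

section \<open>Random variables and processes\<close>

definition conv_in_prob :: "'w measure \<Rightarrow> (nat \<Rightarrow> 'w \<Rightarrow> complex) \<Rightarrow> ('w \<Rightarrow> complex) \<Rightarrow> bool" where
  "conv_in_prob P Y Z \<longleftrightarrow>
     (\<forall>n. Y n \<in> borel_measurable P) \<and> Z \<in> borel_measurable P \<and>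
     (\<forall>e>0. (\<lambda>n. measure P {\<omega> \<in> space P. dist (Y n \<omega>) (Z \<omega>) > e}) \<longlonglongrightarrow> 0)"

definition rotationally_invariant :: "'w measure \<Rightarrow> ('w \<Rightarrow> complex) \<Rightarrow> bool" where
  "rotationally_invariant P Y \<longleftrightarrow>
     Y \<in> borel_measurable P \<and>
     (\<forall>\<theta>::real. 0 \<le> \<theta> \<and> \<theta> < 2 * pi \<longrightarrow>
        distr P borel (\<lambda>\<omega>. exp (\<i> * complex_of_real \<theta>) * Y \<omega>) = distr P borel Y)"

definition rotationally_invariant_process :: "'w measure \<Rightarrow> (real \<Rightarrow> 'w \<Rightarrow> complex) \<Rightarrow> bool" where
  "rotationally_invariant_process P X \<longleftrightarrow>
     (\<forall>(N::nat) (z :: nat \<Rightarrow> complex) (t :: nat \<Rightarrow> real).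
        rotationally_invariant P (\<lambda>\<omega>. \<Sum>n<N. z n * X (t n) \<omega>))"

definition stationary_increments :: "'w measure \<Rightarrow> (real \<Rightarrow> 'w \<Rightarrow> complex) \<Rightarrow> bool" where
  "stationary_increments P X \<longleftrightarrow>
     (\<forall>t. X t \<in> borel_measurable P) \<and>
     (\<forall>(J :: real set) h h'. finite J \<longrightarrow>
        distr P (Pi\<^sub>M J (\<lambda>_. borel)) (\<lambda>\<omega>. \<lambda>t\<in>J. X (t + h) \<omega> - X h \<omega>) =
        distr P (Pi\<^sub>M J (\<lambda>_. borel)) (\<lambda>\<omega>. \<lambda>t\<in>J. X (t + h') \<omega> - X h' \<omega>))"

definition infinitely_divisible :: "'w measure \<Rightarrow> ('w \<Rightarrow> complex) \<Rightarrow> bool" where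
  "infinitely_divisible P Y \<longleftrightarrow>
     (\<forall>n>0. \<exists>\<rho>. prob_space \<rho> \<and> sets \<rho> = sets (borel :: complex measure) \<and>
        distr P borel Y = distr (Pi\<^sub>M {..<n::nat} (\<lambda>_. \<rho>)) borel (\<lambda>x. \<Sum>i<n. x i))"

section \<open>Levy processes indexed by the real line\<close>

definition levy_process :: "'w measure \<Rightarrow> (real \<Rightarrow> 'w \<Rightarrow> 'a::euclidean_space) \<Rightarrow> bool" where
  "levy_process P L \<longleftrightarrow>
     (\<forall>t. L t \<in> borel_measurable P) \<and>
     (AE \<omega> in P. L 0 \<omega> = 0) \<and>
     (\<forall>(n::nat) (t :: nat \<Rightarrow> real). mono t \<longrightarrow>
        prob_space.indep_vars P (\<lambda>_. borel) (\<lambda>i \<omega>. L (t (Suc i)) \<omega> - L (t i) \<omega>) {..<n}) \<and>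
     (\<forall>s h. 0 \<le> h \<longrightarrow>
        distr P borel (\<lambda>\<omega>. L (s + h) \<omega> - L s \<omega>) = distr P borel (L h)) \<and>
     (\<forall>t. \<forall>e>0. ((\<lambda>u. measure P {\<omega> \<in> space P. dist (L u \<omega>) (L t \<omega>) > e}) \<longlongrightarrow> 0) (at t)) \<and>
     (AE \<omega> in P. \<forall>t. continuous (at_right t) (\<lambda>u. L u \<omega>) \<and>
        (\<exists>l. ((\<lambda>u. L u \<omega>) \<longlongrightarrow> l) (at_left t)))"

definition levy_measure :: "'a::euclidean_space measure \<Rightarrow> bool" where
  "levy_measure \<nu> \<longleftrightarrow>
     sets \<nu> = sets borel \<and> emeasure \<nu> {0} = 0 \<and>
     (\<integral>\<^sup>+x. ennreal (min 1 ((norm x)\<^sup>2)) \<partial>\<nu>) < \<infinity>"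

definition levy_integrand :: "'a::euclidean_space \<Rightarrow> 'a \<Rightarrow> complex" where
  "levy_integrand z x = exp (\<i> * complex_of_real (z \<bullet> x)) - 1
     - \<i> * complex_of_real (indicat_real (cball 0 1) x * (z \<bullet> x))"

text \<open>Levy-Khintchine representation with drift \<open>\<gamma>\<close>, covariance operator \<open>A\<close> of the Gaussian
  component, and Levy measure \<open>\<nu>\<close>. The process is without Gaussian component iff \<open>A = 0\<close>.\<close>

definition levy_triplet ::
  "'w measure \<Rightarrow> (real \<Rightarrow> 'w \<Rightarrow> 'a::euclidean_space) \<Rightarrow> 'a \<Rightarrow> ('a \<Rightarrow> 'a) \<Rightarrow> 'a measure \<Rightarrow> bool" where
  "levy_triplet P L \<gamma> A \<nu> \<longleftrightarrow>
     linear A \<and> (\<forall>x y. A x \<bullet> y = x \<bullet> A y) \<and> (\<forall>x. 0 \<le> A x \<bullet> x) \<and>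
     levy_measure \<nu> \<and>
     (\<forall>t\<ge>0. \<forall>z. (\<integral>\<omega>. exp (\<i> * complex_of_real (z \<bullet> L t \<omega>)) \<partial>P) =
        exp (complex_of_real t *
          (\<i> * complex_of_real (\<gamma> \<bullet> z) - complex_of_real (A z \<bullet> z) / 2
            + (\<integral>x. levy_integrand z x \<partial>\<nu>))))"

definition has_levy_measure ::
  "'w measure \<Rightarrow> (real \<Rightarrow> 'w \<Rightarrow> 'a::euclidean_space) \<Rightarrow> 'a measure \<Rightarrow> bool" where
  "has_levy_measure P L \<nu> \<longleftrightarrow> (\<exists>\<gamma> A. levy_triplet P L \<gamma> A \<nu>)"

section \<open>The induced random measure and the stochastic integral\<close>

text \<open>Only the values \<open>\<Lambda> A\<close> on bounded Borel sets \<open>A\<close> are meaningful. These conditions determine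
  \<open>\<Lambda> A\<close> almost surely from \<open>L\<close>.\<close>

definition levy_random_measure ::
  "'w measure \<Rightarrow> (real \<Rightarrow> 'w \<Rightarrow> complex) \<Rightarrow> (real set \<Rightarrow> 'w \<Rightarrow> complex) \<Rightarrow> bool" where
  "levy_random_measure P L \<Lambda> \<longleftrightarrow>
     (\<forall>A. A \<in> sets borel \<and> bounded A \<longrightarrow>
        \<Lambda> A \<in> borel_measurable P \<and> infinitely_divisible P (\<Lambda> A)) \<and>
     (\<forall>A :: nat \<Rightarrow> real set.
        (\<forall>n. A n \<in> sets borel \<and> bounded (A n)) \<and> disjoint_family A \<longrightarrow>
        prob_space.indep_vars P (\<lambda>_. borel) (\<lambda>n. \<Lambda> (A n)) UNIV \<and>
        (bounded (\<Union>n. A n) \<longrightarrow>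
          (AE \<omega> in P. (\<lambda>n. \<Lambda> (A n) \<omega>) sums \<Lambda> (\<Union>n. A n) \<omega>))) \<and>
     (\<forall>s t. s < t \<longrightarrow> (AE \<omega> in P. \<Lambda> {s<..t} \<omega> = L t \<omega> - L s \<omega>))"

text \<open>The list \<open>[(z\<^sub>1, A\<^sub>1), \<dots>, (z\<^sub>n, A\<^sub>n)]\<close> represents the simple function
  \<open>z\<^sub>1 1\<^bsub>A\<^sub>1\<^esub> + \<dots> + z\<^sub>n 1\<^bsub>A\<^sub>n\<^esub>\<close>.\<close>

type_synonym simple_rep = "(complex \<times> real set) list"

definition is_simple_rep :: "simple_rep \<Rightarrow> bool" where
  "is_simple_rep g \<longleftrightarrow>
     (\<forall>(z, A) \<in> set g. A \<in> sets borel \<and> bounded A) \<and> sorted_wrt disjnt (map snd g)"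

definition simple_fun :: "simple_rep \<Rightarrow> real \<Rightarrow> complex" where
  "simple_fun g s = (\<Sum>(z, A)\<leftarrow>g. z * indicator A s)"

definition simple_integral ::
  "(real set \<Rightarrow> 'w \<Rightarrow> complex) \<Rightarrow> simple_rep \<Rightarrow> real set \<Rightarrow> 'w \<Rightarrow> complex" where
  "simple_integral \<Lambda> g B \<omega> = (\<Sum>(z, A)\<leftarrow>g. z * \<Lambda> (B \<inter> A) \<omega>)"

definition approximating_sequence ::
  "'w measure \<Rightarrow> (real set \<Rightarrow> 'w \<Rightarrow> complex) \<Rightarrow> (real \<Rightarrow> complex) \<Rightarrow> (nat \<Rightarrow> simple_rep) \<Rightarrow> bool" where
  "approximating_sequence P \<Lambda> g G \<longleftrightarrow>
     (\<forall>n. is_simple_rep (G n)) \<and>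
     (AE s in lborel. (\<lambda>n. simple_fun (G n) s) \<longlonglongrightarrow> g s) \<and>
     (\<forall>B \<in> sets borel. \<exists>Y. conv_in_prob P (\<lambda>n. simple_integral \<Lambda> (G n) B) Y)"

definition levy_integrable ::
  "'w measure \<Rightarrow> (real set \<Rightarrow> 'w \<Rightarrow> complex) \<Rightarrow> (real \<Rightarrow> complex) \<Rightarrow> bool" where
  "levy_integrable P \<Lambda> g \<longleftrightarrow>
     g \<in> borel_measurable borel \<and> (\<exists>G. approximating_sequence P \<Lambda> g G)"

text \<open>\<open>Y\<close> is a version of the stochastic integral of \<open>g\<close> over \<open>B\<close>.\<close>

definition has_levy_integral ::
  "'w measure \<Rightarrow> (real set \<Rightarrow> 'w \<Rightarrow> complex) \<Rightarrow> (real \<Rightarrow> complex) \<Rightarrow> real set \<Rightarrow> ('w \<Rightarrow> complex) \<Rightarrow> bool"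
where
  "has_levy_integral P \<Lambda> g B Y \<longleftrightarrow>
     g \<in> borel_measurable borel \<and>
     (\<exists>G. approximating_sequence P \<Lambda> g G \<and> conv_in_prob P (\<lambda>n. simple_integral \<Lambda> (G n) B) Y)"

section \<open>Harmonizable fractional Levy motion\<close>

text \<open>The convention that powers of the positive and negative part vanish at \<open>0\<close> is built into
  \<open>powr\<close>, since \<open>0 powr p = 0\<close> for every \<open>p\<close>.\<close>

definition hflm_kernel :: "real \<Rightarrow> real \<Rightarrow> real \<Rightarrow> real \<Rightarrow> real \<Rightarrow> real \<Rightarrow> complex" where
  "hflm_kernel \<alpha> H a b t s =
     (exp (\<i> * complex_of_real (t * s)) - 1) / (\<i> * complex_of_real s) *
     complex_of_real (a * (max s 0) powr (- H - 1 / \<alpha> + 1) + b * (- min s 0) powr (- H - 1 / \<alpha> + 1))"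

definition hflm_exponent :: "complex measure \<Rightarrow> complex \<Rightarrow> complex" where
  "hflm_exponent \<nu> z = (\<integral>x. levy_integrand z x \<partial>\<nu>)"

definition cond_large_jumps :: "real \<Rightarrow> real \<Rightarrow> real measure \<Rightarrow> bool" where
  "cond_large_jumps \<alpha> H \<nu>R \<longleftrightarrow>
     (\<integral>\<^sup>+x\<in>{x. \<bar>x\<bar> > 1}. ennreal (\<bar>x\<bar> powr (1 / (H + 1 / \<alpha>))) \<partial>\<nu>R) < \<infinity>"

definition cond_small_jumps :: "real \<Rightarrow> real \<Rightarrow> real measure \<Rightarrow> bool" where
  "cond_small_jumps \<alpha> H \<nu>R \<longleftrightarrow>
     H + 1 / \<alpha> = 1 \<or>
     (\<integral>\<^sup>+x\<in>{x. \<bar>x\<bar> \<le> 1}. ennreal (\<bar>x\<bar> powr (1 / (H + 1 / \<alpha> - 1))) \<partial>\<nu>R) < \<infinity>"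

text \<open>A correction for the single boundary value \<open>H + 1 / \<alpha> = 3 / 2\<close>; it is void for all other
  parameters. There the exponent in the small jump condition is \<open>2\<close>, so that condition holds for
  every Levy measure, while the kernel behaves like \<open>a * t * s powr (- 1 / 2)\<close> as \<open>s\<close> decreases
  to \<open>0\<close>. Integrability of the kernel forces \<open>min 1 (x\<^sup>2 / s)\<close> to be integrable over \<open>0 < s < 1\<close> and
  \<open>\<bar>x\<bar> \<le> 1\<close> (unless \<open>a t = 0\<close>), and its integral over \<open>s\<close> is \<open>x\<^sup>2 (1 + 2 ln (1 / \<bar>x\<bar>))\<close>. The isotropic
  Levy measure with radial density \<open>1 / (r\<^sup>3 (ln r)\<^sup>2)\<close> on \<open>0 < r < 1 / 2\<close> satisfies both jump conditions
  but not this one, and the integral does not exist for it.\<close>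

definition cond_boundary :: "real \<Rightarrow> real \<Rightarrow> real measure \<Rightarrow> bool" where
  "cond_boundary \<alpha> H \<nu>R \<longleftrightarrow>
     (H + 1 / \<alpha> = 3 / 2 \<longrightarrow>
       (\<integral>\<^sup>+x\<in>{x. \<bar>x\<bar> \<le> 1}. ennreal (x\<^sup>2 * ln (1 / \<bar>x\<bar>)) \<partial>\<nu>R) < \<infinity>)"

end

theory Submission
  imports Defs
begin

text \<open>
  \<^bold>\<open>Exponent.\<close> Rotational invariance makes the characteristic exponent of \<open>L\<close> real and radial:
  \<open>E exp (i (z \<bullet> L t)) = exp (- t \<phi> z)\<close> for \<open>t \<ge> 0\<close>, where \<open>\<phi> z\<close> is the integral of \<open>1 - cos (z \<bullet> x)\<close>
  over \<open>\<nu>\<close> and \<open>\<phi> (c z) = \<phi> z\<close> whenever \<open>c\<close> has modulus one. That the drift drops out as well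
  (\<open>levy_drift_zero\<close>) rests on the symmetry of \<open>\<nu>\<close>, which is recovered from the exponent. For a
  simple \<open>g\<close>, independence then gives \<open>E exp (i (z \<bullet> \<integral> g dL)) = exp (- \<integral> \<phi> (cnj (g s) z) ds)\<close>
  (\<open>char_simple_integral\<close>).

  \<^bold>\<open>Limits.\<close> The square root of \<open>\<phi>\<close> is subadditive, because it is a multiple of the \<open>L\<^sup>2\<close> norm of
  \<open>sin (z \<bullet> x / 2)\<close>;
  the form used is \<open>\<phi> (y + z) \<le> (1 + e) \<phi> y + (1 + 1 / e) \<phi> z\<close>. If simple functions \<open>g\<^sub>n\<close> tend to \<open>g\<close> almost
  everywhere and their integrals converge in probability, then the integrals of \<open>g\<^sub>n - g\<^sub>m\<close> tend to \<open>0\<close>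
  in probability, so \<open>\<integral> \<phi> (cnj (g\<^sub>n - g\<^sub>m) z) ds\<close> tends to \<open>0\<close>. By Fatou's lemma this survives the
  passage \<open>m \<rightarrow> \<infinity>\<close>, and the inequality above turns it into convergence of \<open>\<integral> \<phi> (cnj g\<^sub>n z) ds\<close> to
  \<open>\<integral> \<phi> (cnj g z) ds\<close>. Thus the formula for simple integrands holds for all integrands (\<open>levy_limit_char\<close>).

  \<^bold>\<open>Invariance.\<close> A linear combination of the \<open>X t\<close> is the integral of the same combination of kernels, and
  its characteristic function sees the integrand only through \<open>\<phi>\<close>, which ignores factors of modulus
  one. A constant factor \<open>exp (i \<theta>)\<close> gives rotational invariance; the factor \<open>exp (i h s)\<close> in
  \<open>f\<^bsub>t + h\<^esub> - f\<^bsub>h\<^esub> = exp (i h s) f\<^bsub>t\<^esub>\<close> gives stationary increments. Joint laws are compared through the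
  uniqueness theorem for multivariate characteristic functions (\<open>complex_family_distr_eqI\<close>).

  \<^bold>\<open>Existence.\<close> In terms of the Levy measure of the real part, \<open>\<phi> z\<close> is the integral of \<open>1 - cos (\<bar>z\<bar> x)\<close>
  over \<open>\<nu>R\<close>, hence at most the integral of \<open>min 2 (\<bar>z\<bar>\<^sup>2 x\<^sup>2)\<close>. If this bound, at \<open>z = g s\<close>, is integrable in \<open>s\<close>,
  then fast simple approximations of \<open>g\<close> have almost surely convergent integrals over every Borel set, by the
  truncation inequality and the Borel-Cantelli lemma (\<open>levy_integrable_if_jump_bound\<close>). For the kernel, with
  \<open>\<beta> = H + 1 / \<alpha> > 1 / 2\<close>, the modulus is at most a constant times \<open>\<bar>s\<bar> powr (1 - \<beta>)\<close> near \<open>0\<close> and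
  \<open>\<bar>s\<bar> powr (- \<beta>)\<close> near infinity. Tonelli's theorem reduces the matter to the integral over \<open>s\<close> for fixed \<open>x\<close>. For
  \<open>\<bar>x\<bar> > 1\<close> high frequencies contribute \<open>\<bar>x\<bar> powr (1 / \<beta>)\<close> and low frequencies a bounded amount. For \<open>\<bar>x\<bar> \<le> 1\<close> they contribute \<open>x\<^sup>2\<close>, while low
  frequencies contribute \<open>x\<^sup>2\<close>, \<open>x\<^sup>2 (1 + ln (1 / \<bar>x\<bar>))\<close> or \<open>\<bar>x\<bar> powr (1 / (\<beta> - 1))\<close> according to whether \<open>\<beta>\<close> is
  below, at or above \<open>3 / 2\<close>. These are the jump conditions (\<open>kernel_profile_jump_bound\<close>).
\<close>

section \<open>Uniqueness of multivariate characteristic functions\<close>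


lemma abs_Re_Im_le_1: "norm (z::complex) \<le> 1 \<Longrightarrow> \<bar>Re z\<bar> \<le> 1 \<and> \<bar>Im z\<bar> \<le> 1"
  using abs_Re_le_cmod abs_Im_le_cmod order_trans by blast

lemma (in finite_measure) integrable_norm_le:
  fixes f :: "'a \<Rightarrow> 'b::{banach, second_countable_topology}"
  assumes "f \<in> borel_measurable M" "\<And>x. norm (f x) \<le> B"
  shows "integrable M f"
  using assms by (intro integrable_const_bound[where B=B]) auto

text \<open>Dividing a weight by its total mass turns it into a probability density, so that uniqueness
  for probability laws on the line applies to weighted finite measures.\<close>

lemma normalized_weighted_distr:
  fixes X v :: "'a \<Rightarrow> real"
  assumes "finite_measure M"
    and [measurable]: "X \<in> borel_measurable M" "v \<in> borel_measurable M"
    and v: "\<And>x. 0 \<le> v x" "\<And>x. v x \<le> B" and c: "c = (\<integral>x. v x \<partial>M)" "0 < c"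
  defines "\<mu> \<equiv> distr (density M (\<lambda>x. ennreal (v x / c))) borel X"
  shows "real_distribution \<mu>"
    and "char \<mu> u = (\<integral>x. complex_of_real (v x) * iexp (u * X x) \<partial>M) / c"
    and "A \<in> sets borel \<Longrightarrow> (\<integral>x. indicat_real A x \<partial>\<mu>) = (\<integral>x. v x * indicator A (X x) \<partial>M) / c"
proof -
  interpret finite_measure M by fact
  have iv: "integrable M v" using v by (intro integrable_norm_le[where B=B]) auto
  have "prob_space (density M (\<lambda>x. ennreal (v x / c)))"
  proof
    have "emeasure (density M (\<lambda>x. ennreal (v x / c))) (space M) = ennreal (\<integral>x. v x / c \<partial>M)"
      using iv v c by (subst emeasure_density) (auto simp: nn_integral_eq_integral
        intro!: nn_integral_eq_integral cong: nn_integral_cong)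
    also have "(\<integral>x. v x / c \<partial>M) = 1" using c by simp
    finally show "emeasure (density M (\<lambda>x. ennreal (v x / c))) (space (density M (\<lambda>x. ennreal (v x / c)))) = 1"
      by simp
  qed
  thus "real_distribution \<mu>" unfolding \<mu>_def
    by (intro prob_space.real_distribution_distr) auto
  have "char \<mu> u = (\<integral>x. (v x / c) *\<^sub>R iexp (u * X x) \<partial>M)"
    unfolding char_def \<mu>_def using v c
    by (subst integral_distr) (auto simp: integral_density)
  also have "\<dots> = (\<integral>x. complex_of_real (v x) * iexp (u * X x) / c \<partial>M)"
    by (simp add: scaleR_conv_of_real)
  finally show "char \<mu> u = (\<integral>x. complex_of_real (v x) * iexp (u * X x) \<partial>M) / c" by simp
  assume [measurable]: "A \<in> sets borel"
  show "(\<integral>x. indicat_real A x \<partial>\<mu>) = (\<integral>x. v x * indicator A (X x) \<partial>M) / c"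
    unfolding \<mu>_def using v c by (subst integral_distr) (auto simp: integral_density)
qed

lemma nonneg_weighted_char_unique:
  fixes X v :: "'a \<Rightarrow> real" and Y w :: "'b \<Rightarrow> real"
  assumes M: "finite_measure M" and N: "finite_measure N"
    and m[measurable]: "X \<in> borel_measurable M" "v \<in> borel_measurable M"
      "Y \<in> borel_measurable N" "w \<in> borel_measurable N" "A \<in> sets borel"
    and v: "\<And>x. 0 \<le> v x" "\<And>x. v x \<le> B" and w: "\<And>y. 0 \<le> w y" "\<And>y. w y \<le> B"
    and eq: "\<And>u. (\<integral>x. complex_of_real (v x) * iexp (u * X x) \<partial>M) = (\<integral>y. complex_of_real (w y) * iexp (u * Y y) \<partial>N)"
  shows "(\<integral>x. v x * indicator A (X x) \<partial>M) = (\<integral>y. w y * indicator A (Y y) \<partial>N)"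
proof -
  have iv: "integrable M v"
    using v by (intro finite_measure.integrable_norm_le[OF M, where B=B]) auto
  have iw: "integrable N w"
    using w by (intro finite_measure.integrable_norm_le[OF N, where B=B]) auto
  have "(\<integral>x. complex_of_real (v x) \<partial>M) = (\<integral>y. complex_of_real (w y) \<partial>N)"
    using eq[of 0] by simp
  hence mass: "(\<integral>x. v x \<partial>M) = (\<integral>y. w y \<partial>N)"
    unfolding integral_complex_of_real by simp
  define c where "c = (\<integral>x. v x \<partial>M)"
  have c0: "0 \<le> c" unfolding c_def using v by simp
  show ?thesis
  proof (cases "c = 0")
    case True
    have "AE x in M. v x = 0"
      using True iv v integral_nonneg_eq_0_iff_AE[of M v] by (auto simp: c_def)
    hence "(\<integral>x. v x * indicator A (X x) \<partial>M) = (\<integral>x. 0 \<partial>M)"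
      by (intro integral_cong_AE) auto
    moreover have "AE y in N. w y = 0"
      using True mass iw w integral_nonneg_eq_0_iff_AE[of N w] by (auto simp: c_def)
    hence "(\<integral>y. w y * indicator A (Y y) \<partial>N) = (\<integral>x. 0 \<partial>N)"
      by (intro integral_cong_AE) auto
    ultimately show ?thesis by simp
  next
    case False
    with c0 have c: "0 < c" by simp
    note V = normalized_weighted_distr[OF M m(1,2) v c_def c]
      and W = normalized_weighted_distr[OF N m(3,4) w c_def[unfolded mass] c]
    have "distr (density M (\<lambda>x. ennreal (v x / c))) borel X = distr (density N (\<lambda>y. ennreal (w y / c))) borel Y"
      by (rule Levy_uniqueness[OF V(1) W(1)], rule ext) (simp only: V(2) W(2) eq)
    thus ?thesis using V(3)[OF m(5)] W(3)[OF m(5)] c by simp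
  qed
qed

lemma integral_one_plus_Re_weight:
  fixes X :: "'a \<Rightarrow> real" and V :: "'a \<Rightarrow> complex"
  assumes "finite_measure M"
    and [measurable]: "X \<in> borel_measurable M" "V \<in> borel_measurable M" and V: "\<And>x. norm (V x) \<le> 1"
  shows "(\<integral>x. complex_of_real (1 + Re (z * V x)) * iexp (u * X x) \<partial>M) =
     (\<integral>x. iexp (u * X x) \<partial>M) + (z * (\<integral>x. V x * iexp (u * X x) \<partial>M)
       + cnj (z * (\<integral>x. V x * iexp ((-u) * X x) \<partial>M))) / 2"
proof -
  interpret finite_measure M by fact
  have repr: "complex_of_real (1 + Re q) * e = e + (q * e + cnj (q * cnj e)) / 2" for q e
  proof -
    have "complex_of_real (Re q) = (q + cnj q) / 2" by (simp add: complex_eq_iff)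
    thus ?thesis by (simp add: algebra_simps add_divide_distrib)
  qed
  have i: "integrable M (\<lambda>x. V x * iexp (u * X x))" for u
    using V by (intro integrable_norm_le[where B=1]) (auto simp: norm_mult)
  have i0: "integrable M (\<lambda>x. iexp (u * X x))"
    by (intro integrable_norm_le[where B=1]) auto
  have "(\<integral>x. complex_of_real (1 + Re (z * V x)) * iexp (u * X x) \<partial>M) =
    (\<integral>x. iexp (u * X x) + (z * (V x * iexp (u * X x)) + cnj (z * (V x * iexp ((-u) * X x)))) / 2 \<partial>M)"
    by (intro Bochner_Integration.integral_cong refl, subst repr) (simp add: mult.assoc exp_cnj)
  also have "\<dots> = (\<integral>x. iexp (u * X x) \<partial>M) + (z * (\<integral>x. V x * iexp (u * X x) \<partial>M)
     + cnj (z * (\<integral>x. V x * iexp ((-u) * X x) \<partial>M))) / 2"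
    using i[of u] i[of "-u"] i0 by (simp del: complex_cnj_mult)
  finally show ?thesis .
qed

text \<open>Uniqueness with a bounded complex weight reduces to the case of nonnegative weights: the numbers
  \<open>\<integral> cnj V * exp (i u X)\<close> are the conjugates of \<open>\<integral> V * exp (- i u X)\<close>, so the hypotheses determine the transforms of
  the nonnegative weights \<open>1 + Re (z V)\<close>, and \<open>z = 1\<close>, \<open>z = - \<i>\<close> recover \<open>Re V\<close> and \<open>Im V\<close>.\<close>

lemma weighted_char_unique:
  fixes X :: "'a \<Rightarrow> real" and Y :: "'b \<Rightarrow> real" and V :: "'a \<Rightarrow> complex" and W :: "'b \<Rightarrow> complex"
  assumes "finite_measure M" "finite_measure N"
    and [measurable]: "X \<in> borel_measurable M" "Y \<in> borel_measurable N"
      "V \<in> borel_measurable M" "W \<in> borel_measurable N" "A \<in> sets borel"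
    and V: "\<And>x. norm (V x) \<le> 1" and W: "\<And>y. norm (W y) \<le> 1"
    and eq1: "\<And>u. (\<integral>x. iexp (u * X x) \<partial>M) = (\<integral>y. iexp (u * Y y) \<partial>N)"
    and eqV: "\<And>u. (\<integral>x. V x * iexp (u * X x) \<partial>M) = (\<integral>y. W y * iexp (u * Y y) \<partial>N)"
  shows "(\<integral>x. V x * indicator A (X x) \<partial>M) = (\<integral>y. W y * indicator A (Y y) \<partial>N)"
proof -
  interpret M: finite_measure M by fact
  interpret N: finite_measure N by fact
  have real_part: "(\<integral>x. Re (z * V x) * indicator A (X x) \<partial>M) = (\<integral>y. Re (z * W y) * indicator A (Y y) \<partial>N)"
    if z: "norm z \<le> 1" for z
  proof -
    have zV: "norm (z * V x) \<le> 1" for x using mult_mono[OF z V] by (simp add: norm_mult)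
    have zW: "norm (z * W x) \<le> 1" for x using mult_mono[OF z W] by (simp add: norm_mult)
    have bV: "\<bar>Re (z * V x)\<bar> \<le> 1" for x using zV abs_Re_Im_le_1 by blast
    have bW: "\<bar>Re (z * W x)\<bar> \<le> 1" for x using zW abs_Re_Im_le_1 by blast
    have "(\<integral>x. (1 + Re (z * V x)) * indicator A (X x) \<partial>M) = (\<integral>y. (1 + Re (z * W y)) * indicator A (Y y) \<partial>N)"
    proof (rule nonneg_weighted_char_unique[where B=2])
      show "0 \<le> 1 + Re (z * V x)" "1 + Re (z * V x) \<le> 2" for x using bV[of x] by (auto simp: abs_le_iff)
      show "0 \<le> 1 + Re (z * W x)" "1 + Re (z * W x) \<le> 2" for x using bW[of x] by (auto simp: abs_le_iff)
      show "(\<integral>x. complex_of_real (1 + Re (z * V x)) * iexp (u * X x) \<partial>M) =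
         (\<integral>y. complex_of_real (1 + Re (z * W y)) * iexp (u * Y y) \<partial>N)" for u
        by (simp only: integral_one_plus_Re_weight[OF assms(1) _ _ V] integral_one_plus_Re_weight[OF assms(2) _ _ W] assms(3-6) eq1 eqV)
    qed (use assms in auto)
    moreover have "(\<integral>x. 1 * indicator A (X x) \<partial>M) = (\<integral>y. (1::real) * indicator A (Y y) \<partial>N)"
      by (rule nonneg_weighted_char_unique[where B=1]) (use assms in auto)
    moreover have iM: "integrable M (\<lambda>x. (indicator A (X x) :: real))" "integrable M (\<lambda>x. Re (z * V x) * indicator A (X x))"
      using bV by (auto intro!: M.integrable_norm_le[where B=1] simp: indicator_def simp del: times_complex.simps)
    moreover have iN: "integrable N (\<lambda>x. (indicator A (Y x) :: real))" "integrable N (\<lambda>x. Re (z * W x) * indicator A (Y x))"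
      using bW by (auto intro!: N.integrable_norm_le[where B=1] simp: indicator_def simp del: times_complex.simps)
    ultimately show ?thesis by (simp add: distrib_right del: times_complex.simps)
  qed
  have iM: "integrable M (\<lambda>x. V x * indicator A (X x))"
    using V by (intro M.integrable_norm_le[where B=1]) (auto simp: indicator_def)
  have iN: "integrable N (\<lambda>x. W x * indicator A (Y x))"
    using W by (intro N.integrable_norm_le[where B=1]) (auto simp: indicator_def)
  have indR: "Re (q * indicator A r) = Re q * indicator A r" "Im (q * indicator A r) = Im q * indicator A r"
    for q r by (auto simp: indicator_def)
  show ?thesis
  proof (rule complex_eqI)
    have r1: "Re (1 * V x) = Re (V x)" "Re (1 * W y) = Re (W y)" for x y by auto
    show "Re (\<integral>x. V x * indicator A (X x) \<partial>M) = Re (\<integral>y. W y * indicator A (Y y) \<partial>N)"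
      using real_part[of 1] unfolding integral_Re[OF iM, symmetric] integral_Re[OF iN, symmetric] indR r1 by simp
    have r2: "Re (-\<i> * V x) = Im (V x)" "Re (-\<i> * W y) = Im (W y)" for x y by auto
    show "Im (\<integral>x. V x * indicator A (X x) \<partial>M) = Im (\<integral>y. W y * indicator A (Y y) \<partial>N)"
      using real_part[of "-\<i>"] unfolding integral_Im[OF iM, symmetric] integral_Im[OF iN, symmetric] indR r2 by simp
  qed
qed

text \<open>Coordinates are converted one at a time from frequencies to Borel sets. The factors that belong to the
  other coordinates, indicators or exponentials, form a weight of modulus at most one, so each
  conversion is an instance of the weighted uniqueness on the line.\<close>

lemma finite_dim_char_box:
  fixes X :: "'i \<Rightarrow> 'a \<Rightarrow> real" and Y :: "'i \<Rightarrow> 'b \<Rightarrow> real"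
  assumes "finite_measure M" "finite_measure N" and fin: "finite I"
    and X[measurable]: "\<And>i. i \<in> I \<Longrightarrow> X i \<in> borel_measurable M"
    and Y[measurable]: "\<And>i. i \<in> I \<Longrightarrow> Y i \<in> borel_measurable N"
    and eq: "\<And>u. (\<integral>x. iexp (\<Sum>i\<in>I. u i * X i x) \<partial>M) = (\<integral>y. iexp (\<Sum>i\<in>I. u i * Y i y) \<partial>N)"
    and A[measurable]: "\<And>i. i \<in> I \<Longrightarrow> A i \<in> sets borel"
    and S: "S \<subseteq> I"
  shows "(\<integral>x. (\<Prod>i\<in>S. indicator (A i) (X i x)) * iexp (\<Sum>i\<in>I - S. u i * X i x) \<partial>M) =
         (\<integral>y. (\<Prod>i\<in>S. indicator (A i) (Y i y)) * iexp (\<Sum>i\<in>I - S. u i * Y i y) \<partial>N)"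
  using finite_subset[OF S fin] S
proof (induction S arbitrary: u)
  case empty
  then show ?case using eq by simp
next
  case (insert k S)
  have k: "k \<in> I" "k \<notin> S" "S \<subseteq> I" using insert by auto
  note mS = subsetD[OF k(3)]
  have mX: "X k \<in> borel_measurable M" "Y k \<in> borel_measurable N" "A k \<in> sets borel" using k X Y A by auto
  note mX[measurable]
  let ?V = "\<lambda>x. (\<Prod>i\<in>S. indicator (A i) (X i x)) * iexp (\<Sum>i\<in>I - insert k S. u i * X i x)"
  let ?W = "\<lambda>y. (\<Prod>i\<in>S. indicator (A i) (Y i y)) * iexp (\<Sum>i\<in>I - insert k S. u i * Y i y)"
  have pr: "(\<Prod>i\<in>insert k S. indicator (A i) (Z i)) = (\<Prod>i\<in>S. indicator (A i) (Z i)) * (indicator (A k) (Z k) :: complex)" for Z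
    using insert by (simp add: mult.commute)
  have decomp: "I - S = insert k (I - insert k S)" using k by auto
  have su: "(\<Sum>i\<in>I - S. (u(k := v)) i * Z i) = v * Z k + (\<Sum>i\<in>I - insert k S. u i * Z i)" for v and Z :: "'i \<Rightarrow> real"
    unfolding decomp using fin by (subst sum.insert) (auto intro!: sum.cong)
  have su0: "(\<Sum>i\<in>I. ((\<lambda>_. 0)(k := v)) i * Z i) = v * Z k" for v and Z :: "'i \<Rightarrow> real"
    using fin k by (simp add: if_distrib[where f="\<lambda>x. x * _"] fun_upd_def cong: if_cong)
  have mV[measurable]: "?V \<in> borel_measurable M"
    using X A mS by (intro borel_measurable_times borel_measurable_prod measurable_compose[OF _ borel_measurable_exp]
      borel_measurable_const borel_measurable_of_real borel_measurable_sum) (auto intro!: borel_measurable_indicator')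
  have mW[measurable]: "?W \<in> borel_measurable N"
    using Y A mS by (intro borel_measurable_times borel_measurable_prod measurable_compose[OF _ borel_measurable_exp]
      borel_measurable_const borel_measurable_of_real borel_measurable_sum) (auto intro!: borel_measurable_indicator')
  have ind1: "norm (\<Prod>i\<in>S. indicator (A i) (Z i) :: complex) \<le> 1" for Z
    by (simp add: prod_norm[symmetric] prod_le_1 indicator_def)
  have "(\<integral>x. ?V x * indicator (A k) (X k x) \<partial>M) = (\<integral>y. ?W y * indicator (A k) (Y k y) \<partial>N)"
  proof (rule weighted_char_unique)
    show "norm (?V x) \<le> 1" for x using ind1 by (simp add: norm_mult)
    show "norm (?W x) \<le> 1" for x using ind1 by (simp add: norm_mult)
    \<comment> \<open>all frequencies except the one of coordinate \<open>k\<close> are set to zero\<close>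
    show "(\<integral>x. iexp (v * X k x) \<partial>M) = (\<integral>y. iexp (v * Y k y) \<partial>N)" for v
      using eq[of "(\<lambda>_. 0)(k := v)"] unfolding su0 .
    show "(\<integral>x. ?V x * iexp (v * X k x) \<partial>M) = (\<integral>y. ?W y * iexp (v * Y k y) \<partial>N)" for v
      using insert.IH[of "u(k:=v)"] k(3) unfolding su
      by (simp add: exp_add algebra_simps)
  qed (use assms mV mW mX in auto)
  then show ?case unfolding pr by (simp add: mult_ac)
qed

lemma integral_prod_indicator:
  fixes X :: "'i \<Rightarrow> 'a \<Rightarrow> real"
  assumes M: "finite_measure M" and fin: "finite I"
    and X: "\<And>i. i \<in> I \<Longrightarrow> X i \<in> borel_measurable M" and A: "\<And>i. i \<in> I \<Longrightarrow> A i \<in> sets borel"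
  shows "(\<integral>x. (\<Prod>i\<in>I. indicator (A i) (X i x)) \<partial>M) =
    complex_of_real (measure (distr M (Pi\<^sub>M I (\<lambda>_. borel)) (\<lambda>x. \<lambda>i\<in>I. X i x)) (Pi\<^sub>E I A))"
proof -
  let ?X = "\<lambda>x. \<lambda>i\<in>I. X i x"
  have mX: "?X \<in> measurable M (Pi\<^sub>M I (\<lambda>_. borel))" by (intro measurable_restrict X)
  have box: "Pi\<^sub>E I A \<in> sets (Pi\<^sub>M I (\<lambda>_. borel))" using A fin by (intro sets_PiM_I_finite) auto
  have "(\<integral>x. (\<Prod>i\<in>I. indicator (A i) (X i x)) \<partial>M) = (\<integral>x. complex_of_real (indicator (?X -` Pi\<^sub>E I A \<inter> space M) x) \<partial>M)"
    using fin by (intro Bochner_Integration.integral_cong refl) (auto simp: indicator_def PiE_iff)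
  also have "\<dots> = complex_of_real (measure M (?X -` Pi\<^sub>E I A \<inter> space M))"
    unfolding integral_complex_of_real by simp
  finally show ?thesis by (simp add: measure_distr[OF mX box])
qed

lemma finite_dim_distr_eqI:
  fixes X :: "'i \<Rightarrow> 'a \<Rightarrow> real" and Y :: "'i \<Rightarrow> 'b \<Rightarrow> real"
  assumes M: "finite_measure M" and N: "finite_measure N" and fin: "finite I"
    and X[measurable]: "\<And>i. i \<in> I \<Longrightarrow> X i \<in> borel_measurable M"
    and Y[measurable]: "\<And>i. i \<in> I \<Longrightarrow> Y i \<in> borel_measurable N"
    and eq: "\<And>u. (\<integral>x. iexp (\<Sum>i\<in>I. u i * X i x) \<partial>M) = (\<integral>y. iexp (\<Sum>i\<in>I. u i * Y i y) \<partial>N)"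
  shows "distr M (Pi\<^sub>M I (\<lambda>_. borel)) (\<lambda>x. \<lambda>i\<in>I. X i x) = distr N (Pi\<^sub>M I (\<lambda>_. borel)) (\<lambda>y. \<lambda>i\<in>I. Y i y)"
proof (rule measure_eqI_PiM_finite)
  let ?\<mu> = "distr M (Pi\<^sub>M I (\<lambda>_. borel)) (\<lambda>x. \<lambda>i\<in>I. X i x)"
    and ?\<nu> = "distr N (Pi\<^sub>M I (\<lambda>_. borel)) (\<lambda>y. \<lambda>i\<in>I. Y i y)"
  interpret M: finite_measure M by fact
  interpret N: finite_measure N by fact
  have mX[measurable]: "(\<lambda>x. \<lambda>i\<in>I. X i x) \<in> measurable M (Pi\<^sub>M I (\<lambda>_. borel))"
    by (intro measurable_restrict X)
  have mY[measurable]: "(\<lambda>x. \<lambda>i\<in>I. Y i x) \<in> measurable N (Pi\<^sub>M I (\<lambda>_. borel))"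
    by (intro measurable_restrict Y)
  show "finite I" by fact
  show "sets ?\<mu> = sets (Pi\<^sub>M I (\<lambda>_. borel))"
    "sets ?\<nu> = sets (Pi\<^sub>M I (\<lambda>_. borel))" by auto
  show "emeasure ?\<mu> (Pi\<^sub>E I A) =
    emeasure ?\<nu> (Pi\<^sub>E I A)"
    if A: "\<And>i. i \<in> I \<Longrightarrow> A i \<in> sets borel" for A
  proof -
    have "(\<integral>x. (\<Prod>i\<in>I. indicator (A i) (X i x)) \<partial>M) = (\<integral>x. complex_of_real 1 * (\<Prod>i\<in>I. indicator (A i) (Y i x)) \<partial>N)"
      using finite_dim_char_box[OF M N fin X Y eq A subset_refl] by simp
    hence "measure ?\<mu> (Pi\<^sub>E I A) =
        measure ?\<nu> (Pi\<^sub>E I A)"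
      using integral_prod_indicator[OF M fin X A] integral_prod_indicator[OF N fin Y A] by simp
    thus ?thesis
      using finite_measure.emeasure_eq_measure[OF M.finite_measure_distr[OF mX]]
        finite_measure.emeasure_eq_measure[OF N.finite_measure_distr[OF mY]] by simp
  qed
  show "range (\<lambda>_::nat. Pi\<^sub>E I (\<lambda>_. UNIV)) \<subseteq> prod_algebra I (\<lambda>_. borel)"
    using fin by (auto simp: prod_algebra_eq_finite)
  show "(\<Union>i::nat. Pi\<^sub>E I (\<lambda>_. UNIV)) = space (Pi\<^sub>M I (\<lambda>_. borel))"
    by (simp add: space_PiM)
  show "emeasure ?\<mu> (Pi\<^sub>E I (\<lambda>_. UNIV)) \<noteq> \<infinity>" for i :: nat
    by (simp add: M.finite_measure_distr finite_measure.emeasure_finite)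
qed

text \<open>A complex variable is a pair of real ones; the Boolean index selects the real or the imaginary part.\<close>

lemma complex_family_distr_eqI:
  fixes X :: "'i \<Rightarrow> 'a \<Rightarrow> complex" and Y :: "'i \<Rightarrow> 'b \<Rightarrow> complex"
  assumes M: "finite_measure M" and N: "finite_measure N" and fin: "finite J"
    and X[measurable]: "\<And>j. j \<in> J \<Longrightarrow> X j \<in> borel_measurable M"
    and Y[measurable]: "\<And>j. j \<in> J \<Longrightarrow> Y j \<in> borel_measurable N"
    and eq: "\<And>u. (\<integral>x. iexp (\<Sum>j\<in>J. u j \<bullet> X j x) \<partial>M) = (\<integral>y. iexp (\<Sum>j\<in>J. u j \<bullet> Y j y) \<partial>N)"
  shows "distr M (Pi\<^sub>M J (\<lambda>_. borel)) (\<lambda>x. \<lambda>j\<in>J. X j x) = distr N (Pi\<^sub>M J (\<lambda>_. borel)) (\<lambda>y. \<lambda>j\<in>J. Y j y)"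
proof -
  let ?I = "J \<times> (UNIV :: bool set)"
  define coord :: "complex \<Rightarrow> bool \<Rightarrow> real" where "coord z b = (if b then Re z else Im z)" for z b
  have [measurable]: "(\<lambda>z. coord z b) \<in> borel_measurable borel" for b
    unfolding coord_def by (cases b) auto
  let ?X = "\<lambda>p x. coord (X (fst p) x) (snd p)" and ?Y = "\<lambda>p y. coord (Y (fst p) y) (snd p)"
  define merge :: "('i \<times> bool \<Rightarrow> real) \<Rightarrow> ('i \<Rightarrow> complex)" where
    "merge = (\<lambda>x. \<lambda>j\<in>J. Complex (x (j, True)) (x (j, False)))"
  have Cplx: "Complex r s = of_real r + \<i> * of_real s" for r s by (simp add: complex_eq_iff)
  have mm: "merge \<in> measurable (Pi\<^sub>M ?I (\<lambda>_. borel)) (Pi\<^sub>M J (\<lambda>_. borel))"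
    unfolding merge_def Cplx by (intro measurable_restrict) measurable
  have su: "(\<Sum>p\<in>?I. u p * coord (Z (fst p)) (snd p)) = (\<Sum>j\<in>J. Complex (u (j, True)) (u (j, False)) \<bullet> Z j)" for u Z
  proof -
    have "(\<Sum>p\<in>?I. u p * coord (Z (fst p)) (snd p)) = (\<Sum>j\<in>J. \<Sum>b\<in>UNIV. u (j, b) * coord (Z j) b)"
      by (simp add: sum.cartesian_product case_prod_unfold)
    also have "\<dots> = (\<Sum>j\<in>J. Complex (u (j, True)) (u (j, False)) \<bullet> Z j)"
      by (intro sum.cong refl) (simp add: UNIV_bool coord_def inner_complex_def)
    finally show ?thesis .
  qed
  have mX: "?X p \<in> borel_measurable M" if "p \<in> ?I" for p using that by (auto intro!: measurable_compose[OF X])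
  have mY: "?Y p \<in> borel_measurable N" if "p \<in> ?I" for p using that by (auto intro!: measurable_compose[OF Y])
  have main: "distr M (Pi\<^sub>M ?I (\<lambda>_. borel)) (\<lambda>x. \<lambda>p\<in>?I. ?X p x) = distr N (Pi\<^sub>M ?I (\<lambda>_. borel)) (\<lambda>y. \<lambda>p\<in>?I. ?Y p y)"
  proof (rule finite_dim_distr_eqI[OF M N _ mX mY])
    show "(\<integral>x. iexp (\<Sum>p\<in>?I. u p * ?X p x) \<partial>M) = (\<integral>y. iexp (\<Sum>p\<in>?I. u p * ?Y p y) \<partial>N)" for u
      unfolding su[of u "\<lambda>i. X i x" for x] su[of u "\<lambda>i. Y i y" for y] by (rule eq)
  qed (use fin in auto)
  have mXI: "(\<lambda>x. \<lambda>p\<in>?I. ?X p x) \<in> measurable M (Pi\<^sub>M ?I (\<lambda>_. borel))" using mX by (intro measurable_restrict) auto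
  have mYI: "(\<lambda>x. \<lambda>p\<in>?I. ?Y p x) \<in> measurable N (Pi\<^sub>M ?I (\<lambda>_. borel))" using mY by (intro measurable_restrict) auto
  have "distr M (Pi\<^sub>M J (\<lambda>_. borel)) (merge \<circ> (\<lambda>x. \<lambda>p\<in>?I. ?X p x)) = distr N (Pi\<^sub>M J (\<lambda>_. borel)) (merge \<circ> (\<lambda>y. \<lambda>p\<in>?I. ?Y p y))"
    using distr_distr[OF mm mXI] distr_distr[OF mm mYI] main by simp
  moreover have "merge \<circ> (\<lambda>x. \<lambda>p\<in>?I. ?X p x) = (\<lambda>x. \<lambda>j\<in>J. X j x)"
    by (auto simp: merge_def fun_eq_iff coord_def)
  moreover have "merge \<circ> (\<lambda>x. \<lambda>p\<in>?I. ?Y p x) = (\<lambda>x. \<lambda>j\<in>J. Y j x)"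
    by (auto simp: merge_def fun_eq_iff coord_def)
  ultimately show ?thesis by simp
qed

lemma complex_distr_eqI:
  fixes X :: "'a \<Rightarrow> complex" and Y :: "'b \<Rightarrow> complex"
  assumes "finite_measure M" "finite_measure N"
    and X[measurable]: "X \<in> borel_measurable M" and Y[measurable]: "Y \<in> borel_measurable N"
    and eq: "\<And>u. (\<integral>x. iexp (u \<bullet> X x) \<partial>M) = (\<integral>y. iexp (u \<bullet> Y y) \<partial>N)"
  shows "distr M borel X = distr N borel Y"
proof -
  let ?J = "{()}"
  have d: "distr M (Pi\<^sub>M ?J (\<lambda>_. borel)) (\<lambda>x. \<lambda>j\<in>?J. X x) = distr N (Pi\<^sub>M ?J (\<lambda>_. borel)) (\<lambda>y. \<lambda>j\<in>?J. Y y)"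
    by (rule complex_family_distr_eqI) (use assms in auto)
  have ev: "(\<lambda>x::unit \<Rightarrow> complex. x ()) \<in> measurable (Pi\<^sub>M ?J (\<lambda>_. borel)) borel" by measurable
  have mX: "(\<lambda>x. \<lambda>j\<in>?J. X x) \<in> measurable M (Pi\<^sub>M ?J (\<lambda>_. borel))" by (intro measurable_restrict) auto
  have mY: "(\<lambda>x. \<lambda>j\<in>?J. Y x) \<in> measurable N (Pi\<^sub>M ?J (\<lambda>_. borel))" by (intro measurable_restrict) auto
  have "distr M borel ((\<lambda>x. x ()) \<circ> (\<lambda>x. \<lambda>j\<in>?J. X x)) = distr N borel ((\<lambda>x. x ()) \<circ> (\<lambda>x. \<lambda>j\<in>?J. Y x))"
    using distr_distr[OF ev mX] distr_distr[OF ev mY] d by simp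
  thus ?thesis by (simp add: comp_def)
qed

section \<open>The real part of the exponent\<close>

text \<open>For a symmetric Levy measure, without drift and Gaussian part, this is minus the Levy-Khintchine exponent.\<close>

definition cos_exponent :: "'a::euclidean_space measure \<Rightarrow> 'a \<Rightarrow> real" where
  "cos_exponent \<nu> z = (\<integral>x. 1 - cos (z \<bullet> x) \<partial>\<nu>)"

lemma one_minus_cos_sin: "1 - cos (y::real) = 2 * (sin (y / 2))\<^sup>2"
  using cos_double_sin[of "y / 2"] by simp

lemma one_minus_cos_le_square: "1 - cos (y::real) \<le> y\<^sup>2 / 2"
proof -
  have "(sin (y / 2))\<^sup>2 \<le> (y / 2)\<^sup>2"
    using abs_sin_x_le_abs_x[of "y/2"] by (metis power2_abs power_mono abs_ge_zero)
  thus ?thesis by (simp add: one_minus_cos_sin power_divide)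
qed

text \<open>With \<open>1 - cos y = 2 sin\<^sup>2 (y / 2)\<close> and \<open>\<bar>sin (x + y)\<bar> \<le> \<bar>sin x\<bar> + \<bar>sin y\<bar>\<close> this is Young's inequality
  \<open>2 p q \<le> e p\<^sup>2 + q\<^sup>2 / e\<close>.\<close>

lemma one_minus_cos_add_le:
  fixes x y e :: real assumes e: "e > 0"
  shows "1 - cos (x + y) \<le> (1 + e) * (1 - cos x) + (1 + 1 / e) * (1 - cos y)"
proof -
  let ?a = "\<bar>sin (x / 2)\<bar>" and ?b = "\<bar>sin (y / 2)\<bar>"
  have "\<bar>sin (x / 2 + y / 2)\<bar> \<le> \<bar>sin (x/2) * cos (y/2)\<bar> + \<bar>cos (x/2) * sin (y/2)\<bar>"
    unfolding sin_add by linarith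
  also have "\<dots> \<le> ?a * 1 + 1 * ?b"
    unfolding abs_mult by (intro add_mono mult_mono) auto
  finally have le: "\<bar>sin ((x + y) / 2)\<bar> \<le> ?a + ?b" by (simp add: add_divide_distrib)
  have "0 \<le> (e * ?a - ?b)\<^sup>2 / e" using e by simp
  also have "\<dots> = e * ?a\<^sup>2 + ?b\<^sup>2 / e - 2 * ?a * ?b"
    using e by (simp add: power2_eq_square field_simps)
  finally have "(?a + ?b)\<^sup>2 \<le> (1 + e) * ?a\<^sup>2 + (1 + 1 / e) * ?b\<^sup>2"
    by (simp add: power2_eq_square algebra_simps)
  moreover have "\<bar>sin ((x + y) / 2)\<bar>\<^sup>2 \<le> (?a + ?b)\<^sup>2" using le by (intro power_mono) auto
  ultimately have "(sin ((x + y) / 2))\<^sup>2 \<le> (1 + e) * (sin (x/2))\<^sup>2 + (1 + 1 / e) * (sin (y/2))\<^sup>2"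
    by simp
  thus ?thesis unfolding one_minus_cos_sin by (simp add: algebra_simps)
qed

lemma levy_measure_measurable:
  assumes "levy_measure \<nu>" "f \<in> borel_measurable borel" shows "f \<in> borel_measurable \<nu>"
  using assms measurable_cong_sets[of \<nu> borel] unfolding levy_measure_def by auto

lemma levy_measure_integrable_min:
  assumes "levy_measure \<nu>" shows "integrable \<nu> (\<lambda>x. min 1 ((norm x)\<^sup>2))"
  using assms levy_measure_measurable[OF assms, of "\<lambda>x. min 1 ((norm x)\<^sup>2)"]
  unfolding levy_measure_def by (intro integrableI_bounded) auto

lemma levy_measure_integrable_bounded:
  fixes f :: "'a::euclidean_space \<Rightarrow> 'b::{banach, second_countable_topology}"
  assumes \<nu>: "levy_measure \<nu>" and f: "f \<in> borel_measurable borel"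
    and le: "\<And>x. norm (f x) \<le> K * min 1 ((norm x)\<^sup>2)"
  shows "integrable \<nu> f"
proof (rule Bochner_Integration.integrable_bound)
  show "integrable \<nu> (\<lambda>x. K * min 1 ((norm x)\<^sup>2))" using levy_measure_integrable_min[OF \<nu>] by simp
  show "f \<in> borel_measurable \<nu>" using levy_measure_measurable[OF \<nu> f] .
  show "AE x in \<nu>. norm (f x) \<le> norm (K * min 1 ((norm x)\<^sup>2))"
    using le by (auto intro!: AE_I2 order_trans[OF _ abs_ge_self])
qed

lemma inner_square_le: "(z \<bullet> x)\<^sup>2 \<le> (norm z)\<^sup>2 * (norm (x::'a::real_inner))\<^sup>2"
  using Cauchy_Schwarz_ineq2[of z x] by (metis abs_ge_zero power2_abs power_mono power_mult_distrib)

text \<open>Turns a bound by \<open>2\<close> together with a quadratic bound into a multiple of the function that is integrable for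
  every Levy measure.\<close>

lemma min_scale_le:
  fixes k r y :: real assumes "0 \<le> k" "0 \<le> r" "y \<le> 2" "y \<le> k * r"
  shows "y \<le> max 2 k * min 1 r"
proof (cases "r \<le> 1")
  case True
  have "k * r \<le> max 2 k * r" using assms by (intro mult_right_mono) auto
  with True assms show ?thesis by simp
qed (use assms in auto)

lemma one_minus_cos_inner_le:
  "1 - cos (z \<bullet> x) \<le> max 2 ((norm z)\<^sup>2) * min 1 ((norm (x::'a::real_inner))\<^sup>2)"
proof (rule min_scale_le)
  have "1 - cos (z \<bullet> x) \<le> (z \<bullet> x)\<^sup>2 / 2" by (rule one_minus_cos_le_square)
  also have "\<dots> \<le> (z \<bullet> x)\<^sup>2" by simp
  also have "\<dots> \<le> (norm z)\<^sup>2 * (norm x)\<^sup>2" by (rule inner_square_le)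
  finally show "1 - cos (z \<bullet> x) \<le> (norm z)\<^sup>2 * (norm x)\<^sup>2" .
  show "1 - cos (z \<bullet> x) \<le> 2" using cos_ge_minus_one[of "z \<bullet> x"] by linarith
qed auto

lemma cos_exponent_integrable:
  assumes "levy_measure \<nu>" shows "integrable \<nu> (\<lambda>x. 1 - cos (z \<bullet> x))"
proof (rule levy_measure_integrable_bounded[OF assms])
  show "norm (1 - cos (z \<bullet> x)) \<le> max 2 ((norm z)\<^sup>2) * min 1 ((norm x)\<^sup>2)" for x
    using one_minus_cos_inner_le[of z x] by (simp only: real_norm_def abs_of_nonneg[of "1 - cos (z \<bullet> x)"] cos_le_one diff_ge_0_iff_ge)
qed measurable

lemma cos_exponent_nonneg: "0 \<le> cos_exponent \<nu> z"
  unfolding cos_exponent_def by (intro integral_nonneg_AE AE_I2) simp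

lemma cos_exponent_0 [simp]: "cos_exponent \<nu> 0 = 0"
  unfolding cos_exponent_def by simp

lemma cos_exponent_uminus [simp]: "cos_exponent \<nu> (- z) = cos_exponent \<nu> z"
  unfolding cos_exponent_def by simp

lemma cos_exponent_add_le:
  assumes \<nu>: "levy_measure \<nu>" and e: "e > 0"
  shows "cos_exponent \<nu> (y + z) \<le> (1 + e) * cos_exponent \<nu> y + (1 + 1 / e) * cos_exponent \<nu> z"
proof -
  have "cos_exponent \<nu> (y + z) \<le> (\<integral>x. (1 + e) * (1 - cos (y \<bullet> x)) + (1 + 1 / e) * (1 - cos (z \<bullet> x)) \<partial>\<nu>)"
    unfolding cos_exponent_def
    using cos_exponent_integrable[OF \<nu>] one_minus_cos_add_le[OF e, of "y \<bullet> x" "z \<bullet> x" for x]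
    by (intro integral_mono) (auto simp: inner_add_left[symmetric])
  also have "\<dots> = (1 + e) * cos_exponent \<nu> y + (1 + 1 / e) * cos_exponent \<nu> z"
    unfolding cos_exponent_def using cos_exponent_integrable[OF \<nu>] by simp
  finally show ?thesis .
qed

lemma cos_exponent_continuous:
  assumes \<nu>: "levy_measure \<nu>" shows "continuous_on UNIV (cos_exponent \<nu>)"
proof -
  have "(\<lambda>n. cos_exponent \<nu> (u n)) \<longlonglongrightarrow> cos_exponent \<nu> z" if u: "u \<longlonglongrightarrow> z" for u z
  proof -
    obtain K where K: "\<And>n. norm (u n) \<le> K"
      using Bseq_def u convergentI convergent_imp_Bseq by (metis)
    have "norm (1 - cos (u n \<bullet> x)) \<le> max 2 (K\<^sup>2) * min 1 ((norm x)\<^sup>2)" for n x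
    proof -
      have "norm (1 - cos (u n \<bullet> x)) = 1 - cos (u n \<bullet> x)" by simp
      also have "\<dots> \<le> max 2 ((norm (u n))\<^sup>2) * min 1 ((norm x)\<^sup>2)" by (rule one_minus_cos_inner_le)
      also have "\<dots> \<le> max 2 (K\<^sup>2) * min 1 ((norm x)\<^sup>2)"
        using K[of n] by (intro mult_right_mono max.mono power_mono) auto
      finally show ?thesis .
    qed
    thus ?thesis unfolding cos_exponent_def
      using levy_measure_integrable_min[OF \<nu>] u
      by (intro integral_dominated_convergence[where w="\<lambda>x. max 2 (K\<^sup>2) * min 1 ((norm x)\<^sup>2)"])
        (auto intro!: levy_measure_measurable[OF \<nu>] tendsto_intros)
  qed
  thus ?thesis by (auto simp: continuous_on_eq_continuous_at continuous_at_sequentially comp_def)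
qed

lemma cos_exponent_measurable:
  assumes "levy_measure \<nu>" shows "cos_exponent \<nu> \<in> borel_measurable borel"
  using cos_exponent_continuous[OF assms] by (rule borel_measurable_continuous_onI)

lemma levy_integrand_Re_Im:
  "Re (levy_integrand z x) = - (1 - cos (z \<bullet> x))"
  "Im (levy_integrand z x) = sin (z \<bullet> x) - indicat_real (cball 0 1) x * (z \<bullet> x)"
  unfolding levy_integrand_def by (auto simp: Re_exp Im_exp)

lemma levy_integrand_le:
  "norm (levy_integrand z x) \<le> max 2 ((norm z)\<^sup>2) * min 1 ((norm x)\<^sup>2)"
proof (cases "norm x \<le> 1")
  case True
  have "norm (levy_integrand z x) \<le> \<bar>z \<bullet> x\<bar>\<^sup>2 / 2"
    using iexp_approx1[of "z \<bullet> x" 1] True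
    by (simp add: levy_integrand_def indicator_def diff_diff_eq numeral_2_eq_2)
  also have "\<dots> \<le> (z \<bullet> x)\<^sup>2" by simp
  also have "\<dots> \<le> (norm z)\<^sup>2 * (norm x)\<^sup>2" by (rule inner_square_le)
  also have "\<dots> \<le> max 2 ((norm z)\<^sup>2) * (norm x)\<^sup>2" by (intro mult_right_mono) auto
  finally show ?thesis using True by (simp add: power_le_one_iff)
next
  case False
  have "norm (levy_integrand z x) \<le> 2"
    using norm_triangle_ineq4[of "iexp (z \<bullet> x)" 1] False
    by (simp add: levy_integrand_def indicator_def)
  moreover have "1 \<le> (norm x)\<^sup>2" using False by simp
  ultimately show ?thesis by simp
qed

lemma levy_integrand_measurable: "levy_integrand z \<in> borel_measurable borel"
proof -
  have [measurable]: "cball 0 1 \<in> sets (borel :: 'a::euclidean_space measure)" by simp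
  show ?thesis unfolding levy_integrand_def[abs_def] by measurable
qed

lemma levy_integrand_integrable:
  assumes "levy_measure \<nu>" shows "integrable \<nu> (levy_integrand z)"
  using levy_measure_integrable_bounded[OF assms levy_integrand_measurable levy_integrand_le] .

lemma Re_levy_exponent:
  assumes "levy_measure \<nu>" shows "Re (\<integral>x. levy_integrand z x \<partial>\<nu>) = - cos_exponent \<nu> z"
  unfolding cos_exponent_def integral_Re[OF levy_integrand_integrable[OF assms], symmetric]
    levy_integrand_Re_Im by (simp only: Bochner_Integration.integral_minus)

text \<open>Otherwise \<open>sqrt 2\<close> would be rational.\<close>

lemma cos_both_one:
  assumes "cos (y::real) = 1" "cos (sqrt 2 * y) = 1" shows "y = 0"
proof (rule ccontr)
  assume y: "y \<noteq> 0"
  obtain n :: nat where n: "\<bar>y\<bar> = n * 2 * pi"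
    using assms(1) pi_gt_zero unfolding cos_one_2pi by auto
  obtain m :: nat where m: "\<bar>sqrt 2 * y\<bar> = m * 2 * pi"
    using assms(2) pi_gt_zero unfolding cos_one_2pi by auto
  have "sqrt 2 * n = m" using n m pi_gt_zero by (auto simp: abs_mult)
  hence "(sqrt 2 * n)\<^sup>2 = m\<^sup>2" by simp
  hence "real (2 * n\<^sup>2) = real (m\<^sup>2)" by (simp add: power_mult_distrib)
  hence e: "2 * n\<^sup>2 = m\<^sup>2" using of_nat_eq_iff by blast
  have n0: "n \<noteq> 0" using n y by (intro notI) simp
  have m0: "m \<noteq> 0" using e n0 by (intro notI) simp
  have "multiplicity 2 (2 * n\<^sup>2) = 1 + 2 * multiplicity 2 n"
    using n0 by (simp add: prime_elem_multiplicity_mult_distrib prime_elem_multiplicity_power_distrib)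
  moreover have "multiplicity 2 (m\<^sup>2) = 2 * multiplicity 2 m"
    using m0 by (simp add: prime_elem_multiplicity_power_distrib)
  ultimately have "1 + 2 * multiplicity 2 n = 2 * multiplicity 2 m" using e by simp
  thus False by presburger
qed

text \<open>Let \<open>g z\<close> be the imaginary part of the exponent. By hypothesis \<open>g\<close> is linear, so its second
  differences vanish, and these are the integrals of \<open>sin (z \<bullet> x) * (1 - cos (w \<bullet> x))\<close>. Summing over
  finitely many \<open>w\<close> gives a finite measure \<open>h \<nu>\<close> with real characteristic function; it is symmetric by
  uniqueness. The weight \<open>h\<close> is even and positive off \<open>0\<close>, so dividing by it shows that the odd integrand of \<open>g\<close> has
  integral zero.\<close>

lemma levy_drift_zero:
  fixes \<nu> :: "complex measure"
  assumes \<nu>: "levy_measure \<nu>" and lin: "\<And>z. Im (\<integral>x. levy_integrand z x \<partial>\<nu>) = - (\<gamma> \<bullet> z)"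
  shows "Im (\<integral>x. levy_integrand z x \<partial>\<nu>) = 0"
proof -
  let ?g = "\<lambda>z x::complex. sin (z \<bullet> x) - indicat_real (cball 0 1) x * (z \<bullet> x)"
  have ig: "integrable \<nu> (?g z)" for z
    using integrable_Im[OF levy_integrand_integrable[OF \<nu>, of z]] unfolding levy_integrand_Re_Im .
  have g: "(\<integral>x. ?g z x \<partial>\<nu>) = - (\<gamma> \<bullet> z)" for z
    using lin[of z] unfolding integral_Im[OF levy_integrand_integrable[OF \<nu>], symmetric] levy_integrand_Re_Im .
  have second: "?g z x - (?g (z + w) x + ?g (z - w) x) / 2 = sin (z \<bullet> x) * (1 - cos (w \<bullet> x))" for z w x
    by (simp add: inner_add_left inner_diff_left sin_add sin_diff field_simps)
  have isw: "integrable \<nu> (\<lambda>x. sin (z \<bullet> x) * (1 - cos (w \<bullet> x)))" for z w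
    unfolding second[symmetric] using ig by auto
  have sw: "(\<integral>x. sin (z \<bullet> x) * (1 - cos (w \<bullet> x)) \<partial>\<nu>) = 0" for z w
    unfolding second[symmetric] using ig[of z] ig[of "z + w"] ig[of "z - w"] g
    by (simp add: inner_add_right inner_diff_right)
  \<comment> \<open>two incommensurable frequencies in each coordinate direction, so that \<open>h\<close> vanishes only at \<open>0\<close>\<close>
  define ws where "ws = [1, \<i>, of_real (sqrt 2), of_real (sqrt 2) * \<i>]"
  define h where "h x = (\<Sum>w\<leftarrow>ws. 1 - cos (w \<bullet> x))" for x
  have h_alt: "h = (\<lambda>x. (1 - cos (1 \<bullet> x)) + (1 - cos (\<i> \<bullet> x)) + (1 - cos (of_real (sqrt 2) \<bullet> x)) +
      (1 - cos ((of_real (sqrt 2) * \<i>) \<bullet> x)))"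
    by (rule ext) (simp add: h_def ws_def)
  have hp: "0 \<le> h x" for x
    unfolding h_alt by (intro add_nonneg_nonneg) (simp_all only: diff_ge_0_iff_ge cos_le_one)
  have h0: "x = 0" if "h x = 0" for x
  proof -
    have "cos (1 \<bullet> x) = 1" "cos (\<i> \<bullet> x) = 1" "cos (of_real (sqrt 2) \<bullet> x) = 1" "cos ((of_real (sqrt 2) * \<i>) \<bullet> x) = 1"
      using that cos_le_one[of "1 \<bullet> x"] cos_le_one[of "\<i> \<bullet> x"] cos_le_one[of "of_real (sqrt 2) \<bullet> x"]
        cos_le_one[of "(of_real (sqrt 2) * \<i>) \<bullet> x"] unfolding h_alt by linarith+
    hence "cos (Re x) = 1" "cos (Im x) = 1" "cos (sqrt 2 * Re x) = 1" "cos (sqrt 2 * Im x) = 1"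
      by (auto simp: inner_complex_def)
    thus ?thesis using cos_both_one by (auto simp: complex_eq_iff)
  qed
  have mh: "h \<in> borel_measurable borel" unfolding h_alt by measurable
  have [measurable]: "h \<in> borel_measurable \<nu>" using levy_measure_measurable[OF \<nu> mh] .
  have ih: "integrable \<nu> h" unfolding h_alt by (intro Bochner_Integration.integrable_add cos_exponent_integrable[OF \<nu>])
  define \<mu> where "\<mu> = density \<nu> (\<lambda>x. ennreal (h x))"
  have sets\<mu>: "sets \<mu> = sets borel" using \<nu> by (simp add: \<mu>_def levy_measure_def)
  have m\<mu>: "f \<in> borel_measurable \<mu>" if "f \<in> borel_measurable borel" for f :: "complex \<Rightarrow> 'b::topological_space"
    using that measurable_cong_sets[OF sets\<mu> refl] by auto
  have fin: "finite_measure \<mu>"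
  proof
    have "emeasure \<mu> (space \<mu>) = ennreal (\<integral>x. h x \<partial>\<nu>)"
      unfolding \<mu>_def using ih hp
      by (subst emeasure_density) (auto simp: nn_integral_eq_integral cong: nn_integral_cong)
    thus "emeasure \<mu> (space \<mu>) \<noteq> \<infinity>" by simp
  qed
  interpret \<mu>: finite_measure \<mu> by fact
  have im0: "(\<integral>x. sin (z \<bullet> x) \<partial>\<mu>) = 0" for z
  proof -
    have "(\<integral>x. sin (z \<bullet> x) \<partial>\<mu>) = (\<integral>x. h x * sin (z \<bullet> x) \<partial>\<nu>)"
      unfolding \<mu>_def using hp by (subst integral_density) (auto intro!: levy_measure_measurable[OF \<nu>])
    also have "\<dots> = (\<integral>x. sin (z \<bullet> x) * (1 - cos (1 \<bullet> x)) + sin (z \<bullet> x) * (1 - cos (\<i> \<bullet> x)) +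
        sin (z \<bullet> x) * (1 - cos (of_real (sqrt 2) \<bullet> x)) + sin (z \<bullet> x) * (1 - cos ((of_real (sqrt 2) * \<i>) \<bullet> x)) \<partial>\<nu>)"
      by (intro Bochner_Integration.integral_cong refl) (simp add: h_alt algebra_simps)
    also have "\<dots> = 0"
      by (simp only: Bochner_Integration.integral_add Bochner_Integration.integrable_add isw sw add_0)
    finally show ?thesis .
  qed
  have sym: "distr \<mu> borel (\<lambda>x. x) = distr \<mu> borel uminus"
  proof (rule complex_distr_eqI[OF fin fin])
    show "(\<lambda>x. x) \<in> borel_measurable \<mu>" "uminus \<in> borel_measurable \<mu>" by (auto intro!: m\<mu>)
    fix u
    have i: "integrable \<mu> (\<lambda>x. iexp (u \<bullet> x))" "integrable \<mu> (\<lambda>x. iexp (u \<bullet> (-x)))"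
      by (intro \<mu>.integrable_norm_le[where B=1] m\<mu>; auto)+
    show "(\<integral>x. iexp (u \<bullet> x) \<partial>\<mu>) = (\<integral>x. iexp (u \<bullet> (-x)) \<partial>\<mu>)"
    proof (rule complex_eqI)
      show "Re (\<integral>x. iexp (u \<bullet> x) \<partial>\<mu>) = Re (\<integral>x. iexp (u \<bullet> (-x)) \<partial>\<mu>)"
        unfolding integral_Re[OF i(1), symmetric] integral_Re[OF i(2), symmetric] by (simp add: Re_exp)
      show "Im (\<integral>x. iexp (u \<bullet> x) \<partial>\<mu>) = Im (\<integral>x. iexp (u \<bullet> (-x)) \<partial>\<mu>)"
        unfolding integral_Im[OF i(1), symmetric] integral_Im[OF i(2), symmetric] by (simp add: Im_exp im0)
    qed
  qed
  have mg[measurable]: "?g z \<in> borel_measurable borel" for z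
    using measurable_compose[OF levy_integrand_measurable[of z] borel_measurable_Im] unfolding levy_integrand_Re_Im .
  define F where "F x = ?g z x / h x" for x
  have mF: "F \<in> borel_measurable borel" unfolding F_def using mh by measurable
  have "(\<integral>x. F x \<partial>distr \<mu> borel (\<lambda>x. x)) = (\<integral>x. F x \<partial>distr \<mu> borel uminus)" using sym by simp
  hence "(\<integral>x. F x \<partial>\<mu>) = (\<integral>x. F (-x) \<partial>\<mu>)"
    using mF by (subst (asm) (1 2) integral_distr) (auto intro!: m\<mu>)
  moreover have "F (-x) = - F x" for x
  proof -
    have "h (-x) = h x" "?g z (-x) = - ?g z x" by (simp_all add: h_alt indicator_def)
    thus ?thesis by (simp only: F_def divide_minus_left)
  qed
  ultimately have "(\<integral>x. F x \<partial>\<mu>) = 0" by simp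
  moreover have "(\<integral>x. F x \<partial>\<mu>) = (\<integral>x. h x * F x \<partial>\<nu>)"
    unfolding \<mu>_def using hp by (subst integral_density) (auto intro!: levy_measure_measurable[OF \<nu> mF])
  moreover have "h x * F x = ?g z x" for x
    using h0[of x] by (cases "h x = 0") (auto simp: F_def)
  ultimately have "(\<integral>x. ?g z x \<partial>\<nu>) = 0" by simp
  thus ?thesis unfolding integral_Im[OF levy_integrand_integrable[OF \<nu>], symmetric] levy_integrand_Re_Im .
qed

lemma inner_mult_complex: "z \<bullet> (c * x) = (cnj c * z) \<bullet> (x::complex)"
  by (simp add: inner_complex_def algebra_simps)

section \<open>Rotationally invariant Levy processes\<close>

locale rotation_invariant_levy = prob_space P for P :: "'w measure" +
  fixes L :: "real \<Rightarrow> 'w \<Rightarrow> complex" and \<Lambda> :: "real set \<Rightarrow> 'w \<Rightarrow> complex"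
    and \<gamma> :: complex and \<nu> :: "complex measure"
  assumes levy: "levy_process P L"
    and rotation: "rotationally_invariant_process P L"
    and triplet: "levy_triplet P L \<gamma> (\<lambda>_. 0) \<nu>"
    and random_measure: "levy_random_measure P L \<Lambda>"
begin

abbreviation "\<phi> \<equiv> cos_exponent \<nu>"

lemma \<nu>: "levy_measure \<nu>"
  using triplet by (simp add: levy_triplet_def)

lemma L_measurable [measurable]: "L t \<in> borel_measurable P"
  using levy by (simp add: levy_process_def)

lemma integrable_iexp: "X \<in> borel_measurable P \<Longrightarrow> integrable P (\<lambda>\<omega>. iexp (X \<omega>))"
  by (intro integrable_norm_le[where B=1]) auto

abbreviation "\<Psi> z \<equiv> \<i> * complex_of_real (\<gamma> \<bullet> z) + (\<integral>x. levy_integrand z x \<partial>\<nu>)"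

lemma char_L_triplet: "0 \<le> t \<Longrightarrow> (\<integral>\<omega>. iexp (z \<bullet> L t \<omega>) \<partial>P) = exp (complex_of_real t * \<Psi> z)"
  using triplet by (auto simp: levy_triplet_def)

lemma char_L_rotate:
  assumes c: "norm c = 1"
  shows "(\<integral>\<omega>. iexp ((c * z) \<bullet> L t \<omega>) \<partial>P) = (\<integral>\<omega>. iexp (z \<bullet> L t \<omega>) \<partial>P)"
proof -
  define \<theta> where "\<theta> = Arg2pi (cnj c)"
  have \<theta>: "0 \<le> \<theta>" "\<theta> < 2 * pi" unfolding \<theta>_def by (auto simp: Arg2pi_ge_0 Arg2pi_lt_2pi)
  have e: "exp (\<i> * complex_of_real \<theta>) = cnj c"
    using Arg2pi_eq[of "cnj c"] c unfolding \<theta>_def by simp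
  have "rotationally_invariant P (\<lambda>\<omega>. \<Sum>n<(1::nat). (\<lambda>_. 1) n * L ((\<lambda>_. t) n) \<omega>)"
    by (rule rotation[unfolded rotationally_invariant_process_def, rule_format])
  hence d: "distr P borel (\<lambda>\<omega>. cnj c * L t \<omega>) = distr P borel (L t)"
    using \<theta> unfolding rotationally_invariant_def e[symmetric] by simp
  have "(\<integral>\<omega>. iexp (z \<bullet> (cnj c * L t \<omega>)) \<partial>P) = (\<integral>x. iexp (z \<bullet> x) \<partial>distr P borel (\<lambda>\<omega>. cnj c * L t \<omega>))"
    by (subst integral_distr) auto
  also have "\<dots> = (\<integral>\<omega>. iexp (z \<bullet> L t \<omega>) \<partial>P)"
    unfolding d by (subst integral_distr) auto
  finally show ?thesis by (simp add: inner_mult_complex)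
qed

lemma Re_\<Psi>: "Re (\<Psi> z) = - \<phi> z"
  using Re_levy_exponent[OF \<nu>, of z] by simp

lemma norm_char_L: "norm (\<integral>\<omega>. iexp (z \<bullet> L 1 \<omega>) \<partial>P) = exp (- \<phi> z)"
  using char_L_triplet[of 1 z] Re_\<Psi>[of z] by (simp add: norm_exp_eq_Re)

text \<open>The modulus of the characteristic function at time \<open>1\<close> is \<open>exp (- \<phi> z)\<close>, and rotating the process does not change it.\<close>

lemma \<phi>_rotate: "norm c = 1 \<Longrightarrow> \<phi> (c * z) = \<phi> z"
  using norm_char_L[of "c * z"] norm_char_L[of z] char_L_rotate[of c z 1] by simp

text \<open>Rotation by \<open>-1\<close> conjugates the characteristic function, which is therefore real at all times. If the imaginary
  part of the exponent were \<open>q \<noteq> 0\<close>, the phase \<open>t q\<close> would equal \<open>\<plusminus> pi / 2\<close> at some time \<open>t\<close>.\<close>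

lemma Im_\<Psi>: "Im (\<Psi> z) = 0"
proof (rule ccontr)
  assume n: "Im (\<Psi> z) \<noteq> 0"
  define q where "q = Im (\<Psi> z)"
  define t where "t = pi / (2 * \<bar>q\<bar>)"
  have t: "0 \<le> t" using n by (simp add: t_def)
  have "(\<integral>\<omega>. iexp (((-1) * z) \<bullet> L t \<omega>) \<partial>P) = cnj (\<integral>\<omega>. iexp (z \<bullet> L t \<omega>) \<partial>P)"
    by (subst Bochner_Integration.integral_cnj[symmetric]) (simp add: exp_cnj)
  hence "cnj (\<integral>\<omega>. iexp (z \<bullet> L t \<omega>) \<partial>P) = (\<integral>\<omega>. iexp (z \<bullet> L t \<omega>) \<partial>P)"
    using char_L_rotate[of "-1" z t] by simp
  hence "Im (exp (complex_of_real t * \<Psi> z)) = 0"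
    unfolding char_L_triplet[OF t] by (metis complex_cnj_cancel_iff Reals_cnj_iff complex_is_Real_iff)
  hence "sin (t * q) = 0" by (simp add: Im_exp q_def)
  moreover have "t * q = pi / 2 \<or> t * q = - (pi / 2)"
    using n[folded q_def] by (auto simp: t_def abs_if field_simps)
  hence "sin (t * q) = 1 \<or> sin (t * q) = - 1" by (metis sin_pi_half sin_minus)
  ultimately show False by linarith
qed

lemma exponent_eq: "hflm_exponent \<nu> z = - complex_of_real (\<phi> z)"
proof -
  have "Im (\<integral>x. levy_integrand z x \<partial>\<nu>) = - (\<gamma> \<bullet> z)" for z
    using Im_\<Psi>[of z] by simp
  from levy_drift_zero[OF \<nu> this] show ?thesis
    unfolding hflm_exponent_def by (intro complex_eqI) (simp_all add: Re_levy_exponent[OF \<nu>])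
qed

lemma char_L: "0 \<le> t \<Longrightarrow> (\<integral>\<omega>. iexp (z \<bullet> L t \<omega>) \<partial>P) = exp (- complex_of_real (t * \<phi> z))"
proof -
  assume t: "0 \<le> t"
  have "\<Psi> z = - complex_of_real (\<phi> z)" using Re_\<Psi>[of z] Im_\<Psi>[of z] by (intro complex_eqI) auto
  thus ?thesis using char_L_triplet[OF t, of z] by simp
qed

section \<open>The random measure\<close>

lemma \<Lambda>_measurable: "A \<in> sets borel \<Longrightarrow> bounded A \<Longrightarrow> \<Lambda> A \<in> borel_measurable P"
  using random_measure by (simp add: levy_random_measure_def)

lemma \<Lambda>_disjoint:
  fixes A :: "nat \<Rightarrow> real set"
  assumes "\<And>n. A n \<in> sets borel" "\<And>n. bounded (A n)" "disjoint_family A"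
  shows \<Lambda>_indep: "indep_vars (\<lambda>_. borel) (\<lambda>n. \<Lambda> (A n)) UNIV"
    and \<Lambda>_sums: "bounded (\<Union>n. A n) \<Longrightarrow> AE \<omega> in P. (\<lambda>n. \<Lambda> (A n) \<omega>) sums \<Lambda> (\<Union>n. A n) \<omega>"
  using random_measure assms by (simp_all add: levy_random_measure_def)

text \<open>The constant sequence of empty sets is disjoint, and a convergent series has terms tending to \<open>0\<close>.\<close>

lemma \<Lambda>_empty: "AE \<omega> in P. \<Lambda> {} \<omega> = 0"
proof -
  have "AE \<omega> in P. (\<lambda>n::nat. \<Lambda> {} \<omega>) sums \<Lambda> {} \<omega>"
    using \<Lambda>_sums[of "\<lambda>_. {}"] by (simp add: disjoint_family_on_def)
  thus ?thesis
  proof (rule AE_mp, intro AE_I2 impI)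
    fix \<omega> assume "(\<lambda>n::nat. \<Lambda> {} \<omega>) sums \<Lambda> {} \<omega>"
    hence "(\<lambda>n::nat. \<Lambda> {} \<omega>) \<longlonglongrightarrow> 0" by (intro summable_LIMSEQ_zero sums_summable)
    thus "\<Lambda> {} \<omega> = 0" by (simp add: LIMSEQ_const_iff)
  qed
qed

lemma \<Lambda>_add:
  assumes A: "A \<in> sets borel" "bounded A" and B: "B \<in> sets borel" "bounded B" and AB: "A \<inter> B = {}"
  shows "AE \<omega> in P. \<Lambda> (A \<union> B) \<omega> = \<Lambda> A \<omega> + \<Lambda> B \<omega>"
proof -
  define C where "C n = (if n = 0 then A else if n = 1 then B else {})" for n :: nat
  have U: "(\<Union>n. C n) = A \<union> B" by (auto simp: C_def split: if_splits)
  have "AE \<omega> in P. (\<lambda>n. \<Lambda> (C n) \<omega>) sums \<Lambda> (\<Union>n. C n) \<omega>"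
    using A B AB U by (intro \<Lambda>_sums) (auto simp: C_def disjoint_family_on_def)
  with \<Lambda>_empty show ?thesis
  proof eventually_elim
    case (elim \<omega>)
    have "(\<lambda>n. \<Lambda> (C n) \<omega>) sums (\<Sum>n\<in>{0,1}. \<Lambda> (C n) \<omega>)"
      using elim(1) by (intro sums_finite) (auto simp: C_def)
    with elim(2) have "\<Lambda> (\<Union>n. C n) \<omega> = (\<Sum>n\<in>{0,1}. \<Lambda> (C n) \<omega>)" by (rule sums_unique2)
    thus ?case by (simp add: U) (simp add: C_def)
  qed
qed

lemma char_independent_sum:
  fixes A :: "nat \<Rightarrow> real set"
  assumes A: "\<And>n. A n \<in> sets borel" "\<And>n. bounded (A n)" "disjoint_family A"
  shows "(\<integral>\<omega>. iexp (\<Sum>i<n. w i \<bullet> \<Lambda> (A i) \<omega>) \<partial>P) = (\<Prod>i<n. \<integral>\<omega>. iexp (w i \<bullet> \<Lambda> (A i) \<omega>) \<partial>P)"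
proof -
  have "indep_vars (\<lambda>_. borel) (\<lambda>i \<omega>. iexp (w i \<bullet> \<Lambda> (A i) \<omega>)) {..<n}"
    by (rule indep_vars_compose2[OF indep_vars_subset[OF \<Lambda>_indep[OF A]]]) auto
  hence "(\<integral>\<omega>. (\<Prod>i<n. iexp (w i \<bullet> \<Lambda> (A i) \<omega>)) \<partial>P) = (\<Prod>i<n. \<integral>\<omega>. iexp (w i \<bullet> \<Lambda> (A i) \<omega>) \<partial>P)"
    using \<Lambda>_measurable[OF A(1,2)]
    by (intro indep_vars_lebesgue_integral) (auto intro!: integrable_iexp borel_measurable_inner)
  thus ?thesis by (simp add: exp_sum sum_distrib_left)
qed

lemma char_\<Lambda>_Ioc:
  assumes "s \<le> t"
  shows "(\<integral>\<omega>. iexp (z \<bullet> \<Lambda> {s<..t} \<omega>) \<partial>P) = exp (- complex_of_real ((t - s) * \<phi> z))"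
proof (cases "s = t")
  case True
  have m[measurable]: "\<Lambda> {} \<in> borel_measurable P" by (intro \<Lambda>_measurable) auto
  have "(\<integral>\<omega>. iexp (z \<bullet> \<Lambda> {} \<omega>) \<partial>P) = (\<integral>\<omega>. 1 \<partial>P)"
    using \<Lambda>_empty by (intro integral_cong_AE) auto
  thus ?thesis using True by (simp add: prob_space)
next
  case False
  with assms have st: "s < t" by simp
  have m[measurable]: "\<Lambda> {s<..t} \<in> borel_measurable P" by (intro \<Lambda>_measurable) auto
  have "AE \<omega> in P. \<Lambda> {s<..t} \<omega> = L t \<omega> - L s \<omega>"
    using random_measure st by (simp add: levy_random_measure_def)
  hence "(\<integral>\<omega>. iexp (z \<bullet> \<Lambda> {s<..t} \<omega>) \<partial>P) = (\<integral>\<omega>. iexp (z \<bullet> (L t \<omega> - L s \<omega>)) \<partial>P)"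
    by (intro integral_cong_AE) auto
  also have "\<dots> = (\<integral>x. iexp (z \<bullet> x) \<partial>distr P borel (\<lambda>\<omega>. L (s + (t - s)) \<omega> - L s \<omega>))"
    by (subst integral_distr) auto
  also have "distr P borel (\<lambda>\<omega>. L (s + (t - s)) \<omega> - L s \<omega>) = distr P borel (L (t - s))"
    using levy st unfolding levy_process_def by (metis diff_ge_0_iff_ge less_imp_le)
  also have "(\<integral>x. iexp (z \<bullet> x) \<partial>distr P borel (L (t - s))) = (\<integral>\<omega>. iexp (z \<bullet> L (t - s) \<omega>) \<partial>P)"
    by (subst integral_distr) auto
  also have "\<dots> = exp (- complex_of_real ((t - s) * \<phi> z))" using st by (intro char_L) auto
  finally show ?thesis .
qed

text \<open>Inside a fixed interval \<open>\<Omega>\<close> the sets that satisfy the formula form a Dynkin system: countable additivity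
  and independence handle disjoint unions, and complements work because an exponential never vanishes. Half-open
  intervals satisfy it by stationarity of the increments.\<close>

lemma char_\<Lambda>:
  assumes "A \<in> sets borel" "bounded A"
  shows "(\<integral>\<omega>. iexp (z \<bullet> \<Lambda> A \<omega>) \<partial>P) = exp (- complex_of_real (measure lborel A * \<phi> z))"
proof -
  from assms obtain N where N: "0 < N" "\<And>x. x \<in> A \<Longrightarrow> \<bar>x\<bar> < N"
    unfolding bounded_pos_less by auto
  define \<Omega> where "\<Omega> = {-N<..N}"
  let ?ok = "\<lambda>C. (\<integral>\<omega>. iexp (z \<bullet> \<Lambda> (C \<inter> \<Omega>) \<omega>) \<partial>P) = exp (- complex_of_real (measure lborel (C \<inter> \<Omega>) * \<phi> z))"
  have bd: "bounded (C \<inter> \<Omega>)" for C by (rule bounded_subset[of \<Omega>]) (auto simp: \<Omega>_def)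
  have [measurable]: "\<Omega> \<in> sets borel" by (simp add: \<Omega>_def)
  have fin: "emeasure lborel (C \<inter> \<Omega>) < \<infinity>" for C
    using emeasure_bounded_finite[OF bd] by simp
  let ?G = "range (\<lambda>(a, b). {a<..b::real})"
  have sb: "sets borel = sigma_sets UNIV ?G"
    by (subst borel_sigma_sets_Ioc) (simp add: sets_measure_of)
  have G: "Int_stable ?G" unfolding Int_stable_def by (auto simp: Int_greaterThanAtMost)
  have G_sub: "?G \<subseteq> Pow UNIV" by simp
  have A: "A \<in> sigma_sets UNIV ?G" using assms sb by simp
  have "?ok A"
    using G G_sub A
  proof (induction A rule: sigma_sets_induct_disjoint)
    case (basic C)
    then obtain a b where C: "C = {a<..b}" by auto
    have "C \<inter> \<Omega> = {max a (-N)<..max (max a (-N)) (min b N)}" unfolding C \<Omega>_def by auto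
    then show ?case by (simp add: char_\<Lambda>_Ioc)
  next
    case empty
    show ?case using char_\<Lambda>_Ioc[of 0 0] by simp
  next
    case (compl C)
    have C[measurable]: "C \<in> sets borel" using compl sb by simp
    let ?D = "(UNIV - C) \<inter> \<Omega>"
    define F where "F n = (if n = 0 then C \<inter> \<Omega> else if n = Suc 0 then ?D else {})" for n :: nat
    have "(\<integral>\<omega>. iexp (\<Sum>i<2. z \<bullet> \<Lambda> (F i) \<omega>) \<partial>P) = (\<Prod>i<2. \<integral>\<omega>. iexp (z \<bullet> \<Lambda> (F i) \<omega>) \<partial>P)"
      by (rule char_independent_sum) (auto simp: F_def disjoint_family_on_def bd)
    hence p: "(\<integral>\<omega>. iexp (z \<bullet> \<Lambda> (C \<inter> \<Omega>) \<omega> + z \<bullet> \<Lambda> ?D \<omega>) \<partial>P) =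
      (\<integral>\<omega>. iexp (z \<bullet> \<Lambda> (C \<inter> \<Omega>) \<omega>) \<partial>P) * (\<integral>\<omega>. iexp (z \<bullet> \<Lambda> ?D \<omega>) \<partial>P)"
      by (simp add: numeral_2_eq_2 F_def)
    have U: "C \<inter> \<Omega> \<union> ?D = \<Omega>" by auto
    have [measurable]: "\<Lambda> \<Omega> \<in> borel_measurable P" "\<Lambda> (C \<inter> \<Omega>) \<in> borel_measurable P" "\<Lambda> ?D \<in> borel_measurable P"
      using bd[of UNIV] bd by (auto intro!: \<Lambda>_measurable)
    have "AE \<omega> in P. \<Lambda> (C \<inter> \<Omega> \<union> ?D) \<omega> = \<Lambda> (C \<inter> \<Omega>) \<omega> + \<Lambda> ?D \<omega>"
      by (rule \<Lambda>_add) (auto simp: bd)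
    hence "(\<integral>\<omega>. iexp (z \<bullet> \<Lambda> \<Omega> \<omega>) \<partial>P) = (\<integral>\<omega>. iexp (z \<bullet> \<Lambda> (C \<inter> \<Omega>) \<omega> + z \<bullet> \<Lambda> ?D \<omega>) \<partial>P)"
      unfolding U by (intro integral_cong_AE) (auto simp: inner_add_right)
    hence "exp (- complex_of_real (2 * N * \<phi> z)) =
       exp (- complex_of_real (measure lborel (C \<inter> \<Omega>) * \<phi> z)) * (\<integral>\<omega>. iexp (z \<bullet> \<Lambda> ?D \<omega>) \<partial>P)"
      using char_\<Lambda>_Ioc[of "-N" N z] N(1) unfolding p compl.IH \<Omega>_def[symmetric] by simp
    moreover have "measure lborel \<Omega> = measure lborel (C \<inter> \<Omega>) + measure lborel ?D"
      using fin[of C] fin[of "UNIV - C"] measure_Union[of lborel "C \<inter> \<Omega>" ?D] unfolding U by fastforce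
    hence "complex_of_real (2 * N * \<phi> z) = complex_of_real (measure lborel (C \<inter> \<Omega>) * \<phi> z) + complex_of_real (measure lborel ?D * \<phi> z)"
      using N(1) by (simp add: \<Omega>_def algebra_simps flip: of_real_add of_real_mult)
    ultimately show ?case by (simp add: exp_add exp_minus field_simps)
  next
    case (union F)
    have F[measurable]: "F n \<in> sets borel" for n using union sb by auto
    let ?F = "\<lambda>n. F n \<inter> \<Omega>"
    have U: "(\<Union>n. ?F n) = (\<Union>n. F n) \<inter> \<Omega>" by auto
    have dF: "disjoint_family ?F" using union(1) by (auto simp: disjoint_family_on_def)
    have mF[measurable]: "\<Lambda> (?F n) \<in> borel_measurable P" for n by (intro \<Lambda>_measurable bd) auto
    have mU[measurable]: "\<Lambda> ((\<Union>n. F n) \<inter> \<Omega>) \<in> borel_measurable P" by (intro \<Lambda>_measurable bd) auto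
    have "AE \<omega> in P. (\<lambda>n. \<Lambda> (?F n) \<omega>) sums \<Lambda> (\<Union>n. ?F n) \<omega>"
      by (rule \<Lambda>_sums) (auto simp: bd dF U)
    hence "AE \<omega> in P. (\<lambda>n. iexp (\<Sum>i<n. z \<bullet> \<Lambda> (?F i) \<omega>)) \<longlonglongrightarrow> iexp (z \<bullet> \<Lambda> ((\<Union>n. F n) \<inter> \<Omega>) \<omega>)"
    proof eventually_elim
      case (elim \<omega>)
      then show ?case unfolding U sums_def inner_sum_right[symmetric] by (intro tendsto_intros)
    qed
    hence lim1: "(\<lambda>n. \<integral>\<omega>. iexp (\<Sum>i<n. z \<bullet> \<Lambda> (?F i) \<omega>) \<partial>P) \<longlonglongrightarrow> (\<integral>\<omega>. iexp (z \<bullet> \<Lambda> ((\<Union>n. F n) \<inter> \<Omega>) \<omega>) \<partial>P)"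
      by (intro integral_dominated_convergence[where w="\<lambda>_. 1"]) auto
    have fac: "(\<integral>\<omega>. iexp (\<Sum>i<n. z \<bullet> \<Lambda> (?F i) \<omega>) \<partial>P) = exp (- complex_of_real ((\<Sum>i<n. measure lborel (?F i)) * \<phi> z))" for n
      by (subst char_independent_sum) (auto simp: bd dF union.IH exp_sum sum_negf sum_distrib_right simp flip: exp_sum)
    have "(\<lambda>n. measure lborel (?F n)) sums measure lborel (\<Union>n. ?F n)"
      using fin[of "\<Union>n. F n"] by (intro measure_UNION dF) (auto simp: U)
    hence "(\<lambda>n. exp (- complex_of_real ((\<Sum>i<n. measure lborel (?F i)) * \<phi> z))) \<longlonglongrightarrow>
       exp (- complex_of_real (measure lborel ((\<Union>n. F n) \<inter> \<Omega>) * \<phi> z))"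
      unfolding U sums_def by (intro tendsto_intros)
    with lim1 show ?case unfolding fac by (rule LIMSEQ_unique)
  qed
  moreover have "A \<inter> \<Omega> = A" using N(2) by (fastforce simp: \<Omega>_def)
  ultimately show ?thesis by simp
qed

end

section \<open>Simple integrals without disjointness\<close>

text \<open>Representations whose sets may overlap. They make sums of simple functions concatenations of lists.\<close>

definition bounded_rep :: "simple_rep \<Rightarrow> bool" where
  "bounded_rep g \<longleftrightarrow> (\<forall>(z, A) \<in> set g. A \<in> sets borel \<and> bounded A)"

lemma bounded_rep_Nil [simp]: "bounded_rep []"
  and bounded_rep_Cons [simp]: "bounded_rep ((z, A) # g) \<longleftrightarrow> A \<in> sets borel \<and> bounded A \<and> bounded_rep g"
  and bounded_rep_append [simp]: "bounded_rep (g @ g') \<longleftrightarrow> bounded_rep g \<and> bounded_rep g'"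
  by (auto simp: bounded_rep_def)

lemma is_simple_rep_iff: "is_simple_rep g \<longleftrightarrow> bounded_rep g \<and> sorted_wrt disjnt (map snd g)"
  by (simp add: is_simple_rep_def bounded_rep_def)

definition scale_rep :: "complex \<Rightarrow> simple_rep \<Rightarrow> simple_rep" where
  "scale_rep c g = map (\<lambda>(z, A). (c * z, A)) g"

lemma simple_fun_simps [simp]:
  "simple_fun [] s = 0"
  "simple_fun ((z, A) # g) s = z * indicator A s + simple_fun g s"
  "simple_fun (g @ g') s = simple_fun g s + simple_fun g' s"
  by (auto simp: simple_fun_def)

lemma simple_fun_scale [simp]: "simple_fun (scale_rep c g) s = c * simple_fun g s"
  by (induction g) (auto simp: scale_rep_def algebra_simps)

lemma simple_integral_simps [simp]:
  "simple_integral \<Lambda> [] B \<omega> = 0"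
  "simple_integral \<Lambda> ((z, A) # g) B \<omega> = z * \<Lambda> (B \<inter> A) \<omega> + simple_integral \<Lambda> g B \<omega>"
  "simple_integral \<Lambda> (g @ g') B \<omega> = simple_integral \<Lambda> g B \<omega> + simple_integral \<Lambda> g' B \<omega>"
  by (auto simp: simple_integral_def)

lemma simple_integral_scale [simp]: "simple_integral \<Lambda> (scale_rep c g) B \<omega> = c * simple_integral \<Lambda> g B \<omega>"
  by (induction g) (auto simp: scale_rep_def algebra_simps)

lemma bounded_rep_scale [simp]: "bounded_rep (scale_rep c g) \<longleftrightarrow> bounded_rep g"
  by (induction g) (auto simp: scale_rep_def bounded_rep_def)

lemma simple_fun_measurable: "bounded_rep g \<Longrightarrow> simple_fun g \<in> borel_measurable borel"
proof (induction g)
  case Nil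
  have "simple_fun [] = (\<lambda>_. 0)" by auto
  then show ?case by simp
next
  case (Cons p g)
  obtain z A where p: "p = (z, A)" by (cases p)
  have "simple_fun (p # g) = (\<lambda>s. z * indicator A s + simple_fun g s)" by (auto simp: p)
  then show ?case using Cons p by (auto intro!: borel_measurable_add borel_measurable_times borel_measurable_indicator)
qed

text \<open>Adds \<open>z * indicator A\<close> to a disjoint representation by splitting \<open>A\<close> along its sets.\<close>

fun insert_piece :: "complex \<Rightarrow> real set \<Rightarrow> simple_rep \<Rightarrow> simple_rep" where
  "insert_piece z A [] = [(z, A)]"
| "insert_piece z A ((w, D) # d) = (z + w, A \<inter> D) # (w, D - A) # insert_piece z (A - D) d"

fun disjointify :: "simple_rep \<Rightarrow> simple_rep" where
  "disjointify [] = []"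
| "disjointify ((z, A) # g) = insert_piece z A (disjointify g)"

lemma insert_piece_subset: "D \<in> snd ` set (insert_piece z A d) \<Longrightarrow> D \<subseteq> A \<union> \<Union> (snd ` set d)"
proof (induction z A d rule: insert_piece.induct)
  case (2 z A w E d)
  consider "D = A \<inter> E" | "D = E - A" | "D \<in> snd ` set (insert_piece z (A - E) d)"
    using 2(2) by auto
  then show ?case
  proof cases
    case 3
    from 2(1)[OF this] show ?thesis by auto
  qed auto
qed simp

lemma insert_piece_simple_rep:
  "is_simple_rep d \<Longrightarrow> A \<in> sets borel \<Longrightarrow> bounded A \<Longrightarrow> is_simple_rep (insert_piece z A d)"
proof (induction z A d rule: insert_piece.induct)
  case (1 z A)
  then show ?case by (simp add: is_simple_rep_iff)
next
  case (2 z A w D d)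
  have d: "is_simple_rep d" "D \<in> sets borel" "bounded D" and disj: "\<And>E. E \<in> snd ` set d \<Longrightarrow> disjnt D E"
    using 2(2) by (auto simp: is_simple_rep_iff)
  have IH: "is_simple_rep (insert_piece z (A - D) d)"
    using 2 d by (auto intro: bounded_subset)
  have "disjnt (A \<inter> D) E \<and> disjnt (D - A) E" if "E \<in> snd ` set (insert_piece z (A - D) d)" for E
  proof -
    have "disjnt D (\<Union> (snd ` set d))" using disj by (simp add: disjnt_Union2)
    with insert_piece_subset[OF that] show ?thesis by (auto simp: disjnt_iff)
  qed
  thus ?case using IH d 2(3,4)
    by (auto simp: is_simple_rep_iff disjnt_def intro: bounded_subset)
qed

lemma disjointify_simple_rep: "bounded_rep g \<Longrightarrow> is_simple_rep (disjointify g)"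
  by (induction g rule: disjointify.induct) (auto intro: insert_piece_simple_rep simp: is_simple_rep_iff[of "[]"])

lemma simple_fun_insert_piece: "simple_fun (insert_piece z A d) s = z * indicator A s + simple_fun d s"
  by (induction z A d rule: insert_piece.induct) (auto simp: indicator_def algebra_simps)

lemma simple_fun_disjointify [simp]: "simple_fun (disjointify g) s = simple_fun g s"
  by (induction g rule: disjointify.induct) (auto simp: simple_fun_insert_piece)

text \<open>At most one of the disjoint sets contains \<open>s\<close>.\<close>

lemma disjoint_simple_fun_apply:
  assumes "sorted_wrt disjnt (map snd d)" and f0: "f 0 = (0::real)"
  shows "f (simple_fun d s) = (\<Sum>(w, D)\<leftarrow>d. indicator D s * f w)"
  using assms(1)
proof (induction d)
  case (Cons p d)
  obtain w D where p: "p = (w, D)" by (cases p)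
  show ?case
  proof (cases "s \<in> D")
    case True
    have "\<forall>(v, E)\<in>set d. s \<notin> E" using Cons.prems True p by (force simp: disjnt_iff)
    hence z: "(\<Sum>(w, D)\<leftarrow>d. indicator D s * f w) = 0" "simple_fun d s = 0"
      by (induction d) (auto simp: f0)
    show ?thesis using True by (simp add: p z)
  qed (use Cons p in auto)
qed (simp add: f0)

context rotation_invariant_levy
begin

lemma \<Lambda>_Int_measurable: "A \<in> sets borel \<Longrightarrow> bounded A \<Longrightarrow> B \<in> sets borel \<Longrightarrow> \<Lambda> (B \<inter> A) \<in> borel_measurable P"
  by (intro \<Lambda>_measurable sets.Int) (auto intro: bounded_subset)

lemma simple_integral_measurable:
  "bounded_rep g \<Longrightarrow> B \<in> sets borel \<Longrightarrow> simple_integral \<Lambda> g B \<in> borel_measurable P"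
proof (induction g)
  case Nil
  have "simple_integral \<Lambda> [] B = (\<lambda>_. 0)" by auto
  then show ?case by simp
next
  case (Cons p g)
  obtain z A where p: "p = (z, A)" by (cases p)
  have "simple_integral \<Lambda> (p # g) B = (\<lambda>\<omega>. z * \<Lambda> (B \<inter> A) \<omega> + simple_integral \<Lambda> g B \<omega>)" by (auto simp: p)
  then show ?case using Cons p by (auto intro!: borel_measurable_add borel_measurable_times \<Lambda>_Int_measurable)
qed

lemma simple_integral_insert_piece:
  assumes "is_simple_rep d" "A \<in> sets borel" "bounded A" and B: "B \<in> sets borel"
  shows "AE \<omega> in P. simple_integral \<Lambda> (insert_piece z A d) B \<omega> = z * \<Lambda> (B \<inter> A) \<omega> + simple_integral \<Lambda> d B \<omega>"
  using assms(1-3)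
proof (induction z A d rule: insert_piece.induct)
  case (2 z A w D d)
  have d: "is_simple_rep d" "D \<in> sets borel" "bounded D"
    using 2(2) by (auto simp: is_simple_rep_iff)
  have IH: "AE \<omega> in P. simple_integral \<Lambda> (insert_piece z (A - D) d) B \<omega> =
      z * \<Lambda> (B \<inter> (A - D)) \<omega> + simple_integral \<Lambda> d B \<omega>"
    using 2 d by (auto intro: bounded_subset)
  have split: "AE \<omega> in P. \<Lambda> (B \<inter> E) \<omega> = \<Lambda> (B \<inter> (E \<inter> F)) \<omega> + \<Lambda> (B \<inter> (E - F)) \<omega>"
    if "E \<in> sets borel" "bounded E" "F \<in> sets borel" for E F
  proof -
    have "B \<inter> E = (B \<inter> (E \<inter> F)) \<union> (B \<inter> (E - F))" by auto
    moreover have "AE \<omega> in P. \<Lambda> ((B \<inter> (E \<inter> F)) \<union> (B \<inter> (E - F))) \<omega> = \<Lambda> (B \<inter> (E \<inter> F)) \<omega> + \<Lambda> (B \<inter> (E - F)) \<omega>"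
      using that B by (intro \<Lambda>_add) (auto intro: bounded_subset)
    ultimately show ?thesis by simp
  qed
  from IH split[OF 2(3,4) d(2)] split[OF d(2,3) 2(3)] show ?case
    by eventually_elim (simp add: Int_commute algebra_simps)
qed simp

lemma simple_integral_disjointify:
  assumes "bounded_rep g" and B: "B \<in> sets borel"
  shows "AE \<omega> in P. simple_integral \<Lambda> (disjointify g) B \<omega> = simple_integral \<Lambda> g B \<omega>"
  using assms(1)
proof (induction g rule: disjointify.induct)
  case (2 z A g)
  hence "AE \<omega> in P. simple_integral \<Lambda> (disjointify g) B \<omega> = simple_integral \<Lambda> g B \<omega>" by simp
  moreover have "AE \<omega> in P. simple_integral \<Lambda> (insert_piece z A (disjointify g)) B \<omega> = z * \<Lambda> (B \<inter> A) \<omega> + simple_integral \<Lambda> (disjointify g) B \<omega>"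
    using 2(2) B by (intro simple_integral_insert_piece disjointify_simple_rep) auto
  ultimately show ?case by eventually_elim simp
qed simp

text \<open>The integral of this density is the exponent of the stochastic integral of \<open>g\<close>; the conjugate arises from
  \<open>z \<bullet> (c x) = (cnj c z) \<bullet> x\<close>.\<close>

abbreviation energy_density :: "complex \<Rightarrow> (real \<Rightarrow> complex) \<Rightarrow> real \<Rightarrow> real" where
  "energy_density z g s \<equiv> \<phi> (cnj (g s) * z)"

lemma \<phi>_measurable [measurable]: "\<phi> \<in> borel_measurable borel"
  by (rule cos_exponent_measurable[OF \<nu>])

lemma char_disjoint_simple_integral:
  assumes d: "is_simple_rep d" and B[measurable]: "B \<in> sets borel"
  shows "has_bochner_integral lborel (\<lambda>s. indicator B s * energy_density z (simple_fun d) s)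
           (\<Sum>(w, D)\<leftarrow>d. measure lborel (B \<inter> D) * \<phi> (cnj w * z))"
    and "(\<integral>\<omega>. iexp (z \<bullet> simple_integral \<Lambda> d B \<omega>) \<partial>P) =
           exp (- complex_of_real (\<Sum>(w, D)\<leftarrow>d. measure lborel (B \<inter> D) * \<phi> (cnj w * z)))"
proof -
  have bd: "\<And>w D. (w, D) \<in> set d \<Longrightarrow> D \<in> sets borel \<and> bounded D" and dj: "sorted_wrt disjnt (map snd d)"
    using d unfolding is_simple_rep_def by auto
  have "energy_density z (simple_fun d) s = (\<Sum>(w, D)\<leftarrow>d. indicator D s * \<phi> (cnj w * z))" for s
    by (rule disjoint_simple_fun_apply[OF dj, where f="\<lambda>w. \<phi> (cnj w * z)"]) simp
  hence eq: "(\<lambda>s. indicator B s * energy_density z (simple_fun d) s) =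
      (\<lambda>s. \<Sum>(w, D)\<leftarrow>d. indicator (B \<inter> D) s * \<phi> (cnj w * z))"
    by (auto simp: fun_eq_iff indicator_inter_arith sum_list_const_mult[symmetric] case_prod_unfold mult.assoc)
  show "has_bochner_integral lborel (\<lambda>s. indicator B s * energy_density z (simple_fun d) s)
     (\<Sum>(w, D)\<leftarrow>d. measure lborel (B \<inter> D) * \<phi> (cnj w * z))"
    unfolding eq using bd
  proof (induction d)
    case (Cons p d)
    obtain w D where p: "p = (w, D)" by (cases p)
    have D: "D \<in> sets borel" "bounded D" using Cons.prems p by auto
    have "emeasure lborel (B \<inter> D) < \<infinity>" using D emeasure_bounded_finite[of "B \<inter> D"]
      by (auto intro: bounded_subset)
    hence "has_bochner_integral lborel (\<lambda>s. indicator (B \<inter> D) s * \<phi> (cnj w * z)) (measure lborel (B \<inter> D) * \<phi> (cnj w * z))"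
      using D by (intro has_bochner_integral_mult_left has_bochner_integral_real_indicator) auto
    with Cons p show ?case by (auto intro!: has_bochner_integral_add)
  qed (simp add: has_bochner_integral_zero)
  \<comment> \<open>the finite list is padded with empty sets to a disjoint sequence\<close>
  define A where "A i = (if i < length d then B \<inter> snd (d ! i) else {})" for i
  define w where "w i = cnj (fst (d ! i)) * z" for i
  have A: "A n \<in> sets borel" "bounded (A n)" for n
    using bd[of "fst (d ! n)" "snd (d ! n)"] by (auto simp: A_def intro: bounded_subset)
  have "disjnt (snd (d ! i)) (snd (d ! j))" if "i < j" "j < length d" for i j
    using dj that unfolding sorted_wrt_iff_nth_less by simp
  hence dA: "disjoint_family A"
  proof (unfold disjoint_family_on_def, intro ballI impI)
    fix i j :: nat assume "i \<noteq> j"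
    then consider "i < j" | "j < i" by linarith
    thus "A i \<inter> A j = {}"
      by cases (use \<open>\<And>i j. i < j \<Longrightarrow> j < length d \<Longrightarrow> disjnt (snd (d ! i)) (snd (d ! j))\<close> in
        \<open>fastforce simp: A_def disjnt_iff split: if_splits\<close>)+
  qed
  have "z \<bullet> simple_integral \<Lambda> d B \<omega> = (\<Sum>i<length d. w i \<bullet> \<Lambda> (A i) \<omega>)" for \<omega>
    by (simp add: simple_integral_def sum_list_sum_nth inner_sum_right case_prod_unfold inner_mult_complex
        w_def A_def atLeast0LessThan)
  hence "(\<integral>\<omega>. iexp (z \<bullet> simple_integral \<Lambda> d B \<omega>) \<partial>P) = (\<Prod>i<length d. \<integral>\<omega>. iexp (w i \<bullet> \<Lambda> (A i) \<omega>) \<partial>P)"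
    by (simp only: char_independent_sum[OF A dA])
  also have "\<dots> = (\<Prod>i<length d. exp (- complex_of_real (measure lborel (A i) * \<phi> (w i))))"
    by (simp only: char_\<Lambda>[OF A])
  also have "\<dots> = exp (- complex_of_real (\<Sum>i<length d. measure lborel (A i) * \<phi> (w i)))"
    by (simp add: exp_sum flip: sum_negf)
  also have "(\<Sum>i<length d. measure lborel (A i) * \<phi> (w i)) = (\<Sum>(w, D)\<leftarrow>d. measure lborel (B \<inter> D) * \<phi> (cnj w * z))"
    by (simp add: sum_list_sum_nth case_prod_unfold w_def A_def atLeast0LessThan)
  finally show "(\<integral>\<omega>. iexp (z \<bullet> simple_integral \<Lambda> d B \<omega>) \<partial>P) =
           exp (- complex_of_real (\<Sum>(w, D)\<leftarrow>d. measure lborel (B \<inter> D) * \<phi> (cnj w * z)))" .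
qed

lemma
  assumes g: "bounded_rep g" and B: "B \<in> sets borel"
  shows energy_integrable: "integrable lborel (\<lambda>s. indicator B s * energy_density z (simple_fun g) s)"
    and char_simple_integral: "(\<integral>\<omega>. iexp (z \<bullet> simple_integral \<Lambda> g B \<omega>) \<partial>P) =
           exp (- complex_of_real (\<integral>s. indicator B s * energy_density z (simple_fun g) s \<partial>lborel))"
proof -
  note d = disjointify_simple_rep[OF g]
  note hb = char_disjoint_simple_integral(1)[OF d B, of z, unfolded simple_fun_disjointify]
  show "integrable lborel (\<lambda>s. indicator B s * energy_density z (simple_fun g) s)"
    using hb by (simp only: has_bochner_integral_iff)
  have [measurable]: "simple_integral \<Lambda> g B \<in> borel_measurable P" "simple_integral \<Lambda> (disjointify g) B \<in> borel_measurable P"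
    using g d B by (auto intro!: simple_integral_measurable simp: is_simple_rep_iff)
  have "(\<integral>\<omega>. iexp (z \<bullet> simple_integral \<Lambda> g B \<omega>) \<partial>P) = (\<integral>\<omega>. iexp (z \<bullet> simple_integral \<Lambda> (disjointify g) B \<omega>) \<partial>P)"
    using simple_integral_disjointify[OF g B] by (intro integral_cong_AE) auto
  thus "(\<integral>\<omega>. iexp (z \<bullet> simple_integral \<Lambda> g B \<omega>) \<partial>P) =
           exp (- complex_of_real (\<integral>s. indicator B s * energy_density z (simple_fun g) s \<partial>lborel))"
    unfolding char_disjoint_simple_integral(2)[OF d B] has_bochner_integral_integral_eq[OF hb] .
qed

end

section \<open>Limits in probability\<close>

lemma norm_iexp_diff_le: "norm (iexp a - iexp b) \<le> min 2 \<bar>a - b\<bar>"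
proof -
  have "iexp a - iexp b = iexp b * (iexp (a - b) - 1)"
    by (simp add: algebra_simps flip: exp_add)
  hence "norm (iexp a - iexp b) = norm (iexp (a - b) - 1)" by (simp add: norm_mult)
  moreover have "norm (iexp (a - b) - 1) \<le> \<bar>a - b\<bar>" using iexp_approx1[of "a - b" 0] by simp
  moreover have "norm (iexp (a - b) - 1) \<le> 2" using norm_triangle_ineq4[of "iexp (a - b)" 1] by simp
  ultimately show ?thesis by simp
qed

lemma borel_measurable_cnj [measurable]: "cnj \<in> borel_measurable borel"
  by (intro borel_measurable_continuous_onI continuous_intros)

context prob_space
begin

lemma conv_in_prob_cmult:
  assumes "conv_in_prob M Y Z" shows "conv_in_prob M (\<lambda>n \<omega>. c * Y n \<omega>) (\<lambda>\<omega>. c * Z \<omega>)"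
proof (cases "c = 0")
  case False
  have "{\<omega> \<in> space M. dist (c * Y n \<omega>) (c * Z \<omega>) > e} = {\<omega> \<in> space M. dist (Y n \<omega>) (Z \<omega>) > e / norm c}" for n e
  proof -
    have "dist (c * x) (c * y) = dist x y * norm c" for x y
      by (metis dist_norm mult.commute norm_mult right_diff_distrib)
    thus ?thesis using False by (simp add: pos_divide_less_eq)
  qed
  thus ?thesis using assms False unfolding conv_in_prob_def by (auto intro!: borel_measurable_times)
qed (use assms in \<open>auto simp: conv_in_prob_def\<close>)

lemma conv_in_prob_add:
  assumes Y: "conv_in_prob M Y Z" and Y': "conv_in_prob M Y' Z'"
  shows "conv_in_prob M (\<lambda>n \<omega>. Y n \<omega> + Y' n \<omega>) (\<lambda>\<omega>. Z \<omega> + Z' \<omega>)"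
  unfolding conv_in_prob_def
proof (intro conjI allI impI)
  have [measurable]: "Y n \<in> borel_measurable M" "Y' n \<in> borel_measurable M" "Z \<in> borel_measurable M" "Z' \<in> borel_measurable M" for n
    using Y Y' by (auto simp: conv_in_prob_def)
  show "(\<lambda>\<omega>. Y n \<omega> + Y' n \<omega>) \<in> borel_measurable M" "(\<lambda>\<omega>. Z \<omega> + Z' \<omega>) \<in> borel_measurable M" for n by measurable
  fix e :: real assume e: "e > 0"
  let ?A = "\<lambda>n. {\<omega> \<in> space M. dist (Y n \<omega>) (Z \<omega>) > e / 2}" and ?B = "\<lambda>n. {\<omega> \<in> space M. dist (Y' n \<omega>) (Z' \<omega>) > e / 2}"
  let ?C = "\<lambda>n. {\<omega> \<in> space M. dist (Y n \<omega> + Y' n \<omega>) (Z \<omega> + Z' \<omega>) > e}"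
  have lim: "(\<lambda>n. measure M (?A n) + measure M (?B n)) \<longlonglongrightarrow> 0"
  proof -
    have "0 < e / 2" using e by simp
    hence "(\<lambda>n. measure M (?A n)) \<longlonglongrightarrow> 0" "(\<lambda>n. measure M (?B n)) \<longlonglongrightarrow> 0"
      using Y Y' unfolding conv_in_prob_def by blast+
    from tendsto_add[OF this] show ?thesis by simp
  qed
  have "measure M (?C n) \<le> measure M (?A n) + measure M (?B n)" for n
  proof -
    have "?C n \<subseteq> ?A n \<union> ?B n"
    proof
      fix \<omega> assume "\<omega> \<in> ?C n"
      moreover have "dist (Y n \<omega> + Y' n \<omega>) (Z \<omega> + Z' \<omega>) \<le> dist (Y n \<omega>) (Z \<omega>) + dist (Y' n \<omega>) (Z' \<omega>)"
        by (rule dist_triangle_add)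
      ultimately show "\<omega> \<in> ?A n \<union> ?B n" by auto
    qed
    hence "measure M (?C n) \<le> measure M (?A n \<union> ?B n)" by (intro finite_measure_mono) auto
    also have "\<dots> \<le> measure M (?A n) + measure M (?B n)" by (intro measure_Un_le) auto
    finally show ?thesis .
  qed
  thus "(\<lambda>n. measure M (?C n)) \<longlonglongrightarrow> 0"
    by (intro tendsto_sandwich[OF _ _ tendsto_const lim] always_eventually) auto
qed

text \<open>The truncated distance is at most \<open>K e\<close>, except on an event of small probability, where it is at most \<open>2\<close>.\<close>

lemma conv_in_prob_truncated_mean:
  assumes Y: "conv_in_prob M Y Z" and K: "0 \<le> K"
  shows "(\<lambda>n. \<integral>\<omega>. min 2 (K * dist (Y n \<omega>) (Z \<omega>)) \<partial>M) \<longlonglongrightarrow> 0"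
proof (rule LIMSEQ_I)
  let ?I = "\<lambda>n. \<integral>\<omega>. min 2 (K * dist (Y n \<omega>) (Z \<omega>)) \<partial>M"
  have [measurable]: "Y n \<in> borel_measurable M" "Z \<in> borel_measurable M" for n
    using Y by (auto simp: conv_in_prob_def)
  fix r :: real assume r: "0 < r"
  define e where "e = r / (2 * (K + 1))"
  have e: "0 < e" "K * e < r / 2" using r K by (auto simp: e_def field_simps)
  let ?A = "\<lambda>n. {\<omega> \<in> space M. dist (Y n \<omega>) (Z \<omega>) > e}"
  have "(\<lambda>n. measure M (?A n)) \<longlonglongrightarrow> 0" using Y e by (auto simp: conv_in_prob_def)
  from LIMSEQ_D[OF this, of "r / 4"] r obtain N where N: "\<And>n. N \<le> n \<Longrightarrow> measure M (?A n) < r / 4" by auto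
  show "\<exists>N. \<forall>n\<ge>N. norm (?I n - 0) < r"
  proof (intro exI[of _ N] allI impI)
    fix n assume n: "N \<le> n"
    have "?I n \<le> (\<integral>\<omega>. K * e + 2 * indicator (?A n) \<omega> \<partial>M)"
    proof (rule integral_mono)
      show "integrable M (\<lambda>\<omega>. min 2 (K * dist (Y n \<omega>) (Z \<omega>)))"
        using K by (intro integrable_norm_le[where B=2]) auto
      show "integrable M (\<lambda>\<omega>. K * e + 2 * indicator (?A n) \<omega>)"
        using K e by (intro integrable_norm_le[where B="K * e + 2"]) (auto simp: indicator_def abs_if)
      show "min 2 (K * dist (Y n \<omega>) (Z \<omega>)) \<le> K * e + 2 * indicator (?A n) \<omega>" if "\<omega> \<in> space M" for \<omega>
        using that K e mult_left_mono[of "dist (Y n \<omega>) (Z \<omega>)" e K] by (auto simp: indicator_def not_less min_le_iff_disj)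
    qed
    also have "\<dots> = K * e + 2 * measure M (?A n)"
    proof -
      have "integrable M (indicat_real (?A n))"
        by (intro integrable_norm_le[where B=1]) (auto simp: indicator_def)
      thus ?thesis by (simp add: prob_space)
    qed
    also have "\<dots> < r" using N[OF n] e by simp
    finally have "?I n < r" .
    moreover have "0 \<le> ?I n"
      using K by (intro integral_nonneg_AE AE_I2) auto
    ultimately show "norm (?I n - 0) < r" by simp
  qed
qed

lemma char_diff_le:
  fixes X Y :: "'a \<Rightarrow> real"
  assumes [measurable]: "X \<in> borel_measurable M" "Y \<in> borel_measurable M" "b \<in> borel_measurable M"
    and le: "\<And>\<omega>. min 2 \<bar>X \<omega> - Y \<omega>\<bar> \<le> b \<omega>" and b: "\<And>\<omega>. b \<omega> \<le> B"
  shows "norm ((\<integral>\<omega>. iexp (X \<omega>) \<partial>M) - (\<integral>\<omega>. iexp (Y \<omega>) \<partial>M)) \<le> (\<integral>\<omega>. b \<omega> \<partial>M)"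
proof -
  have i: "integrable M (\<lambda>\<omega>. iexp (X \<omega>))" "integrable M (\<lambda>\<omega>. iexp (Y \<omega>))"
    by (intro integrable_norm_le[where B=1]; simp)+
  have b0: "0 \<le> b \<omega>" for \<omega> using le[of \<omega>] by (meson abs_ge_zero min.boundedI order_trans zero_le_numeral)
  have ib: "integrable M b" using b b0 by (intro integrable_norm_le[where B=B]) auto
  have "norm ((\<integral>\<omega>. iexp (X \<omega>) \<partial>M) - (\<integral>\<omega>. iexp (Y \<omega>) \<partial>M)) = norm (\<integral>\<omega>. iexp (X \<omega>) - iexp (Y \<omega>) \<partial>M)"
    using i by simp
  also have "\<dots> \<le> (\<integral>\<omega>. norm (iexp (X \<omega>) - iexp (Y \<omega>)) \<partial>M)" by (rule integral_norm_bound)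
  also have "\<dots> \<le> (\<integral>\<omega>. b \<omega> \<partial>M)"
    using i ib order_trans[OF norm_iexp_diff_le le] by (intro integral_mono) auto
  finally show ?thesis .
qed

end

context rotation_invariant_levy
begin

text \<open>Stochastic integrals over the whole line, in a form that is closed under linear combinations: representations
  with overlapping sets are simply concatenated, without a common refinement.\<close>

definition levy_limit :: "(real \<Rightarrow> complex) \<Rightarrow> ('w \<Rightarrow> complex) \<Rightarrow> bool" where
  "levy_limit g Y \<longleftrightarrow> g \<in> borel_measurable borel \<and>
     (\<exists>G. (\<forall>n. bounded_rep (G n)) \<and> (AE s in lborel. (\<lambda>n. simple_fun (G n) s) \<longlonglongrightarrow> g s) \<and>
        conv_in_prob P (\<lambda>n. simple_integral \<Lambda> (G n) UNIV) Y)"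

lemma levy_limit_integral: "has_levy_integral P \<Lambda> g UNIV Y \<Longrightarrow> levy_limit g Y"
  unfolding has_levy_integral_def levy_limit_def approximating_sequence_def is_simple_rep_iff by blast

lemma levy_limit_zero: "levy_limit (\<lambda>_. 0) (\<lambda>_. 0)"
proof -
  have "simple_integral \<Lambda> [] UNIV = (\<lambda>_. 0)" by auto
  thus ?thesis unfolding levy_limit_def conv_in_prob_def by (auto intro!: exI[of _ "\<lambda>_. []"])
qed

lemma levy_limit_scale: "levy_limit g Y \<Longrightarrow> levy_limit (\<lambda>s. c * g s) (\<lambda>\<omega>. c * Y \<omega>)"
  unfolding levy_limit_def
proof (elim conjE exE, intro conjI)
  fix G assume G: "\<forall>n. bounded_rep (G n)" "AE s in lborel. (\<lambda>n. simple_fun (G n) s) \<longlonglongrightarrow> g s"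
    "conv_in_prob P (\<lambda>n. simple_integral \<Lambda> (G n) UNIV) Y"
  have "simple_integral \<Lambda> (scale_rep c (G n)) UNIV = (\<lambda>\<omega>. c * simple_integral \<Lambda> (G n) UNIV \<omega>)" for n
    by auto
  with G conv_in_prob_cmult[OF G(3), of c]
  show "\<exists>G. (\<forall>n. bounded_rep (G n)) \<and> (AE s in lborel. (\<lambda>n. simple_fun (G n) s) \<longlonglongrightarrow> c * g s) \<and>
        conv_in_prob P (\<lambda>n. simple_integral \<Lambda> (G n) UNIV) (\<lambda>\<omega>. c * Y \<omega>)"
    by (intro exI[of _ "\<lambda>n. scale_rep c (G n)"]) (auto elim!: eventually_mono intro!: tendsto_intros)
qed auto

lemma levy_limit_add:
  "levy_limit g Y \<Longrightarrow> levy_limit g' Y' \<Longrightarrow> levy_limit (\<lambda>s. g s + g' s) (\<lambda>\<omega>. Y \<omega> + Y' \<omega>)"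
  unfolding levy_limit_def
proof (elim conjE exE, intro conjI)
  fix G G' assume G: "\<forall>n. bounded_rep (G n)" "AE s in lborel. (\<lambda>n. simple_fun (G n) s) \<longlonglongrightarrow> g s"
    "conv_in_prob P (\<lambda>n. simple_integral \<Lambda> (G n) UNIV) Y"
    and G': "\<forall>n. bounded_rep (G' n)" "AE s in lborel. (\<lambda>n. simple_fun (G' n) s) \<longlonglongrightarrow> g' s"
    "conv_in_prob P (\<lambda>n. simple_integral \<Lambda> (G' n) UNIV) Y'"
  have "simple_integral \<Lambda> (G n @ G' n) UNIV = (\<lambda>\<omega>. simple_integral \<Lambda> (G n) UNIV \<omega> + simple_integral \<Lambda> (G' n) UNIV \<omega>)" for n
    by auto
  moreover from G(2) G'(2) have "AE s in lborel. (\<lambda>n. simple_fun (G n @ G' n) s) \<longlonglongrightarrow> g s + g' s"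
    by eventually_elim (auto intro!: tendsto_intros)
  ultimately
  show "\<exists>G. (\<forall>n. bounded_rep (G n)) \<and> (AE s in lborel. (\<lambda>n. simple_fun (G n) s) \<longlonglongrightarrow> g s + g' s) \<and>
        conv_in_prob P (\<lambda>n. simple_integral \<Lambda> (G n) UNIV) (\<lambda>\<omega>. Y \<omega> + Y' \<omega>)"
    using G G' conv_in_prob_add[OF G(3) G'(3)]
    by (intro exI[of _ "\<lambda>n. G n @ G' n"]) auto
qed auto

lemma levy_limit_sum:
  assumes "finite J" "\<And>j. j \<in> J \<Longrightarrow> levy_limit (g j) (Y j)"
  shows "levy_limit (\<lambda>s. \<Sum>j\<in>J. g j s) (\<lambda>\<omega>. \<Sum>j\<in>J. Y j \<omega>)"
  using assms by (induction J rule: finite_induct) (auto intro: levy_limit_zero levy_limit_add)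

lemma levy_limit_diff:
  assumes "levy_limit g Y" "levy_limit g' Y'"
  shows "levy_limit (\<lambda>s. g s - g' s) (\<lambda>\<omega>. Y \<omega> - Y' \<omega>)"
  using levy_limit_add[OF assms(1) levy_limit_scale[OF assms(2), of "-1"]] by simp

lemma levy_limit_measurable: "levy_limit g Y \<Longrightarrow> Y \<in> borel_measurable P"
  by (auto simp: levy_limit_def conv_in_prob_def)

text \<open>The integrals \<open>En n m\<close> of \<open>\<phi>\<close> at differences of approximants tend to zero, because \<open>exp (- En n m)\<close> is the
  characteristic function of a variable that tends to zero in probability. Fatou's lemma replaces one approximant by \<open>g\<close>, and
  quasi-subadditivity of \<open>\<phi>\<close> compares the energies of \<open>g\<close> and of its approximants.\<close>

lemma levy_limit_char:
  assumes "levy_limit g Y"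
  shows energy_integrable_limit: "integrable lborel (energy_density z g)"
    and char_levy_limit: "(\<integral>\<omega>. iexp (z \<bullet> Y \<omega>) \<partial>P) = exp (- complex_of_real (\<integral>s. energy_density z g s \<partial>lborel))"
proof -
  from assms obtain G where G: "\<And>n. bounded_rep (G n)"
    and lim: "AE s in lborel. (\<lambda>n. simple_fun (G n) s) \<longlonglongrightarrow> g s"
    and conv: "conv_in_prob P (\<lambda>n. simple_integral \<Lambda> (G n) UNIV) Y"
    and [measurable]: "g \<in> borel_measurable borel"
    unfolding levy_limit_def by blast
  define S where "S n = simple_integral \<Lambda> (G n) UNIV" for n
  have mG[measurable]: "simple_fun (G n) \<in> borel_measurable borel" for n by (rule simple_fun_measurable[OF G])
  have [measurable]: "Y \<in> borel_measurable P" "S n \<in> borel_measurable P" for n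
    using conv by (auto simp: conv_in_prob_def S_def)
  let ?b = "\<lambda>n \<omega>. min 2 (norm z * dist (S n \<omega>) (Y \<omega>))"
  define q where "q n = (\<integral>\<omega>. ?b n \<omega> \<partial>P)" for n
  have q: "q \<longlonglongrightarrow> 0" unfolding q_def S_def
    by (rule conv_in_prob_truncated_mean[OF conv]) simp
  have iq: "integrable P (\<lambda>\<omega>. ?b n \<omega>)" for n
    by (intro integrable_norm_le[where B=2]) auto
  have zle: "\<bar>z \<bullet> x - z \<bullet> y\<bar> \<le> norm z * dist x y" for x y
    using Cauchy_Schwarz_ineq2[of z "x - y"] by (simp add: inner_diff_right dist_norm)
  define En where "En n m = (\<integral>s. energy_density z (\<lambda>s. simple_fun (G n) s - simple_fun (G m) s) s \<partial>lborel)" for n m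
  have diff: "integrable lborel (energy_density z (\<lambda>s. simple_fun (G n) s - simple_fun (G m) s))"
    "(\<integral>\<omega>. iexp (z \<bullet> (S n \<omega> - S m \<omega>)) \<partial>P) = exp (- complex_of_real (En n m))" for n m
    using energy_integrable[of "G n @ scale_rep (-1) (G m)" UNIV z] char_simple_integral[of "G n @ scale_rep (-1) (G m)" UNIV z] G
    by (simp_all add: S_def En_def)
  have En_le: "1 - exp (- En n m) \<le> q n + q m" for n m
  proof -
    have "norm ((\<integral>\<omega>. iexp (z \<bullet> (S n \<omega> - S m \<omega>)) \<partial>P) - (\<integral>\<omega>. iexp ((\<lambda>_. 0) \<omega>) \<partial>P)) \<le>
       (\<integral>\<omega>. ?b n \<omega> + ?b m \<omega> \<partial>P)"
    proof (rule char_diff_le[where B=4])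
      fix \<omega>
      have "\<bar>z \<bullet> (S n \<omega> - S m \<omega>) - 0\<bar> \<le> norm z * dist (S n \<omega>) (S m \<omega>)"
        using zle[of "S n \<omega>" "S m \<omega>"] by (simp add: inner_diff_right)
      also have "\<dots> \<le> norm z * (dist (S n \<omega>) (Y \<omega>) + dist (S m \<omega>) (Y \<omega>))"
        by (intro mult_left_mono dist_triangle2) auto
      finally have "\<bar>z \<bullet> (S n \<omega> - S m \<omega>) - 0\<bar> \<le> norm z * dist (S n \<omega>) (Y \<omega>) + norm z * dist (S m \<omega>) (Y \<omega>)"
        by (simp add: distrib_left)
      moreover have "0 \<le> norm z * dist (S n \<omega>) (Y \<omega>)" "0 \<le> norm z * dist (S m \<omega>) (Y \<omega>)" by auto
      ultimately show "min 2 \<bar>z \<bullet> (S n \<omega> - S m \<omega>) - 0\<bar> \<le> ?b n \<omega> + ?b m \<omega>"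
        by linarith
      show "?b n \<omega> + ?b m \<omega> \<le> 4" by linarith
    qed measurable
    also have "\<dots> = q n + q m" unfolding q_def using iq by simp
    finally have "norm (exp (- complex_of_real (En n m)) - 1) \<le> q n + q m" unfolding diff by (simp add: prob_space)
    moreover have "exp (- complex_of_real (En n m)) - 1 = complex_of_real (exp (- En n m) - 1)"
      by (simp flip: exp_of_real)
    ultimately show ?thesis by (simp only: norm_of_real)
  qed
  have En_small: "\<exists>N. \<forall>n\<ge>N. \<forall>m\<ge>N. En n m \<le> r" if r: "0 < r" for r
  proof -
    have "0 < (1 - exp (- r)) / 2" using r by simp
    from LIMSEQ_D[OF q this] obtain N where N: "\<And>n. N \<le> n \<Longrightarrow> \<bar>q n\<bar> < (1 - exp (- r)) / 2" by auto
    have "En n m \<le> r" if "N \<le> n" "N \<le> m" for n m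
    proof -
      have "q n < (1 - exp (- r)) / 2" "q m < (1 - exp (- r)) / 2"
        using N[OF that(1)] N[OF that(2)] by (auto simp: abs_less_iff)
      hence "q n + q m < 1 - exp (- r)" by (simp add: field_simps)
      hence "1 - exp (- En n m) < 1 - exp (- r)" using En_le[of n m] by linarith
      thus ?thesis by simp
    qed
    thus ?thesis by blast
  qed
  let ?d = "\<lambda>n s. energy_density z (\<lambda>s. simple_fun (G n) s - g s) s"
  have fatou: "(\<integral>\<^sup>+s. ennreal (?d n s) \<partial>lborel) \<le> ennreal r" if N: "\<forall>n\<ge>N. \<forall>m\<ge>N. En n m \<le> r" and n: "N \<le> n" for N n r
  proof -
    let ?u = "\<lambda>m s. ennreal (energy_density z (\<lambda>s. simple_fun (G n) s - simple_fun (G m) s) s)"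
    have "AE s in lborel. ennreal (?d n s) = liminf (\<lambda>m. ?u m s)"
      using lim
    proof eventually_elim
      case (elim s)
      have "(\<lambda>m. \<phi> (cnj (simple_fun (G n) s - simple_fun (G m) s) * z)) \<longlonglongrightarrow> \<phi> (cnj (simple_fun (G n) s - g s) * z)"
        using elim by (intro continuous_on_tendsto_compose[OF cos_exponent_continuous[OF \<nu>]] tendsto_intros) auto
      hence "(\<lambda>m. ?u m s) \<longlonglongrightarrow> ennreal (?d n s)" by (rule tendsto_ennrealI)
      thus ?case by (intro lim_imp_Liminf[symmetric]) auto
    qed
    hence "(\<integral>\<^sup>+s. ennreal (?d n s) \<partial>lborel) = (\<integral>\<^sup>+s. liminf (\<lambda>m. ?u m s) \<partial>lborel)"
      by (rule nn_integral_cong_AE)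
    also have "\<dots> \<le> liminf (\<lambda>m. \<integral>\<^sup>+s. ?u m s \<partial>lborel)" by (intro nn_integral_liminf) measurable
    also have "\<dots> = liminf (\<lambda>m. ennreal (En n m))"
      unfolding En_def using diff(1) by (subst nn_integral_eq_integral) (auto simp: cos_exponent_nonneg)
    also have "\<dots> \<le> ennreal r"
      using N n by (intro Liminf_le) (auto simp: eventually_sequentially intro!: exI[of _ N] ennreal_leI)
    finally show ?thesis .
  qed
  have small: "\<exists>N. \<forall>n\<ge>N. integrable lborel (?d n) \<and> (\<integral>s. ?d n s \<partial>lborel) \<le> r" if r: "0 < r" for r
  proof -
    obtain N where N: "\<forall>n\<ge>N. \<forall>m\<ge>N. En n m \<le> r" using En_small[OF r] by blast
    have "integrable lborel (?d n) \<and> (\<integral>s. ?d n s \<partial>lborel) \<le> r" if "N \<le> n" for n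
    proof
      show i: "integrable lborel (?d n)"
        using fatou[OF N that] by (intro integrableI_bounded)
          (auto simp: cos_exponent_nonneg intro: order_le_less_trans)
      have "ennreal (\<integral>s. ?d n s \<partial>lborel) \<le> ennreal r"
        using fatou[OF N that] i by (subst (asm) nn_integral_eq_integral) (auto simp: cos_exponent_nonneg)
      thus "(\<integral>s. ?d n s \<partial>lborel) \<le> r" using r by simp
    qed
    thus ?thesis by blast
  qed
  have iG: "integrable lborel (energy_density z (simple_fun (G n)))" for n
    using energy_integrable[OF G, of UNIV] by simp
  have sub1: "energy_density z g s \<le> (1 + e) * energy_density z (simple_fun (G n)) s + (1 + 1 / e) * ?d n s"
    if "0 < e" for e n s
  proof -
    have "cnj (g s) * z = cnj (simple_fun (G n) s) * z + (- (cnj (simple_fun (G n) s - g s) * z))"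
      by (simp add: algebra_simps)
    thus ?thesis using cos_exponent_add_le[OF \<nu> that, of "cnj (simple_fun (G n) s) * z" "- (cnj (simple_fun (G n) s - g s) * z)"]
      by (simp only: cos_exponent_uminus)
  qed
  have sub2: "energy_density z (simple_fun (G n)) s \<le> (1 + e) * energy_density z g s + (1 + 1 / e) * ?d n s"
    if "0 < e" for e n s
  proof -
    have "cnj (simple_fun (G n) s) * z = cnj (g s) * z + cnj (simple_fun (G n) s - g s) * z"
      by (simp add: algebra_simps)
    thus ?thesis using cos_exponent_add_le[OF \<nu> that, of "cnj (g s) * z" "cnj (simple_fun (G n) s - g s) * z"]
      by simp
  qed
  show int: "integrable lborel (energy_density z g)"
  proof -
    obtain n where n: "integrable lborel (?d n)" using small[of 1] by auto
    show ?thesis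
    proof (rule Bochner_Integration.integrable_bound)
      show "integrable lborel (\<lambda>s. (1 + 1) * energy_density z (simple_fun (G n)) s + (1 + 1 / 1) * ?d n s)"
        using iG n by (intro Bochner_Integration.integrable_add integrable_mult_right)
      show "AE s in lborel. norm (energy_density z g s) \<le> norm ((1 + 1) * energy_density z (simple_fun (G n)) s + (1 + 1 / 1) * ?d n s)"
        using sub1[of 1 _ n] by (intro AE_I2) (auto simp: cos_exponent_nonneg intro!: order_trans[OF _ abs_ge_self])
    qed measurable
  qed
  define a where "a = (\<integral>s. energy_density z g s \<partial>lborel)"
  define an where "an n = (\<integral>s. energy_density z (simple_fun (G n)) s \<partial>lborel)" for n
  have a0: "0 \<le> a" "0 \<le> an n" for n
    unfolding a_def an_def by (intro integral_nonneg_AE AE_I2; simp add: cos_exponent_nonneg)+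
  have "an \<longlonglongrightarrow> a"
  proof (rule LIMSEQ_I)
    fix \<delta> :: real assume \<delta>: "0 < \<delta>"
    \<comment> \<open>\<open>e\<close> absorbs the factor \<open>1 + e\<close>, since both energies are at most \<open>2 a + 1\<close>; then \<open>r\<close> absorbs \<open>1 + 1 / e\<close>\<close>
    define e where "e = \<delta> / (2 * (2 * a + 3))"
    have e: "0 < e" using \<delta> a0 by (simp add: e_def)
    define r where "r = min (1 / 2) (\<delta> / (3 * (1 + 1 / e)))"
    have e1: "0 < 1 + 1 / e" using e by (simp add: add_pos_pos)
    have "0 < \<delta> / (3 * (1 + 1 / e))" using \<delta> e1 by (intro divide_pos_pos mult_pos_pos) auto
    hence r: "r \<le> 1 / 2" "0 < r" unfolding r_def by linarith+
    have "(1 + 1 / e) * r \<le> (1 + 1 / e) * (\<delta> / (3 * (1 + 1 / e)))"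
      using e by (intro mult_left_mono) (auto simp: r_def)
    also have "\<dots> = \<delta> / 3" using e1 by (metis nonzero_mult_divide_mult_cancel_left2 less_irrefl times_divide_eq_right mult.commute)
    finally have r3: "(1 + 1 / e) * r \<le> \<delta> / 3" .
    obtain N where N: "\<And>n. N \<le> n \<Longrightarrow> integrable lborel (?d n) \<and> (\<integral>s. ?d n s \<partial>lborel) \<le> r"
      using small[OF r(2)] by blast
    show "\<exists>N. \<forall>n\<ge>N. norm (an n - a) < \<delta>"
    proof (intro exI[of _ N] allI impI)
      fix n assume "N \<le> n"
      note n = N[OF this]
      have le1: "a \<le> (1 + c) * an n + (1 + 1 / c) * (\<integral>s. ?d n s \<partial>lborel)" if "0 < c" for c
      proof -
        have "a \<le> (\<integral>s. (1 + c) * energy_density z (simple_fun (G n)) s + (1 + 1 / c) * ?d n s \<partial>lborel)"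
          unfolding a_def using int iG n sub1[OF that] by (intro integral_mono) auto
        thus ?thesis using iG n by (simp add: an_def)
      qed
      have le2: "an n \<le> (1 + c) * a + (1 + 1 / c) * (\<integral>s. ?d n s \<partial>lborel)" if "0 < c" for c
      proof -
        have "an n \<le> (\<integral>s. (1 + c) * energy_density z g s + (1 + 1 / c) * ?d n s \<partial>lborel)"
          unfolding an_def using int iG n sub2[OF that] by (intro integral_mono) auto
        thus ?thesis using int n by (simp add: a_def)
      qed
      have "an n \<le> 2 * a + 2 * (\<integral>s. ?d n s \<partial>lborel)" using le2[of 1] by simp
      hence anb: "an n \<le> 2 * a + 1" using n r by linarith
      have "(1 + 1 / e) * (\<integral>s. ?d n s \<partial>lborel) \<le> (1 + 1 / e) * r" using n e by (intro mult_left_mono) auto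
      hence d: "(1 + 1 / e) * (\<integral>s. ?d n s \<partial>lborel) \<le> \<delta> / 3" using r3 by linarith
      have "e * an n \<le> e * (2 * a + 3)" "e * a \<le> e * (2 * a + 3)" using anb a0 e by (intro mult_left_mono; simp)+
      moreover have "e * (2 * a + 3) = \<delta> / 2" using a0 by (simp add: e_def field_simps)
      ultimately have "e * an n \<le> \<delta> / 2" "e * a \<le> \<delta> / 2" by auto
      with le1[OF e] le2[OF e] d \<delta> show "norm (an n - a) < \<delta>" by (simp add: distrib_right abs_if)
    qed
  qed
  hence "(\<lambda>n. exp (- complex_of_real (an n))) \<longlonglongrightarrow> exp (- complex_of_real a)" by (intro tendsto_intros)
  moreover have "(\<integral>\<omega>. iexp (z \<bullet> S n \<omega>) \<partial>P) = exp (- complex_of_real (an n))" for n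
    using char_simple_integral[OF G, of UNIV z n] by (simp add: S_def an_def)
  moreover have "(\<lambda>n. \<integral>\<omega>. iexp (z \<bullet> S n \<omega>) \<partial>P) \<longlonglongrightarrow> (\<integral>\<omega>. iexp (z \<bullet> Y \<omega>) \<partial>P)"
  proof (rule LIM_zero_cancel, rule Lim_null_comparison)
    show "\<forall>\<^sub>F n in sequentially. norm ((\<integral>\<omega>. iexp (z \<bullet> S n \<omega>) \<partial>P) - (\<integral>\<omega>. iexp (z \<bullet> Y \<omega>) \<partial>P)) \<le> q n"
      unfolding q_def by (intro always_eventually allI char_diff_le[where B=2])
        (auto intro: min.coboundedI2 zle)
  qed (rule q)
  ultimately show "(\<integral>\<omega>. iexp (z \<bullet> Y \<omega>) \<partial>P) = exp (- complex_of_real (\<integral>s. energy_density z g s \<partial>lborel))"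
    unfolding a_def[symmetric] using LIMSEQ_unique by (simp only:)
qed

section \<open>Invariance properties of integral processes\<close>

lemma levy_limit_rotate_distr:
  assumes Y: "levy_limit g Y" and c: "norm c = 1"
  shows "distr P borel (\<lambda>\<omega>. c * Y \<omega>) = distr P borel Y"
proof (rule complex_distr_eqI)
  have [measurable]: "Y \<in> borel_measurable P" by (rule levy_limit_measurable[OF Y])
  show "(\<lambda>\<omega>. c * Y \<omega>) \<in> borel_measurable P" "Y \<in> borel_measurable P" by measurable
  fix z
  have "energy_density z (\<lambda>s. c * g s) s = energy_density z g s" for s
    using \<phi>_rotate[of "cnj c" "cnj (g s) * z"] c by (simp add: mult.assoc)
  thus "(\<integral>\<omega>. iexp (z \<bullet> (c * Y \<omega>)) \<partial>P) = (\<integral>\<omega>. iexp (z \<bullet> Y \<omega>) \<partial>P)"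
    by (simp only: char_levy_limit[OF Y] char_levy_limit[OF levy_limit_scale[OF Y]])
qed unfold_locales

lemma integral_process_rotationally_invariant:
  assumes X: "\<And>t. levy_limit (f t) (X t)"
  shows "rotationally_invariant_process P X"
  unfolding rotationally_invariant_process_def rotationally_invariant_def
proof (intro allI conjI impI)
  fix N :: nat and z :: "nat \<Rightarrow> complex" and t :: "nat \<Rightarrow> real"
  have Y: "levy_limit (\<lambda>s. \<Sum>n<N. z n * f (t n) s) (\<lambda>\<omega>. \<Sum>n<N. z n * X (t n) \<omega>)"
    by (intro levy_limit_sum levy_limit_scale X) auto
  show "(\<lambda>\<omega>. \<Sum>n<N. z n * X (t n) \<omega>) \<in> borel_measurable P" by (rule levy_limit_measurable[OF Y])
  fix \<theta> :: real
  show "distr P borel (\<lambda>\<omega>. iexp \<theta> * (\<Sum>n<N. z n * X (t n) \<omega>)) = distr P borel (\<lambda>\<omega>. \<Sum>n<N. z n * X (t n) \<omega>)"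
    by (rule levy_limit_rotate_distr[OF Y]) simp
qed

lemma integral_process_stationary_increments:
  assumes X: "\<And>t. levy_limit (f t) (X t)"
    and f: "\<And>t h s. f (t + h) s - f h s = iexp (h * s) * f t s"
  shows "stationary_increments P X"
  unfolding stationary_increments_def
proof (intro allI conjI impI)
  show mX[measurable]: "X t \<in> borel_measurable P" for t by (rule levy_limit_measurable[OF X])
  fix J :: "real set" and h h' assume J: "finite J"
  show "distr P (Pi\<^sub>M J (\<lambda>_. borel)) (\<lambda>\<omega>. \<lambda>t\<in>J. X (t + h) \<omega> - X h \<omega>) =
        distr P (Pi\<^sub>M J (\<lambda>_. borel)) (\<lambda>\<omega>. \<lambda>t\<in>J. X (t + h') \<omega> - X h' \<omega>)"
  proof (rule complex_family_distr_eqI)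
    fix u :: "real \<Rightarrow> complex"
    have "(\<integral>\<omega>. iexp (\<Sum>t\<in>J. u t \<bullet> (X (t + h) \<omega> - X h \<omega>)) \<partial>P) =
        exp (- complex_of_real (\<integral>s. energy_density 1 (\<lambda>s. \<Sum>t\<in>J. cnj (u t) * f t s) s \<partial>lborel))" for h
    proof -
      have Y: "levy_limit (\<lambda>s. \<Sum>t\<in>J. cnj (u t) * (f (t + h) s - f h s)) (\<lambda>\<omega>. \<Sum>t\<in>J. cnj (u t) * (X (t + h) \<omega> - X h \<omega>))"
        by (intro levy_limit_sum levy_limit_scale levy_limit_diff X J)
      have "(\<Sum>t\<in>J. u t \<bullet> (X (t + h) \<omega> - X h \<omega>)) = 1 \<bullet> (\<Sum>t\<in>J. cnj (u t) * (X (t + h) \<omega> - X h \<omega>))" for \<omega>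
        unfolding inner_sum_right inner_mult_complex by simp
      hence "(\<integral>\<omega>. iexp (\<Sum>t\<in>J. u t \<bullet> (X (t + h) \<omega> - X h \<omega>)) \<partial>P) =
          exp (- complex_of_real (\<integral>s. energy_density 1 (\<lambda>s. \<Sum>t\<in>J. cnj (u t) * (f (t + h) s - f h s)) s \<partial>lborel))"
        by (simp only: char_levy_limit[OF Y])
      moreover have "energy_density 1 (\<lambda>s. \<Sum>t\<in>J. cnj (u t) * (f (t + h) s - f h s)) s =
          energy_density 1 (\<lambda>s. \<Sum>t\<in>J. cnj (u t) * f t s) s" for s
      proof -
        have "(\<Sum>t\<in>J. cnj (u t) * (f (t + h) s - f h s)) = iexp (h * s) * (\<Sum>t\<in>J. cnj (u t) * f t s)"
          unfolding f sum_distrib_left by (intro sum.cong) (auto simp: algebra_simps)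
        moreover have "norm (cnj (iexp (h * s))) = 1" by simp
        ultimately show ?thesis using \<phi>_rotate[of "cnj (iexp (h * s))"] by (simp only: complex_cnj_mult mult.assoc)
      qed
      ultimately show ?thesis by simp
    qed
    thus "(\<integral>\<omega>. iexp (\<Sum>t\<in>J. u t \<bullet> (X (t + h) \<omega> - X h \<omega>)) \<partial>P) = (\<integral>\<omega>. iexp (\<Sum>t\<in>J. u t \<bullet> (X (t + h') \<omega> - X h' \<omega>)) \<partial>P)"
      by simp
  qed (use J in \<open>auto intro: finite_measure_axioms\<close>)
qed

end

section \<open>The Levy measure of the real part\<close>

text \<open>Dominated convergence: the exponent of a pure jump part grows more slowly than quadratically.\<close>

lemma cos_exponent_scaled_tendsto_0:
  assumes \<nu>: "levy_measure \<nu>"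
  shows "(\<lambda>n. cos_exponent \<nu> (real (Suc n) *\<^sub>R z) / (real (Suc n))\<^sup>2) \<longlonglongrightarrow> 0"
proof -
  let ?f = "\<lambda>n x. (1 - cos (real (Suc n) * (z \<bullet> x))) / (real (Suc n))\<^sup>2"
  have sq: "1 \<le> (real (Suc n))\<^sup>2" for n by (intro one_le_power) simp
  have "(\<lambda>n. \<integral>x. ?f n x \<partial>\<nu>) \<longlonglongrightarrow> (\<integral>x. 0 \<partial>\<nu>)"
  proof (rule integral_dominated_convergence[where w="\<lambda>x. max 2 ((norm z)\<^sup>2) * min 1 ((norm x)\<^sup>2)"])
    show "integrable \<nu> (\<lambda>x. max 2 ((norm z)\<^sup>2) * min 1 ((norm x)\<^sup>2))"
      using levy_measure_integrable_min[OF \<nu>] by simp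
    show "?f n \<in> borel_measurable \<nu>" for n
      by (intro levy_measure_measurable[OF \<nu>]) measurable
    have nn: "0 \<le> ?f n x" for n x by simp
    show "AE x in \<nu>. norm (?f n x) \<le> max 2 ((norm z)\<^sup>2) * min 1 ((norm x)\<^sup>2)" for n
    proof (rule AE_I2)
      fix x
      have "?f n x \<le> max 2 ((norm z)\<^sup>2) * min 1 ((norm x)\<^sup>2)"
      proof (rule min_scale_le)
        have c2: "1 - cos (real (Suc n) * (z \<bullet> x)) \<le> 2"
          using cos_ge_minus_one[of "real (Suc n) * (z \<bullet> x)"] by linarith
        have "?f n x \<le> 2 / 1" by (rule frac_le) (use c2 sq[of n] in auto)
        thus "?f n x \<le> 2" by simp
        have "1 - cos (real (Suc n) * (z \<bullet> x)) \<le> (real (Suc n) * (z \<bullet> x))\<^sup>2 / 2"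
          by (rule one_minus_cos_le_square)
        also have "\<dots> \<le> (real (Suc n))\<^sup>2 * (z \<bullet> x)\<^sup>2" by (simp add: power_mult_distrib)
        also have "\<dots> \<le> (real (Suc n))\<^sup>2 * ((norm z)\<^sup>2 * (norm x)\<^sup>2)" by (intro mult_left_mono inner_square_le) auto
        finally show "?f n x \<le> (norm z)\<^sup>2 * (norm x)\<^sup>2"
          using sq[of n] by (subst pos_divide_le_eq) (auto simp: mult.commute)
      qed auto
      thus "norm (?f n x) \<le> max 2 ((norm z)\<^sup>2) * min 1 ((norm x)\<^sup>2)" using nn[of n x] by (simp only: real_norm_def abs_of_nonneg)
    qed
    show "AE x in \<nu>. (\<lambda>n. ?f n x) \<longlonglongrightarrow> 0"
    proof (rule AE_I2, rule tendsto_sandwich[OF _ _ tendsto_const])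
      fix x
      show "\<forall>\<^sub>F n in sequentially. ?f n x \<le> 2 / (real (Suc n))\<^sup>2"
      proof (intro always_eventually allI divide_right_mono)
        show "1 - cos (real (Suc n) * (z \<bullet> x)) \<le> 2" for n
          using cos_ge_minus_one[of "real (Suc n) * (z \<bullet> x)"] by linarith
      qed simp
      have "(\<lambda>n. 2 * (inverse (real (Suc n)))\<^sup>2) \<longlonglongrightarrow> 2 * 0\<^sup>2"
        by (intro tendsto_intros LIMSEQ_inverse_real_of_nat)
      thus "(\<lambda>n. 2 / (real (Suc n))\<^sup>2) \<longlonglongrightarrow> 0" by (simp add: field_simps)
    qed (simp add: nn)
  qed simp
  thus ?thesis by (simp add: cos_exponent_def)
qed

text \<open>The Gaussian part of the real component would contribute a quadratic term to the exponent along the real axis,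
  where \<open>\<phi>\<close> grows more slowly. Hence only the jumps of the real part remain, and radial symmetry carries the formula
  from the real axis to the plane.\<close>

lemma (in rotation_invariant_levy) \<phi>_real_part:
  assumes "has_levy_measure P (\<lambda>t \<omega>. Re (L t \<omega>)) \<nu>R"
  shows "levy_measure \<nu>R" and "\<phi> z = cos_exponent \<nu>R (norm z)"
proof -
  obtain \<gamma>' A where tr: "levy_triplet P (\<lambda>t \<omega>. Re (L t \<omega>)) \<gamma>' A \<nu>R"
    using assms by (auto simp: has_levy_measure_def)
  show \<nu>R: "levy_measure \<nu>R" using tr by (simp add: levy_triplet_def)
  have lin: "linear A" and pos: "0 \<le> A x * x" for x using tr by (auto simp: levy_triplet_def)
  have Au: "A u = u * A 1" for u
    using linear_cmul[OF lin, of u 1] by simp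
  have c: "0 \<le> A 1" using pos[of 1] by simp
  have eq: "\<phi> (complex_of_real u) = u\<^sup>2 * A 1 / 2 + cos_exponent \<nu>R u" for u
  proof -
    have "(\<integral>\<omega>. iexp (u \<bullet> Re (L 1 \<omega>)) \<partial>P) = exp (complex_of_real 1 * (\<i> * complex_of_real (\<gamma>' \<bullet> u)
        - complex_of_real (A u \<bullet> u) / 2 + (\<integral>x. levy_integrand u x \<partial>\<nu>R)))"
      using tr unfolding levy_triplet_def by (metis zero_le_one)
    hence "norm (\<integral>\<omega>. iexp (u \<bullet> Re (L 1 \<omega>)) \<partial>P) = exp (- (u\<^sup>2 * A 1 / 2 + cos_exponent \<nu>R u))"
      using Au[of u] Re_levy_exponent[OF \<nu>R, of u] by (simp add: norm_exp_eq_Re power2_eq_square mult_ac)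
    moreover have "complex_of_real u \<bullet> x = u \<bullet> Re x" for x by (simp add: inner_complex_def)
    ultimately show ?thesis using norm_char_L[of "complex_of_real u"] by simp
  qed
  have "(\<lambda>n. cos_exponent \<nu> (real (Suc n) *\<^sub>R 1) / (real (Suc n))\<^sup>2) \<longlonglongrightarrow> 0"
    by (rule cos_exponent_scaled_tendsto_0[OF \<nu>])
  moreover have "A 1 / 2 \<le> cos_exponent \<nu> (real (Suc n) *\<^sub>R 1) / (real (Suc n))\<^sup>2" for n
    using eq[of "real (Suc n)"] cos_exponent_nonneg[of \<nu>R "real (Suc n)"]
    by (subst pos_le_divide_eq) (auto simp: scaleR_conv_of_real mult_ac)
  ultimately have "A 1 / 2 \<le> 0" by (intro LIMSEQ_le_const) auto
  with c have "A 1 = 0" by simp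
  hence eq': "\<phi> (complex_of_real u) = cos_exponent \<nu>R u" for u using eq by simp
  show "\<phi> z = cos_exponent \<nu>R (norm z)"
  proof (cases "z = 0")
    case False
    have "z = sgn z * complex_of_real (norm z)" using False by (simp add: sgn_eq)
    hence "\<phi> z = \<phi> (sgn z * complex_of_real (norm z))" by simp
    also have "\<dots> = \<phi> (complex_of_real (norm z))" using False by (intro \<phi>_rotate) (simp add: norm_sgn)
    finally show ?thesis by (simp add: eq')
  qed simp
qed

section \<open>A monotone majorant of the exponent\<close>

text \<open>By Markov's inequality the sets where \<open>min 1 ((norm x)\<^sup>2)\<close> is at least \<open>1 / (k + 1)\<close> have finite measure, and they exhaust the complement of \<open>0\<close>.\<close>

lemma levy_measure_sigma_finite:
  fixes \<nu> :: "'a::euclidean_space measure"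
  assumes \<nu>: "levy_measure \<nu>" shows "sigma_finite_measure \<nu>"
proof -
  let ?m = "\<lambda>x::'a. min 1 ((norm x)\<^sup>2)"
  define A where "A n = (case n of 0 \<Rightarrow> {0} | Suc k \<Rightarrow> {x. 1 / real (Suc k) \<le> ?m x})" for n
  have sets: "sets \<nu> = sets borel" using \<nu> by (simp add: levy_measure_def)
  hence space: "space \<nu> = UNIV" by (metis sets_eq_imp_space_eq space_borel)
  show ?thesis
  proof (unfold sigma_finite_measure_def, intro exI[of _ "range A"] conjI ballI)
    show "countable (range A)" by simp
    show sub: "range A \<subseteq> sets \<nu>"
    proof
      fix C assume "C \<in> range A"
      then obtain n where C: "C = A n" by auto
      show "C \<in> sets \<nu>"
      proof (cases n)
        case (Suc k)
        have "{x. 1 / real (Suc k) \<le> ?m x} \<in> sets (borel :: 'a measure)" by measurable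
        thus ?thesis using Suc C by (simp add: A_def sets)
      qed (simp add: C A_def sets)
    qed
    show "\<Union> (range A) = space \<nu>"
    proof -
      have "x \<in> \<Union> (range A)" for x
      proof (cases "x = 0")
        case True
        then show ?thesis by (auto intro!: exI[of _ 0] simp: A_def)
      next
        case False
        hence "0 < ?m x" by simp
        then obtain k where "1 / real (Suc k) < ?m x" using nat_approx_posE by blast
        thus ?thesis by (auto intro!: exI[of _ "Suc k"] simp: A_def)
      qed
      thus ?thesis using space by auto
    qed
    fix C assume "C \<in> range A"
    then obtain n where C: "C = A n" by auto
    show "emeasure \<nu> C \<noteq> \<infinity>"
    proof (cases n)
      case 0
      then show ?thesis using \<nu> by (simp add: C A_def levy_measure_def)
    next
      case (Suc k)
      have "emeasure \<nu> (A n) = (\<integral>\<^sup>+x. indicator (A n) x \<partial>\<nu>)"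
        using sub by (subst nn_integral_indicator) auto
      also have "\<dots> \<le> (\<integral>\<^sup>+x. ennreal (real (Suc k)) * ennreal (?m x) \<partial>\<nu>)"
      proof (rule nn_integral_mono)
        fix x
        have "1 \<le> real (Suc k) * ?m x" if "x \<in> A n"
          using that Suc by (simp only: A_def nat.case mem_Collect_eq) (subst (asm) pos_divide_le_eq, auto simp: mult.commute)
        thus "indicator (A n) x \<le> ennreal (real (Suc k)) * ennreal (?m x)"
        proof (cases "x \<in> A n")
          case True
          hence "ennreal 1 \<le> ennreal (real (Suc k) * ?m x)"
            using \<open>x \<in> A n \<Longrightarrow> 1 \<le> real (Suc k) * ?m x\<close> by (intro ennreal_leI)
          also have "\<dots> = ennreal (real (Suc k)) * ennreal (?m x)" by (intro ennreal_mult) auto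
          finally show ?thesis using True by simp
        qed simp
      qed
      also have "\<dots> = ennreal (real (Suc k)) * (\<integral>\<^sup>+x. ennreal (?m x) \<partial>\<nu>)"
        by (intro nn_integral_cmult levy_measure_measurable[OF \<nu>]) measurable
      also have "\<dots> < \<infinity>"
        using \<nu> unfolding levy_measure_def by (auto simp: ennreal_mult_less_top simp del: of_nat_Suc)
      finally show ?thesis using C by simp
    qed
  qed
qed

text \<open>A majorant of the exponent that, unlike the exponent itself, is monotone in the modulus of the
  frequency; dominated convergence can therefore be applied to approximations of the integrand.\<close>

definition jump_bound :: "real measure \<Rightarrow> real \<Rightarrow> ennreal" where
  "jump_bound \<nu>R u = (\<integral>\<^sup>+x. ennreal (min 2 (u\<^sup>2 * x\<^sup>2)) \<partial>\<nu>R)"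

lemma jump_bound_measurable_integrand:
  "levy_measure \<nu>R \<Longrightarrow> (\<lambda>x. ennreal (min 2 (u\<^sup>2 * x\<^sup>2))) \<in> borel_measurable \<nu>R"
  by (rule levy_measure_measurable) measurable

lemma jump_bound_measurable:
  assumes \<nu>R: "levy_measure \<nu>R" shows "jump_bound \<nu>R \<in> borel_measurable borel"
proof -
  interpret sigma_finite_measure \<nu>R by (rule levy_measure_sigma_finite[OF \<nu>R])
  have "sets (borel \<Otimes>\<^sub>M \<nu>R) = sets (borel \<Otimes>\<^sub>M (borel :: real measure))"
    using \<nu>R by (intro sets_pair_measure_cong) (auto simp: levy_measure_def)
  moreover have "(\<lambda>(u, x). ennreal (min 2 (u\<^sup>2 * x\<^sup>2))) \<in> borel_measurable (borel \<Otimes>\<^sub>M (borel :: real measure))"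
    by measurable
  ultimately have "(\<lambda>(u, x). ennreal (min 2 (u\<^sup>2 * x\<^sup>2))) \<in> borel_measurable (borel \<Otimes>\<^sub>M \<nu>R)"
    using measurable_cong_sets[OF _ refl] by blast
  hence "(\<lambda>u. \<integral>\<^sup>+x. ennreal (min 2 (u\<^sup>2 * x\<^sup>2)) \<partial>\<nu>R) \<in> borel_measurable borel"
    by (rule borel_measurable_nn_integral)
  thus ?thesis by (simp add: jump_bound_def[abs_def])
qed

lemma jump_bound_mono: "0 \<le> u \<Longrightarrow> u \<le> v \<Longrightarrow> jump_bound \<nu>R u \<le> jump_bound \<nu>R v"
  unfolding jump_bound_def by (intro nn_integral_mono ennreal_leI min.mono mult_right_mono power_mono) auto

lemma cos_exponent_le_jump_bound:
  assumes \<nu>R: "levy_measure \<nu>R" shows "ennreal (cos_exponent \<nu>R u) \<le> jump_bound \<nu>R u"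
proof -
  have "ennreal (cos_exponent \<nu>R u) = (\<integral>\<^sup>+x. ennreal (1 - cos (u \<bullet> x)) \<partial>\<nu>R)"
    unfolding cos_exponent_def using cos_exponent_integrable[OF \<nu>R] by (intro nn_integral_eq_integral[symmetric]) auto
  also have "\<dots> \<le> jump_bound \<nu>R u" unfolding jump_bound_def
  proof (intro nn_integral_mono ennreal_leI)
    fix x
    have "1 - cos (u * x) \<le> 2" using cos_ge_minus_one[of "u * x"] by linarith
    moreover have "1 - cos (u * x) \<le> (u * x)\<^sup>2" using one_minus_cos_le_square[of "u * x"] by (smt (verit) zero_le_power2 field_sum_of_halves)
    ultimately show "1 - cos (u \<bullet> x) \<le> min 2 (u\<^sup>2 * x\<^sup>2)" by (simp add: power_mult_distrib)
  qed
  finally show ?thesis .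
qed

lemma min_mult_le: "1 \<le> c \<Longrightarrow> 0 \<le> y \<Longrightarrow> min 2 (c * y) \<le> c * min 2 (y::real)"
  using mult_mono[of 1 c 2 y] by (cases "y \<le> 2") (auto simp: min_def)

lemma jump_bound_scale:
  assumes \<nu>R: "levy_measure \<nu>R" and c: "1 \<le> c" "k\<^sup>2 \<le> c"
  shows "jump_bound \<nu>R (k * u) \<le> ennreal c * jump_bound \<nu>R u"
proof -
  have "jump_bound \<nu>R (k * u) \<le> (\<integral>\<^sup>+x. ennreal c * ennreal (min 2 (u\<^sup>2 * x\<^sup>2)) \<partial>\<nu>R)"
    unfolding jump_bound_def
  proof (intro nn_integral_mono)
    fix x
    have "(k * u)\<^sup>2 * x\<^sup>2 = k\<^sup>2 * (u\<^sup>2 * x\<^sup>2)" by (simp add: power_mult_distrib)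
    also have "\<dots> \<le> c * (u\<^sup>2 * x\<^sup>2)" using c by (intro mult_right_mono) auto
    finally have "min 2 ((k * u)\<^sup>2 * x\<^sup>2) \<le> min 2 (c * (u\<^sup>2 * x\<^sup>2))" by simp
    also have "\<dots> \<le> c * min 2 (u\<^sup>2 * x\<^sup>2)" using c by (intro min_mult_le) auto
    finally show "ennreal (min 2 ((k * u)\<^sup>2 * x\<^sup>2)) \<le> ennreal c * ennreal (min 2 (u\<^sup>2 * x\<^sup>2))"
      using c by (simp add: ennreal_mult[symmetric] ennreal_leI)
  qed
  also have "\<dots> = ennreal c * jump_bound \<nu>R u"
    unfolding jump_bound_def by (intro nn_integral_cmult jump_bound_measurable_integrand[OF \<nu>R])
  finally show ?thesis .
qed

lemma jump_bound_add:
  assumes \<nu>R: "levy_measure \<nu>R"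
  shows "jump_bound \<nu>R (u + v) \<le> 2 * jump_bound \<nu>R u + 2 * jump_bound \<nu>R v"
proof -
  have "jump_bound \<nu>R (u + v) \<le> (\<integral>\<^sup>+x. 2 * ennreal (min 2 (u\<^sup>2 * x\<^sup>2)) + 2 * ennreal (min 2 (v\<^sup>2 * x\<^sup>2)) \<partial>\<nu>R)"
    unfolding jump_bound_def
  proof (intro nn_integral_mono)
    fix x
    have "0 \<le> (u - v)\<^sup>2 * x\<^sup>2" by simp
    hence "(u + v)\<^sup>2 * x\<^sup>2 \<le> 2 * (u\<^sup>2 * x\<^sup>2) + 2 * (v\<^sup>2 * x\<^sup>2)" by (simp add: power2_eq_square algebra_simps)
    moreover have "0 \<le> u\<^sup>2 * x\<^sup>2" "0 \<le> v\<^sup>2 * x\<^sup>2" by auto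
    ultimately have "min 2 ((u + v)\<^sup>2 * x\<^sup>2) \<le> 2 * min 2 (u\<^sup>2 * x\<^sup>2) + 2 * min 2 (v\<^sup>2 * x\<^sup>2)" by linarith
    moreover have "2 * ennreal (min 2 (u\<^sup>2 * x\<^sup>2)) + 2 * ennreal (min 2 (v\<^sup>2 * x\<^sup>2)) = ennreal (2 * min 2 (u\<^sup>2 * x\<^sup>2) + 2 * min 2 (v\<^sup>2 * x\<^sup>2))"
      by (simp add: ennreal_plus ennreal_mult)
    ultimately show "ennreal (min 2 ((u + v)\<^sup>2 * x\<^sup>2)) \<le> 2 * ennreal (min 2 (u\<^sup>2 * x\<^sup>2)) + 2 * ennreal (min 2 (v\<^sup>2 * x\<^sup>2))"
      by (simp only: ennreal_leI)
  qed
  also have "\<dots> = 2 * jump_bound \<nu>R u + 2 * jump_bound \<nu>R v"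
    unfolding jump_bound_def using jump_bound_measurable_integrand[OF \<nu>R]
    by (simp add: nn_integral_add nn_integral_cmult)
  finally show ?thesis .
qed

lemma jump_bound_finite:
  assumes \<nu>R: "levy_measure \<nu>R" shows "jump_bound \<nu>R u < \<infinity>"
proof -
  have "jump_bound \<nu>R u \<le> ennreal (max 2 (u\<^sup>2)) * jump_bound \<nu>R 1"
    using jump_bound_scale[OF \<nu>R, of "max 2 (u\<^sup>2)" u 1] by simp
  moreover have "jump_bound \<nu>R 1 \<le> (\<integral>\<^sup>+x. 2 * ennreal (min 1 ((norm x)\<^sup>2)) \<partial>\<nu>R)"
    unfolding jump_bound_def
  proof (intro nn_integral_mono)
    fix x :: real
    have "min 2 (1\<^sup>2 * x\<^sup>2) \<le> 2 * min 1 ((norm x)\<^sup>2)"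
      using zero_le_power2[of x] by (simp add: min_def)
    hence "ennreal (min 2 (1\<^sup>2 * x\<^sup>2)) \<le> ennreal (2 * min 1 ((norm x)\<^sup>2))" by (rule ennreal_leI)
    thus "ennreal (min 2 (1\<^sup>2 * x\<^sup>2)) \<le> 2 * ennreal (min 1 ((norm x)\<^sup>2))" by (simp add: ennreal_mult)
  qed
  moreover have "(\<integral>\<^sup>+x. 2 * ennreal (min 1 ((norm x)\<^sup>2)) \<partial>\<nu>R) = 2 * (\<integral>\<^sup>+x. ennreal (min 1 ((norm x)\<^sup>2)) \<partial>\<nu>R)"
    by (intro nn_integral_cmult levy_measure_measurable[OF \<nu>R]) measurable
  moreover have "\<dots> < \<infinity>" using \<nu>R by (simp add: levy_measure_def ennreal_mult_less_top)
  ultimately have "jump_bound \<nu>R 1 < \<infinity>" by (metis order_le_less_trans)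
  with \<open>jump_bound \<nu>R u \<le> ennreal (max 2 (u\<^sup>2)) * jump_bound \<nu>R 1\<close> show ?thesis
    by (auto simp: ennreal_mult_less_top intro: order_le_less_trans)
qed

lemma jump_bound_tendsto_0:
  assumes \<nu>R: "levy_measure \<nu>R" and u: "u \<longlonglongrightarrow> 0"
  shows "(\<lambda>n. jump_bound \<nu>R (u n)) \<longlonglongrightarrow> 0"
proof -
  obtain K where K: "\<And>n. norm (u n) \<le> K"
    using u by (metis Bseq_def convergentI convergent_imp_Bseq)
  have "(\<lambda>n. jump_bound \<nu>R (u n)) \<longlonglongrightarrow> (\<integral>\<^sup>+x. 0 \<partial>\<nu>R)"
    unfolding jump_bound_def
  proof (rule nn_integral_dominated_convergence[where w="\<lambda>x. ennreal (min 2 (K\<^sup>2 * x\<^sup>2))"])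
    show "(\<integral>\<^sup>+x. ennreal (min 2 (K\<^sup>2 * x\<^sup>2)) \<partial>\<nu>R) < \<infinity>"
      using jump_bound_finite[OF \<nu>R, of K] by (simp add: jump_bound_def)
    show "AE x in \<nu>R. ennreal (min 2 ((u n)\<^sup>2 * x\<^sup>2)) \<le> ennreal (min 2 (K\<^sup>2 * x\<^sup>2))" for n
    proof (intro AE_I2 ennreal_leI min.mono mult_right_mono order_refl)
      show "(u n)\<^sup>2 \<le> K\<^sup>2" using K[of n] power_mono[of "\<bar>u n\<bar>" K 2] by simp
    qed auto
    show "AE x in \<nu>R. (\<lambda>n. ennreal (min 2 ((u n)\<^sup>2 * x\<^sup>2))) \<longlonglongrightarrow> 0"
    proof (rule AE_I2)
      fix x
      have "(\<lambda>n. min 2 ((u n)\<^sup>2 * x\<^sup>2)) \<longlonglongrightarrow> min 2 (0\<^sup>2 * x\<^sup>2)" by (intro tendsto_intros u)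
      hence "(\<lambda>n. ennreal (min 2 ((u n)\<^sup>2 * x\<^sup>2))) \<longlonglongrightarrow> ennreal (min 2 (0\<^sup>2 * x\<^sup>2))" by (rule tendsto_ennrealI)
      thus "(\<lambda>n. ennreal (min 2 ((u n)\<^sup>2 * x\<^sup>2))) \<longlonglongrightarrow> 0" by simp
    qed
  qed (rule jump_bound_measurable_integrand[OF \<nu>R] | simp)+
  thus ?thesis by simp
qed

section \<open>Fast convergence in probability\<close>

context prob_space
begin

lemma conv_in_prob_of_AE:
  assumes T[measurable]: "\<And>n. T n \<in> borel_measurable M" and Y[measurable]: "Y \<in> borel_measurable M"
    and lim: "AE \<omega> in M. (\<lambda>n. T n \<omega>) \<longlonglongrightarrow> Y \<omega>"
  shows "conv_in_prob M T Y"
  unfolding conv_in_prob_def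
proof (intro conjI allI impI T Y)
  fix e :: real assume e: "0 < e"
  let ?A = "\<lambda>n. {\<omega> \<in> space M. dist (T n \<omega>) (Y \<omega>) > e}"
  have "(\<lambda>n. \<integral>\<omega>. indicat_real (?A n) \<omega> \<partial>M) \<longlonglongrightarrow> (\<integral>\<omega>. 0 \<partial>M)"
  proof (rule integral_dominated_convergence[where w="\<lambda>_. 1"])
    show "AE \<omega> in M. (\<lambda>n. indicat_real (?A n) \<omega>) \<longlonglongrightarrow> 0"
      using lim
    proof eventually_elim
      case (elim \<omega>)
      have "\<forall>\<^sub>F n in sequentially. indicat_real (?A n) \<omega> = 0"
        using tendstoD[OF elim e] by eventually_elim auto
      thus ?case by (rule tendsto_eventually)
    qed
    show "AE \<omega> in M. norm (indicat_real (?A n) \<omega>) \<le> 1" for n by (simp add: indicator_def)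
  qed simp_all
  thus "(\<lambda>n. prob (?A n)) \<longlonglongrightarrow> 0" by simp
qed

text \<open>By the Borel-Cantelli lemma almost surely all but finitely many increments are bounded by the terms of a convergent series.\<close>

lemma conv_in_prob_of_summable:
  assumes T[measurable]: "\<And>n. T n \<in> borel_measurable M"
    and small: "\<And>n. prob {\<omega> \<in> space M. c n < dist (T (Suc n) \<omega>) (T n \<omega>)} \<le> p n"
    and c: "summable c" and p: "summable p"
  shows "\<exists>Y. conv_in_prob M T Y"
proof -
  let ?A = "\<lambda>n. {\<omega> \<in> space M. c n < dist (T (Suc n) \<omega>) (T n \<omega>)}"
  define Y where "Y \<omega> = lim (\<lambda>n. T n \<omega>)" for \<omega>
  have [measurable]: "Y \<in> borel_measurable M" unfolding Y_def by (rule borel_measurable_lim_metric) measurable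
  have "summable (\<lambda>n. prob (?A n))"
    using small by (intro summable_comparison_test'[OF p]) auto
  hence "AE \<omega> in M. \<forall>\<^sub>F n in sequentially. \<omega> \<in> space M - ?A n"
    by (intro borel_cantelli_AE1) (auto simp: emeasure_eq_measure)
  hence "AE \<omega> in M. (\<lambda>n. T n \<omega>) \<longlonglongrightarrow> Y \<omega>"
  proof eventually_elim
    case (elim \<omega>)
    hence "\<forall>\<^sub>F n in sequentially. norm (T (Suc n) \<omega> - T n \<omega>) \<le> c n"
      by eventually_elim (auto simp: dist_norm)
    hence "summable (\<lambda>n. T (Suc n) \<omega> - T n \<omega>)" using c by (rule summable_comparison_test_ev)
    hence "convergent (\<lambda>n. \<Sum>i<n. T (Suc i) \<omega> - T i \<omega>)" by (simp add: summable_iff_convergent)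
    moreover have "(\<Sum>i<n. T (Suc i) \<omega> - T i \<omega>) = T n \<omega> - T 0 \<omega>" for n
      by (induction n) auto
    ultimately have "convergent (\<lambda>n. (T n \<omega> - T 0 \<omega>) + T 0 \<omega>)"
      by (intro convergent_add convergent_const) simp
    thus ?case by (simp add: Y_def convergent_LIMSEQ_iff)
  qed
  thus ?thesis using conv_in_prob_of_AE[of T Y] by auto
qed

text \<open>The truncation inequality. The mean of \<open>1 - cos (r x)\<close> over \<open>0 \<le> r \<le> R\<close> is \<open>1 - sin (R x) / (R x)\<close>, which is at
  least \<open>1 / 2\<close> as soon as \<open>\<bar>x\<bar> \<ge> 2 / R\<close>.\<close>

lemma prob_ge_le_cos_mean:
  fixes X :: "'a \<Rightarrow> real"
  assumes [measurable]: "X \<in> borel_measurable M" and R: "0 < R" and d: "0 \<le> \<delta>"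
    and le: "\<And>r. 0 \<le> r \<Longrightarrow> r \<le> R \<Longrightarrow> (\<integral>\<omega>. 1 - cos (r * X \<omega>) \<partial>M) \<le> \<delta>"
  shows "prob {\<omega> \<in> space M. 2 / R \<le> \<bar>X \<omega>\<bar>} \<le> 2 * \<delta>"
proof -
  interpret pair_sigma_finite lborel M ..
  let ?f = "\<lambda>r \<omega>. ennreal (1 - cos (r * X \<omega>)) * indicator {0..R} r"
  let ?A = "{\<omega> \<in> space M. 2 / R \<le> \<bar>X \<omega>\<bar>}"
  have inner: "ennreal (R / 2) \<le> (\<integral>\<^sup>+r. ?f r \<omega> \<partial>lborel)" if "\<omega> \<in> ?A" for \<omega>
  proof -
    let ?x = "X \<omega>"
    have x: "2 / R \<le> \<bar>?x\<bar>" "?x \<noteq> 0" using that R by (auto simp: divide_le_0_iff)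
    have "(\<integral>\<^sup>+r. ?f r \<omega> \<partial>lborel) = ennreal ((R - sin (R * ?x) / ?x) - (0 - sin (0 * ?x) / ?x))"
      by (rule nn_integral_FTC_Icc) (use R x in \<open>auto intro!: derivative_eq_intros\<close>)
    moreover have "R / 2 \<le> R - sin (R * ?x) / ?x"
    proof -
      have "sin (R * ?x) / ?x \<le> \<bar>sin (R * ?x)\<bar> / \<bar>?x\<bar>" by (simp flip: abs_divide)
      also have "\<dots> \<le> 1 / \<bar>?x\<bar>" by (intro divide_right_mono) auto
      also have "\<dots> \<le> R / 2" using x R by (simp add: field_simps)
      finally show ?thesis by simp
    qed
    ultimately show ?thesis by (simp add: ennreal_leI)
  qed
  have "ennreal (R / 2) * emeasure M ?A = (\<integral>\<^sup>+\<omega>. ennreal (R / 2) * indicator ?A \<omega> \<partial>M)"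
    by (subst nn_integral_cmult_indicator) auto
  also have "\<dots> \<le> (\<integral>\<^sup>+\<omega>. \<integral>\<^sup>+r. ?f r \<omega> \<partial>lborel \<partial>M)"
    using inner by (intro nn_integral_mono) (auto simp: indicator_def)
  also have "\<dots> = (\<integral>\<^sup>+r. \<integral>\<^sup>+\<omega>. ?f r \<omega> \<partial>M \<partial>lborel)"
    by (rule Fubini') measurable
  also have "\<dots> \<le> (\<integral>\<^sup>+r. ennreal \<delta> * indicator {0..R} r \<partial>lborel)"
  proof (intro nn_integral_mono)
    fix r :: real
    have "(\<integral>\<^sup>+\<omega>. ennreal (1 - cos (r * X \<omega>)) \<partial>M) = ennreal (\<integral>\<omega>. 1 - cos (r * X \<omega>) \<partial>M)"
    proof (rule nn_integral_eq_integral)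
      show "integrable M (\<lambda>\<omega>. 1 - cos (r * X \<omega>))"
      proof (rule integrable_norm_le[where B=2])
        show "norm (1 - cos (r * X \<omega>)) \<le> 2" for \<omega>
          using cos_ge_minus_one[of "r * X \<omega>"] cos_le_one[of "r * X \<omega>"] unfolding real_norm_def abs_le_iff by linarith
      qed measurable
    qed simp
    thus "(\<integral>\<^sup>+\<omega>. ?f r \<omega> \<partial>M) \<le> ennreal \<delta> * indicator {0..R} r"
      using le[of r] by (cases "r \<in> {0..R}") (auto intro!: ennreal_leI)
  qed
  also have "\<dots> = ennreal (\<delta> * R)"
    using R d by (subst nn_integral_cmult_indicator) (auto simp: ennreal_mult)
  finally have "ennreal (R / 2) * emeasure M ?A \<le> ennreal (\<delta> * R)" .
  hence "ennreal (R / 2 * prob ?A) \<le> ennreal (\<delta> * R)"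
    unfolding emeasure_eq_measure using R by (subst ennreal_mult) auto
  hence "R / 2 * prob ?A \<le> \<delta> * R" using R d by (subst (asm) ennreal_le_iff) auto
  thus ?thesis using R by (simp add: field_simps)
qed

end

section \<open>Approximation by simple functions\<close>

lemma simple_function_rep:
  fixes f :: "real \<Rightarrow> complex"
  assumes f: "simple_function borel f"
  shows "\<exists>d. is_simple_rep d \<and> (\<forall>s. simple_fun d s = indicator {-r..r} s * f s)"
proof -
  have fin: "finite (range f)" using simple_functionD(1)[OF f] by simp
  then obtain vs where vs: "set vs = range f" "distinct vs" using finite_distinct_list by blast
  define piece where "piece v = (v, f -` {v} \<inter> {-r..r})" for v
  let ?d = "map piece vs"
  have fm: "f -` {v} \<in> sets borel" for v
    using simple_functionD(2)[OF f, of "{v}"] by simp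
  have "sorted_wrt disjnt (map snd ?d)"
    using vs(2) by (auto simp: piece_def disjnt_iff sorted_wrt_iff_nth_less nth_eq_iff_index_eq)
  moreover have "bounded_rep ?d"
    using fm by (auto simp: bounded_rep_def piece_def intro: bounded_subset[of "{-r..r}"])
  moreover have "simple_fun ?d s = indicator {-r..r} s * f s" for s
  proof -
    have "simple_fun ?d s = (\<Sum>v\<in>range f. v * indicator (f -` {v} \<inter> {-r..r}) s)"
      unfolding simple_fun_def vs(1)[symmetric]
      by (simp add: piece_def comp_def sum_list_distinct_conv_sum_set[OF vs(2)])
    also have "\<dots> = (\<Sum>v\<in>range f. if v = f s then v * indicator {-r..r} s else 0)"
      by (intro sum.cong) (auto simp: indicator_def)
    also have "\<dots> = indicator {-r..r} s * f s" using fin by (subst sum.delta) auto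
    finally show ?thesis .
  qed
  ultimately show ?thesis by (intro exI[of _ ?d]) (simp add: is_simple_rep_iff)
qed

text \<open>The approximants are bounded by \<open>2 * norm (g s)\<close>, so the error at \<open>s\<close> is at most \<open>3 * norm (g s)\<close> and its jump bound at most
  \<open>9\<close> times that of \<open>g\<close>: dominated convergence applies.\<close>

lemma simple_rep_approximation:
  assumes \<nu>R: "levy_measure \<nu>R" and g[measurable]: "g \<in> borel_measurable borel"
    and fin: "(\<integral>\<^sup>+s. jump_bound \<nu>R (norm (g s)) \<partial>lborel) < \<infinity>"
  obtains G where "\<And>n. is_simple_rep (G n)" "\<And>s. (\<lambda>n. simple_fun (G n) s) \<longlonglongrightarrow> g s"
    "(\<lambda>n. \<integral>\<^sup>+s. jump_bound \<nu>R (norm (simple_fun (G n) s - g s)) \<partial>lborel) \<longlonglongrightarrow> 0"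
proof -
  let ?J = "\<lambda>w. jump_bound \<nu>R (norm w)"
  note [measurable] = jump_bound_measurable[OF \<nu>R]
  obtain F where F: "\<And>i. simple_function borel (F i)" "\<And>s. (\<lambda>i. F i s) \<longlonglongrightarrow> g s" "\<And>i s. norm (F i s) \<le> 2 * norm (g s)"
    using borel_measurable_implies_sequence_metric[OF g, of 0] by auto
  have "\<exists>d. is_simple_rep d \<and> (\<forall>s. simple_fun d s = indicator {-real n..real n} s * F n s)" for n
    by (rule simple_function_rep[OF F(1)])
  then obtain G where G: "\<And>n. is_simple_rep (G n)" "\<And>n s. simple_fun (G n) s = indicator {-real n..real n} s * F n s"
    by metis
  have lim: "(\<lambda>n. simple_fun (G n) s) \<longlonglongrightarrow> g s" for s
  proof -
    obtain N :: nat where N: "\<bar>s\<bar> \<le> real N" using real_arch_simple by blast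
    have "\<forall>\<^sub>F n in sequentially. F n s = simple_fun (G n) s"
      using eventually_ge_at_top[of N]
    proof eventually_elim
      case (elim n)
      hence "\<bar>s\<bar> \<le> real n" using N by linarith
      thus ?case by (simp add: G(2) indicator_def abs_le_iff)
    qed
    with F(2) show ?thesis by (rule Lim_transform_eventually)
  qed
  have [measurable]: "simple_fun (G n) \<in> borel_measurable borel" for n
    using G(1) by (intro simple_fun_measurable) (simp add: is_simple_rep_iff)
  have "(\<lambda>n. \<integral>\<^sup>+s. ?J (simple_fun (G n) s - g s) \<partial>lborel) \<longlonglongrightarrow> (\<integral>\<^sup>+s. 0 \<partial>(lborel :: real measure))"
  proof (rule nn_integral_dominated_convergence[where w="\<lambda>s. ennreal 9 * ?J (g s)"])
    show "(\<integral>\<^sup>+s. ennreal 9 * ?J (g s) \<partial>lborel) < \<infinity>"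
      using fin by (subst nn_integral_cmult) (auto simp: ennreal_mult_less_top)
    show "AE s in lborel. ?J (simple_fun (G n) s - g s) \<le> ennreal 9 * ?J (g s)" for n
    proof (rule AE_I2)
      fix s
      have "norm (simple_fun (G n) s - g s) \<le> norm (simple_fun (G n) s) + norm (g s)" by (rule norm_triangle_ineq4)
      also have "norm (simple_fun (G n) s) \<le> norm (F n s)" by (simp add: G(2) indicator_def)
      also have "norm (F n s) \<le> 2 * norm (g s)" by (rule F(3))
      finally have "?J (simple_fun (G n) s - g s) \<le> jump_bound \<nu>R (3 * norm (g s))"
        by (intro jump_bound_mono) auto
      also have "\<dots> \<le> ennreal 9 * ?J (g s)" by (rule jump_bound_scale[OF \<nu>R]) auto
      finally show "?J (simple_fun (G n) s - g s) \<le> ennreal 9 * ?J (g s)" .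
    qed
    show "AE s in lborel. (\<lambda>n. ?J (simple_fun (G n) s - g s)) \<longlonglongrightarrow> 0"
    proof (intro AE_I2 jump_bound_tendsto_0[OF \<nu>R])
      show "(\<lambda>n. norm (simple_fun (G n) s - g s)) \<longlonglongrightarrow> 0" for s
        using lim[of s] by (intro tendsto_norm_zero LIM_zero)
    qed
  qed measurable
  hence "(\<lambda>n. \<integral>\<^sup>+s. ?J (simple_fun (G n) s - g s) \<partial>lborel) \<longlonglongrightarrow> 0" by simp
  with G(1) lim show ?thesis by (rule that)
qed

context rotation_invariant_levy
begin

text \<open>The bound does not depend on the set \<open>B\<close>, so one approximating sequence serves all Borel sets.\<close>

lemma simple_integral_prob_le:
  assumes \<nu>R: "levy_measure \<nu>R" and \<phi>: "\<And>z. \<phi> z = cos_exponent \<nu>R (norm z)"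
    and g: "bounded_rep g" and B: "B \<in> sets borel" and R: "1 \<le> R" and d: "0 \<le> \<delta>"
    and le: "(\<integral>\<^sup>+s. jump_bound \<nu>R (norm (simple_fun g s)) \<partial>lborel) \<le> ennreal \<delta>"
  shows "prob {\<omega> \<in> space P. 4 / R < norm (simple_integral \<Lambda> g B \<omega>)} \<le> 4 * R\<^sup>2 * \<delta>"
proof -
  note [measurable] = jump_bound_measurable[OF \<nu>R] simple_fun_measurable[OF g]
  let ?S = "simple_integral \<Lambda> g B"
  have [measurable]: "?S \<in> borel_measurable P" by (rule simple_integral_measurable[OF g B])
  have R2: "1 \<le> R\<^sup>2" using R by (rule one_le_power)
  have dir: "prob {\<omega> \<in> space P. 2 / R \<le> \<bar>w \<bullet> ?S \<omega>\<bar>} \<le> 2 * (R\<^sup>2 * \<delta>)" if w: "norm w = 1" for w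
  proof (rule prob_ge_le_cos_mean)
    fix r assume r: "0 \<le> r" "r \<le> R"
    define z where "z = of_real r * w"
    define E where "E = (\<integral>s. indicator B s * energy_density z (simple_fun g) s \<partial>lborel)"
    have iE: "integrable lborel (\<lambda>s. indicator B s * energy_density z (simple_fun g) s)"
      by (rule energy_integrable[OF g B])
    have "ennreal E = (\<integral>\<^sup>+s. ennreal (indicator B s * energy_density z (simple_fun g) s) \<partial>lborel)"
      unfolding E_def using iE by (intro nn_integral_eq_integral[symmetric]) (auto simp: cos_exponent_nonneg)
    also have "\<dots> \<le> (\<integral>\<^sup>+s. ennreal (R\<^sup>2) * jump_bound \<nu>R (norm (simple_fun g s)) \<partial>lborel)"
    proof (intro nn_integral_mono)
      fix s
      have "ennreal (indicator B s * energy_density z (simple_fun g) s) \<le> ennreal (energy_density z (simple_fun g) s)"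
        by (intro ennreal_leI) (auto simp: indicator_def cos_exponent_nonneg)
      also have "\<dots> = ennreal (cos_exponent \<nu>R (r * norm (simple_fun g s)))"
        using w r by (simp add: \<phi> z_def norm_mult mult.commute)
      also have "\<dots> \<le> jump_bound \<nu>R (r * norm (simple_fun g s))" by (rule cos_exponent_le_jump_bound[OF \<nu>R])
      also have "\<dots> \<le> ennreal (R\<^sup>2) * jump_bound \<nu>R (norm (simple_fun g s))"
        using R2 r by (intro jump_bound_scale[OF \<nu>R] power_mono) auto
      finally show "ennreal (indicator B s * energy_density z (simple_fun g) s) \<le> ennreal (R\<^sup>2) * jump_bound \<nu>R (norm (simple_fun g s))" .
    qed
    also have "\<dots> = ennreal (R\<^sup>2) * (\<integral>\<^sup>+s. jump_bound \<nu>R (norm (simple_fun g s)) \<partial>lborel)"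
      by (intro nn_integral_cmult) measurable
    also have "\<dots> \<le> ennreal (R\<^sup>2) * ennreal \<delta>" by (intro mult_left_mono le) auto
    also have "\<dots> = ennreal (R\<^sup>2 * \<delta>)" using d by (simp add: ennreal_mult)
    finally have E: "E \<le> R\<^sup>2 * \<delta>" using d by (simp add: ennreal_le_iff)
    have i: "integrable P (\<lambda>\<omega>. iexp (z \<bullet> ?S \<omega>))" by (rule integrable_iexp) measurable
    have zS: "z \<bullet> x = r * (w \<bullet> x)" for x by (simp add: z_def inner_complex_def algebra_simps)
    have "(\<integral>\<omega>. cos (z \<bullet> ?S \<omega>) \<partial>P) = Re (\<integral>\<omega>. iexp (z \<bullet> ?S \<omega>) \<partial>P)"
      unfolding integral_Re[OF i, symmetric] by (simp add: Re_exp)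
    also have "\<dots> = exp (- E)" unfolding char_simple_integral[OF g B] E_def by (simp add: Re_exp)
    finally have "(\<integral>\<omega>. 1 - cos (z \<bullet> ?S \<omega>) \<partial>P) = 1 - exp (- E)"
      by (subst Bochner_Integration.integral_diff) (auto intro!: integrable_norm_le[where B=1] simp: prob_space)
    also have "\<dots> \<le> E" using exp_ge_add_one_self[of "- E"] by linarith
    finally show "(\<integral>\<omega>. 1 - cos (r * (w \<bullet> ?S \<omega>)) \<partial>P) \<le> R\<^sup>2 * \<delta>" using E by (simp add: zS)
  qed (use R d in auto)
  have "{\<omega> \<in> space P. 4 / R < norm (?S \<omega>)} \<subseteq>
     {\<omega> \<in> space P. 2 / R \<le> \<bar>1 \<bullet> ?S \<omega>\<bar>} \<union> {\<omega> \<in> space P. 2 / R \<le> \<bar>\<i> \<bullet> ?S \<omega>\<bar>}"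
  proof
    fix \<omega> assume "\<omega> \<in> {\<omega> \<in> space P. 4 / R < norm (?S \<omega>)}"
    moreover have "norm (?S \<omega>) \<le> \<bar>Re (?S \<omega>)\<bar> + \<bar>Im (?S \<omega>)\<bar>" by (rule cmod_le)
    moreover have "4 / R = 2 / R + 2 / R" by simp
    ultimately have "\<omega> \<in> space P" "2 / R \<le> \<bar>Re (?S \<omega>)\<bar> \<or> 2 / R \<le> \<bar>Im (?S \<omega>)\<bar>"
      unfolding mem_Collect_eq by linarith+
    thus "\<omega> \<in> {\<omega> \<in> space P. 2 / R \<le> \<bar>1 \<bullet> ?S \<omega>\<bar>} \<union> {\<omega> \<in> space P. 2 / R \<le> \<bar>\<i> \<bullet> ?S \<omega>\<bar>}"
      by (auto simp: inner_complex_def)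
  qed
  hence "prob {\<omega> \<in> space P. 4 / R < norm (?S \<omega>)} \<le>
     prob ({\<omega> \<in> space P. 2 / R \<le> \<bar>1 \<bullet> ?S \<omega>\<bar>} \<union> {\<omega> \<in> space P. 2 / R \<le> \<bar>\<i> \<bullet> ?S \<omega>\<bar>})"
    by (intro finite_measure_mono) auto
  also have "\<dots> \<le> prob {\<omega> \<in> space P. 2 / R \<le> \<bar>1 \<bullet> ?S \<omega>\<bar>} + prob {\<omega> \<in> space P. 2 / R \<le> \<bar>\<i> \<bullet> ?S \<omega>\<bar>}"
    by (intro measure_Un_le) auto
  also have "\<dots> \<le> 4 * R\<^sup>2 * \<delta>" using dir[of 1] dir[of \<i>] by simp
  finally show ?thesis .
qed

text \<open>Along a subsequence the approximation error decays like \<open>(1 / 16) ^ n\<close>. With the frequency bound \<open>R = 2 ^ n\<close>,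
  increments larger than \<open>4 / R\<close> then have probability of order \<open>R\<^sup>2 * (1 / 16) ^ n = (1 / 4) ^ n\<close>.\<close>

lemma levy_integrable_if_jump_bound:
  assumes \<nu>R: "levy_measure \<nu>R" and \<phi>: "\<And>z. \<phi> z = cos_exponent \<nu>R (norm z)"
    and g[measurable]: "g \<in> borel_measurable borel"
    and fin: "(\<integral>\<^sup>+s. jump_bound \<nu>R (norm (g s)) \<partial>lborel) < \<infinity>"
  shows "levy_integrable P \<Lambda> g"
proof -
  let ?J = "\<lambda>w. jump_bound \<nu>R (norm w)"
  note [measurable] = jump_bound_measurable[OF \<nu>R]
  obtain F where F: "\<And>n. is_simple_rep (F n)" "\<And>s. (\<lambda>n. simple_fun (F n) s) \<longlonglongrightarrow> g s"
    and D: "(\<lambda>n. \<integral>\<^sup>+s. ?J (simple_fun (F n) s - g s) \<partial>lborel) \<longlonglongrightarrow> 0"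
    using simple_rep_approximation[OF \<nu>R g fin] by blast
  define \<epsilon> :: "nat \<Rightarrow> real" where "\<epsilon> n = (1 / 16) ^ n" for n
  have \<epsilon>: "0 < \<epsilon> n" for n by (simp add: \<epsilon>_def)
  have "\<exists>k\<ge>n. (\<integral>\<^sup>+s. ?J (simple_fun (F k) s - g s) \<partial>lborel) \<le> ennreal (\<epsilon> n)" for n
  proof -
    have "\<forall>\<^sub>F k in sequentially. (\<integral>\<^sup>+s. ?J (simple_fun (F k) s - g s) \<partial>lborel) < ennreal (\<epsilon> n)"
      using order_tendstoD(2)[OF D] \<epsilon>[of n] by simp
    with eventually_ge_at_top[of n]
    have "\<forall>\<^sub>F k in sequentially. n \<le> k \<and> (\<integral>\<^sup>+s. ?J (simple_fun (F k) s - g s) \<partial>lborel) < ennreal (\<epsilon> n)"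
      by eventually_elim simp
    then show ?thesis unfolding eventually_sequentially by (meson order_refl less_imp_le)
  qed
  then obtain k where k: "\<And>n. n \<le> k n"
    "\<And>n. (\<integral>\<^sup>+s. ?J (simple_fun (F (k n)) s - g s) \<partial>lborel) \<le> ennreal (\<epsilon> n)"
    by metis
  define G where "G n = F (k n)" for n
  have G: "is_simple_rep (G n)" "bounded_rep (G n)" for n using F(1) by (auto simp: G_def is_simple_rep_iff)
  note [measurable] = simple_fun_measurable[OF G(2)]
  have "filterlim k sequentially sequentially"
    using k(1) by (intro filterlim_at_top_mono[OF filterlim_ident]) auto
  hence lim: "(\<lambda>n. simple_fun (G n) s) \<longlonglongrightarrow> g s" for s
    unfolding G_def using F(2) by (rule filterlim_compose[rotated])
  have step: "(\<integral>\<^sup>+s. ?J (simple_fun (G (Suc n) @ scale_rep (-1) (G n)) s) \<partial>lborel) \<le> ennreal (4 * \<epsilon> n)" for n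
  proof -
    have "(\<integral>\<^sup>+s. ?J (simple_fun (G (Suc n) @ scale_rep (-1) (G n)) s) \<partial>lborel) \<le>
      (\<integral>\<^sup>+s. 2 * ?J (simple_fun (G (Suc n)) s - g s) + 2 * ?J (simple_fun (G n) s - g s) \<partial>lborel)"
    proof (intro nn_integral_mono)
      fix s
      have "norm (simple_fun (G (Suc n) @ scale_rep (-1) (G n)) s) \<le>
          norm (simple_fun (G (Suc n)) s - g s) + norm (simple_fun (G n) s - g s)"
        using norm_triangle_ineq4[of "simple_fun (G (Suc n)) s - g s" "simple_fun (G n) s - g s"] by simp
      hence "?J (simple_fun (G (Suc n) @ scale_rep (-1) (G n)) s) \<le>
          jump_bound \<nu>R (norm (simple_fun (G (Suc n)) s - g s) + norm (simple_fun (G n) s - g s))"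
        by (intro jump_bound_mono) auto
      also have "\<dots> \<le> 2 * ?J (simple_fun (G (Suc n)) s - g s) + 2 * ?J (simple_fun (G n) s - g s)"
        by (rule jump_bound_add[OF \<nu>R])
      finally show "?J (simple_fun (G (Suc n) @ scale_rep (-1) (G n)) s) \<le>
         2 * ?J (simple_fun (G (Suc n)) s - g s) + 2 * ?J (simple_fun (G n) s - g s)" .
    qed
    also have "\<dots> = 2 * (\<integral>\<^sup>+s. ?J (simple_fun (G (Suc n)) s - g s) \<partial>lborel) +
        2 * (\<integral>\<^sup>+s. ?J (simple_fun (G n) s - g s) \<partial>lborel)"
      by (simp add: nn_integral_add nn_integral_cmult)
    also have "\<dots> \<le> 2 * ennreal (\<epsilon> (Suc n)) + 2 * ennreal (\<epsilon> n)"
      unfolding G_def by (intro add_mono mult_left_mono k) auto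
    also have "\<dots> = ennreal (2 * \<epsilon> (Suc n) + 2 * \<epsilon> n)"
      using \<epsilon>[of n] \<epsilon>[of "Suc n"] by (simp add: ennreal_plus ennreal_mult)
    also have "\<dots> \<le> ennreal (4 * \<epsilon> n)" using \<epsilon>[of n] by (intro ennreal_leI) (simp add: \<epsilon>_def)
    finally show ?thesis .
  qed
  have "\<exists>Y. conv_in_prob P (\<lambda>n. simple_integral \<Lambda> (G n) B) Y" if B: "B \<in> sets borel" for B
  proof (rule conv_in_prob_of_summable)
    show "simple_integral \<Lambda> (G n) B \<in> borel_measurable P" for n by (rule simple_integral_measurable[OF G(2) B])
    show "prob {\<omega> \<in> space P. 4 * (1 / 2) ^ n < dist (simple_integral \<Lambda> (G (Suc n)) B \<omega>) (simple_integral \<Lambda> (G n) B \<omega>)}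
        \<le> 16 * (1 / 4) ^ n" for n
    proof -
      have "prob {\<omega> \<in> space P. 4 / 2 ^ n < norm (simple_integral \<Lambda> (G (Suc n) @ scale_rep (-1) (G n)) B \<omega>)} \<le> 4 * (2 ^ n)\<^sup>2 * (4 * \<epsilon> n)"
        by (rule simple_integral_prob_le[OF \<nu>R \<phi> _ B _ _ step]) (use G(2) \<epsilon>[of n] in auto)
      also have "4 * (2 ^ n)\<^sup>2 * (4 * \<epsilon> n) = 16 * (1 / 4) ^ n"
      proof -
        have "((2::real) ^ n)\<^sup>2 * (1 / 16) ^ n = (2\<^sup>2 * (1 / 16)) ^ n"
          by (simp only: power_mult_distrib power_mult[symmetric] mult.commute)
        thus ?thesis by (simp add: \<epsilon>_def)
      qed
      finally show ?thesis by (simp add: dist_norm power_one_over field_simps)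
    qed
    show "summable (\<lambda>n. 4 * (1 / 2 :: real) ^ n)" "summable (\<lambda>n. 16 * (1 / 4 :: real) ^ n)"
      by (intro summable_mult summable_geometric; simp)+
  qed
  with G(1) lim g show ?thesis
    unfolding levy_integrable_def approximating_sequence_def by (intro conjI exI[of _ G]) auto
qed

end

section \<open>Integrals of truncated powers\<close>

text \<open>The contribution of a jump of size \<open>x\<close> to the jump bound of an integrand with squared modulus \<open>s powr q\<close>.\<close>

definition truncated_power :: "real \<Rightarrow> real \<Rightarrow> real set \<Rightarrow> ennreal" where
  "truncated_power q x A = (\<integral>\<^sup>+s\<in>A. ennreal (min 2 (x\<^sup>2 * s powr q)) \<partial>lborel)"

lemma truncated_power_le_integral:
  assumes I: "((\<lambda>s. s powr q) has_integral I) A" and A[measurable]: "A \<in> sets borel"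
  shows "truncated_power q x A \<le> ennreal (x\<^sup>2 * I)"
proof -
  have "truncated_power q x A \<le> (\<integral>\<^sup>+s. ennreal (x\<^sup>2) * (ennreal (s powr q) * indicator A s) \<partial>lborel)"
    unfolding truncated_power_def
    by (intro nn_integral_mono) (auto simp: indicator_def ennreal_mult[symmetric] intro!: ennreal_leI)
  also have "\<dots> = ennreal (x\<^sup>2) * (\<integral>\<^sup>+s. ennreal (s powr q) * indicator A s \<partial>lborel)"
    using A by (intro nn_integral_cmult) measurable
  also have "(\<integral>\<^sup>+s. ennreal (s powr q) * indicator A s \<partial>lborel) = ennreal I"
    using I by (intro nn_integral_has_integral_lebesgue') auto
  also have "ennreal (x\<^sup>2) * ennreal I = ennreal (x\<^sup>2 * I)"
    using has_integral_nonneg[OF I] by (simp add: ennreal_mult)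
  finally show ?thesis .
qed

lemma truncated_power_le_length:
  assumes "a \<le> b" shows "truncated_power q x {a..b} \<le> ennreal (2 * (b - a))"
proof -
  have "truncated_power q x {a..b} \<le> (\<integral>\<^sup>+s. 2 * indicator {a..b} s \<partial>lborel)"
    unfolding truncated_power_def
    by (intro nn_integral_mono mult_right_mono) (auto simp flip: ennreal_numeral intro!: ennreal_leI)
  also have "\<dots> = ennreal (2 * (b - a))"
    using assms ennreal_mult[of 2 "b - a"] by (subst nn_integral_cmult_indicator) auto
  finally show ?thesis .
qed

lemma truncated_power_le_sum:
  assumes "A \<subseteq> B \<union> C" and [measurable]: "B \<in> sets borel" "C \<in> sets borel"
  shows "truncated_power q x A \<le> truncated_power q x B + truncated_power q x C"
proof -
  have "truncated_power q x A \<le> (\<integral>\<^sup>+s. ennreal (min 2 (x\<^sup>2 * s powr q)) * indicator B s + ennreal (min 2 (x\<^sup>2 * s powr q)) * indicator C s \<partial>lborel)"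
    unfolding truncated_power_def using assms(1) by (intro nn_integral_mono) (auto simp: indicator_def)
  also have "\<dots> = truncated_power q x B + truncated_power q x C"
    unfolding truncated_power_def by (intro nn_integral_add) measurable
  finally show ?thesis .
qed

text \<open>The truncation level \<open>2\<close> is used below \<open>c\<close> and the power itself above.\<close>

lemma truncated_power_tail:
  assumes q: "q < - 1" and c: "0 < c" and A: "A \<subseteq> {0..}"
  shows "truncated_power q x A \<le> ennreal (2 * c + x\<^sup>2 * (c powr (q + 1) / (- q - 1)))"
proof -
  have "truncated_power q x A \<le> truncated_power q x {0..c} + truncated_power q x {c..}"
    using A by (intro truncated_power_le_sum) auto
  also have "\<dots> \<le> ennreal (2 * (c - 0)) + ennreal (x\<^sup>2 * (- (c powr (q + 1)) / (q + 1)))"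
    using q c by (intro add_mono truncated_power_le_length truncated_power_le_integral has_integral_powr_to_inf) auto
  also have "- (c powr (q + 1)) / (q + 1) = c powr (q + 1) / (- q - 1)"
    using q by (simp add: field_simps)
  also have "ennreal (2 * (c - 0)) + ennreal (x\<^sup>2 * (c powr (q + 1) / (- q - 1))) = ennreal (2 * c + x\<^sup>2 * (c powr (q + 1) / (- q - 1)))"
    using q c by (subst ennreal_plus) auto
  finally show ?thesis .
qed

lemma square_times_powr:
  assumes "x \<noteq> (0::real)" shows "x\<^sup>2 * (\<bar>x\<bar> powr r) powr q = \<bar>x\<bar> powr (2 + r * q)"
proof -
  have "x\<^sup>2 = \<bar>x\<bar> powr 2" using assms by simp
  thus ?thesis by (simp only: powr_powr powr_add)
qed

lemma truncated_power_large_frequencies: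
  assumes \<beta>: "1 / 2 < \<beta>"
  shows "truncated_power (- 2 * \<beta>) x {1..} \<le>
    ennreal ((2 + 1 / (2 * \<beta> - 1)) * (if \<bar>x\<bar> \<le> 1 then x\<^sup>2 else \<bar>x\<bar> powr (1 / \<beta>)))"
proof (cases "\<bar>x\<bar> \<le> 1")
  case True
  have "truncated_power (- 2 * \<beta>) x {1..} \<le> ennreal (x\<^sup>2 * (- (1 powr (- 2 * \<beta> + 1)) / (- 2 * \<beta> + 1)))"
    using \<beta> by (intro truncated_power_le_integral has_integral_powr_to_inf) auto
  also have "x\<^sup>2 * (- (1 powr (- 2 * \<beta> + 1)) / (- 2 * \<beta> + 1)) = 1 / (2 * \<beta> - 1) * x\<^sup>2"
    using \<beta> by (simp add: field_simps)
  also have "\<dots> \<le> (2 + 1 / (2 * \<beta> - 1)) * x\<^sup>2" by (intro mult_right_mono) auto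
  finally show ?thesis using True by (simp add: ennreal_leI)
next
  case False
  hence x: "x \<noteq> 0" by auto
  \<comment> \<open>the point where \<open>x\<^sup>2 * s powr (- 2 * \<beta>)\<close> equals \<open>1\<close>\<close>
  define c where "c = \<bar>x\<bar> powr (1 / \<beta>)"
  have c: "0 < c" using x by (simp add: c_def)
  have e: "2 + 1 / \<beta> * (- 2 * \<beta> + 1) = 1 / \<beta>" using \<beta> by (simp add: field_simps)
  have "x\<^sup>2 * c powr (- 2 * \<beta> + 1) = c"
    unfolding c_def square_times_powr[OF x] e by simp
  hence "2 * c + x\<^sup>2 * (c powr (- 2 * \<beta> + 1) / (- (- 2 * \<beta>) - 1)) = (2 + 1 / (2 * \<beta> - 1)) * c"
    by (simp add: distrib_right)
  moreover have "truncated_power (- 2 * \<beta>) x {1..} \<le> ennreal (2 * c + x\<^sup>2 * (c powr (- 2 * \<beta> + 1) / (- (- 2 * \<beta>) - 1)))"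
    using \<beta> c by (intro truncated_power_tail) auto
  ultimately show ?thesis using False by (simp add: c_def)
qed

text \<open>The exponent \<open>2 - 2 * \<beta>\<close> is integrable at \<open>0\<close> exactly for \<open>\<beta> < 3 / 2\<close>. Beyond that value the truncation
  decides, and at \<open>\<beta> = 3 / 2\<close> the integral of \<open>1 / s\<close> from \<open>x\<^sup>2\<close> to \<open>1\<close> produces the logarithm.\<close>

lemma truncated_power_small_frequencies:
  shows "truncated_power (2 - 2 * \<beta>) x {0..1} \<le>
    ennreal (if 1 < \<bar>x\<bar> then 2
             else if \<beta> < 3 / 2 then 1 / (3 - 2 * \<beta>) * x\<^sup>2
             else if \<beta> = 3 / 2 then 2 * x\<^sup>2 + 2 * (x\<^sup>2 * ln (1 / \<bar>x\<bar>))
             else (2 + 1 / (2 * \<beta> - 3)) * \<bar>x\<bar> powr (1 / (\<beta> - 1)))"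
proof -
  have x0: "truncated_power q 0 A = 0" for q A by (simp add: truncated_power_def)
  consider "1 < \<bar>x\<bar>" | "\<bar>x\<bar> \<le> 1" "\<beta> < 3 / 2" | "\<bar>x\<bar> \<le> 1" "x \<noteq> 0" "\<beta> = 3 / 2" | "\<bar>x\<bar> \<le> 1" "x \<noteq> 0" "3 / 2 < \<beta>" | "x = 0"
    by linarith
  thus ?thesis
  proof cases
    case 1
    then show ?thesis using truncated_power_le_length[of 0 1] by simp
  next
    case 2
    have "truncated_power (2 - 2 * \<beta>) x {0..1} \<le> ennreal (x\<^sup>2 * (1 powr (2 - 2 * \<beta> + 1) / (2 - 2 * \<beta> + 1)))"
      using 2 by (intro truncated_power_le_integral has_integral_powr_from_0) auto
    thus ?thesis using 2 by simp
  next
    case 3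
    have x2: "0 < x\<^sup>2" "x\<^sup>2 \<le> 1" using 3 by (auto simp: abs_square_le_1)
    have "((\<lambda>s. s powr (-1)) has_integral (ln 1 - ln (x\<^sup>2))) {x\<^sup>2..1}"
    proof (rule fundamental_theorem_of_calculus[OF x2(2)])
      fix s assume "s \<in> {x\<^sup>2..1}"
      hence s: "0 < s" using x2(1) unfolding atLeastAtMost_iff by linarith
      hence "s powr (-1) = 1 / s" by (simp add: powr_minus_divide)
      with DERIV_ln_divide[OF s] show "(ln has_vector_derivative s powr (-1)) (at s within {x\<^sup>2..1})"
        by (simp add: has_real_derivative_iff_has_vector_derivative has_vector_derivative_at_within)
    qed
    moreover have "ln 1 - ln (x\<^sup>2) = 2 * ln (1 / \<bar>x\<bar>)"
      using 3 ln_realpow[of "\<bar>x\<bar>" 2] by (simp add: ln_div)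
    ultimately have I: "((\<lambda>s. s powr (-1)) has_integral (2 * ln (1 / \<bar>x\<bar>))) {x\<^sup>2..1}" by simp
    have "truncated_power (-1) x {0..1} \<le> truncated_power (-1) x {0..x\<^sup>2} + truncated_power (-1) x {x\<^sup>2..1}"
      using x2 by (intro truncated_power_le_sum) auto
    also have "\<dots> \<le> ennreal (2 * (x\<^sup>2 - 0)) + ennreal (x\<^sup>2 * (2 * ln (1 / \<bar>x\<bar>)))"
      using x2 by (intro add_mono truncated_power_le_length truncated_power_le_integral I) auto
    also have "\<dots> = ennreal (2 * x\<^sup>2 + 2 * (x\<^sup>2 * ln (1 / \<bar>x\<bar>)))"
      using 3 by (subst ennreal_plus) (auto simp: mult_ac intro!: mult_nonneg_nonneg)
    finally have *: "truncated_power (-1) x {0..1} \<le> ennreal (2 * x\<^sup>2 + 2 * (x\<^sup>2 * ln (1 / \<bar>x\<bar>)))" .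
    have e: "2 - 2 * \<beta> = -1" using 3 by simp
    show ?thesis unfolding e using * 3 by simp
  next
    case 4
    \<comment> \<open>the point where \<open>x\<^sup>2 * s powr (2 - 2 * \<beta>)\<close> equals \<open>1\<close>\<close>
    define c where "c = \<bar>x\<bar> powr (1 / (\<beta> - 1))"
    have c: "0 < c" using 4 by (simp add: c_def)
    have e: "2 + 1 / (\<beta> - 1) * (2 - 2 * \<beta> + 1) = 1 / (\<beta> - 1)" using 4 by (simp add: field_simps)
    have "x\<^sup>2 * c powr (2 - 2 * \<beta> + 1) = c"
      unfolding c_def square_times_powr[OF 4(2)] e by simp
    hence "2 * c + x\<^sup>2 * (c powr (2 - 2 * \<beta> + 1) / (- (2 - 2 * \<beta>) - 1)) = (2 + 1 / (2 * \<beta> - 3)) * c"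
      by (simp add: distrib_right)
    moreover have "truncated_power (2 - 2 * \<beta>) x {0..1} \<le> ennreal (2 * c + x\<^sup>2 * (c powr (2 - 2 * \<beta> + 1) / (- (2 - 2 * \<beta>) - 1)))"
      using 4 c by (intro truncated_power_tail) auto
    ultimately show ?thesis using 4 by (simp add: c_def)
  next
    case 5
    then show ?thesis by (simp add: x0)
  qed
qed

section \<open>The kernel of harmonizable fractional Levy motion\<close>

text \<open>The order of magnitude of the kernel: \<open>\<bar>exp (i t s) - 1\<bar> / \<bar>s\<bar>\<close> is bounded near \<open>0\<close> and at most of order \<open>1 / \<bar>s\<bar>\<close>
  at infinity, and the remaining factor is of order \<open>\<bar>s\<bar> powr (1 - \<beta>)\<close>.\<close>

definition kernel_profile :: "real \<Rightarrow> real \<Rightarrow> real" where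
  "kernel_profile \<beta> s = (if \<bar>s\<bar> \<le> 1 then \<bar>s\<bar> powr (1 - \<beta>) else \<bar>s\<bar> powr (- \<beta>))"

lemma kernel_profile_measurable [measurable]: "kernel_profile \<beta> \<in> borel_measurable borel"
  unfolding kernel_profile_def[abs_def] by measurable

lemma hflm_kernel_measurable [measurable]: "hflm_kernel \<alpha> H a b t \<in> borel_measurable borel"
  unfolding hflm_kernel_def[abs_def] by measurable

lemma hflm_kernel_le_profile:
  "norm (hflm_kernel \<alpha> H a b t s) \<le> (\<bar>a\<bar> + \<bar>b\<bar>) * max 2 \<bar>t\<bar> * kernel_profile (H + 1 / \<alpha>) s"
proof (cases "s = 0")
  case False
  let ?p = "- H - 1 / \<alpha> + 1"
  have p: "?p = 1 - (H + 1 / \<alpha>)" by simp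
  have E: "norm (iexp (t * s) - 1) \<le> min 2 (\<bar>t\<bar> * \<bar>s\<bar>)"
    using norm_iexp_diff_le[of "t * s" 0] by (simp add: abs_mult)
  have le: "\<bar>a * (max s 0) powr ?p + b * (- min s 0) powr ?p\<bar> \<le> (\<bar>a\<bar> + \<bar>b\<bar>) * \<bar>s\<bar> powr ?p"
  proof (cases "0 < s")
    case True
    hence "a * (max s 0) powr ?p + b * (- min s 0) powr ?p = a * \<bar>s\<bar> powr ?p" by (simp add: max_def min_def)
    thus ?thesis by (simp add: abs_mult mult_right_mono)
  next
    case neg: False
    hence "a * (max s 0) powr ?p + b * (- min s 0) powr ?p = b * \<bar>s\<bar> powr ?p" using False by (simp add: max_def min_def)
    thus ?thesis by (simp add: abs_mult mult_right_mono)
  qed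
  have "norm (hflm_kernel \<alpha> H a b t s) \<le> min 2 (\<bar>t\<bar> * \<bar>s\<bar>) / \<bar>s\<bar> * ((\<bar>a\<bar> + \<bar>b\<bar>) * \<bar>s\<bar> powr ?p)"
  proof -
    have "norm (hflm_kernel \<alpha> H a b t s) = norm (iexp (t * s) - 1) / \<bar>s\<bar> * \<bar>a * (max s 0) powr ?p + b * (- min s 0) powr ?p\<bar>"
      unfolding hflm_kernel_def norm_mult norm_divide norm_of_real norm_ii mult_1_left ..
    also have "\<dots> \<le> min 2 (\<bar>t\<bar> * \<bar>s\<bar>) / \<bar>s\<bar> * ((\<bar>a\<bar> + \<bar>b\<bar>) * \<bar>s\<bar> powr ?p)"
      by (rule mult_mono[OF divide_right_mono[OF E] le]) simp_all
    finally show ?thesis .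
  qed
  also have "\<dots> = (\<bar>a\<bar> + \<bar>b\<bar>) * (min 2 (\<bar>t\<bar> * \<bar>s\<bar>) / \<bar>s\<bar> * \<bar>s\<bar> powr ?p)" by (simp add: mult_ac)
  also have "\<dots> \<le> (\<bar>a\<bar> + \<bar>b\<bar>) * (max 2 \<bar>t\<bar> * kernel_profile (H + 1 / \<alpha>) s)"
  proof (rule mult_left_mono)
    show "min 2 (\<bar>t\<bar> * \<bar>s\<bar>) / \<bar>s\<bar> * \<bar>s\<bar> powr ?p \<le> max 2 \<bar>t\<bar> * kernel_profile (H + 1 / \<alpha>) s"
    proof (cases "\<bar>s\<bar> \<le> 1")
      case True
      have "min 2 (\<bar>t\<bar> * \<bar>s\<bar>) / \<bar>s\<bar> \<le> \<bar>t\<bar> * \<bar>s\<bar> / \<bar>s\<bar>" by (intro divide_right_mono) auto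
      also have "\<dots> = \<bar>t\<bar>" using False by simp
      also have "\<dots> \<le> max 2 \<bar>t\<bar>" by simp
      finally have "min 2 (\<bar>t\<bar> * \<bar>s\<bar>) / \<bar>s\<bar> \<le> max 2 \<bar>t\<bar>" .
      thus ?thesis unfolding kernel_profile_def p if_P[OF True] by (rule mult_right_mono) simp
    next
      case nle: False
      have "min 2 (\<bar>t\<bar> * \<bar>s\<bar>) / \<bar>s\<bar> * \<bar>s\<bar> powr ?p \<le> max 2 \<bar>t\<bar> / \<bar>s\<bar> * \<bar>s\<bar> powr ?p"
        by (intro mult_right_mono divide_right_mono) auto
      also have "\<dots> = max 2 \<bar>t\<bar> * (\<bar>s\<bar> powr ?p / \<bar>s\<bar> powr 1)" using False by simp
      also have "\<bar>s\<bar> powr ?p / \<bar>s\<bar> powr 1 = \<bar>s\<bar> powr (- (H + 1 / \<alpha>))"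
        unfolding powr_diff[symmetric] by (rule arg_cong[where f="(powr) \<bar>s\<bar>"]) simp
      finally show ?thesis using nle by (simp add: kernel_profile_def)
    qed
  qed auto
  finally show ?thesis by (simp add: mult.assoc)
qed (simp add: hflm_kernel_def kernel_profile_def)

lemma kernel_profile_truncated:
  "(\<integral>\<^sup>+s. ennreal (min 2 ((kernel_profile \<beta> s)\<^sup>2 * x\<^sup>2)) \<partial>lborel) \<le>
     2 * (truncated_power (2 - 2 * \<beta>) x {0..1} + truncated_power (- 2 * \<beta>) x {1..})"
proof -
  define h where "h s = ennreal (min 2 (x\<^sup>2 * s powr (2 - 2 * \<beta>))) * indicator {0..1} s + ennreal (min 2 (x\<^sup>2 * s powr (- 2 * \<beta>))) * indicator {1..} s" for s
  have [measurable]: "h \<in> borel_measurable borel" unfolding h_def[abs_def] by measurable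
  have sq: "(r powr p)\<^sup>2 = r powr (2 * p)" for r p :: real
    by (simp add: power2_eq_square flip: powr_add)
  have "(\<integral>\<^sup>+s. ennreal (min 2 ((kernel_profile \<beta> s)\<^sup>2 * x\<^sup>2)) \<partial>lborel) \<le> (\<integral>\<^sup>+s. h s + h (- s) \<partial>lborel)"
  proof (intro nn_integral_mono)
    fix s :: real
    have "ennreal (min 2 ((kernel_profile \<beta> s)\<^sup>2 * x\<^sup>2)) \<le> h \<bar>s\<bar>"
      by (auto simp: h_def kernel_profile_def sq indicator_def right_diff_distrib mult.commute)
    also have "h \<bar>s\<bar> \<le> h s + h (- s)" by (cases "0 \<le> s") simp_all
    finally show "ennreal (min 2 ((kernel_profile \<beta> s)\<^sup>2 * x\<^sup>2)) \<le> h s + h (- s)" .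
  qed
  also have "\<dots> = (\<integral>\<^sup>+s. h s \<partial>lborel) + (\<integral>\<^sup>+s. h (- s) \<partial>lborel)"
    by (intro nn_integral_add) measurable
  also have "(\<integral>\<^sup>+s. h (- s) \<partial>lborel) = (\<integral>\<^sup>+s. h s \<partial>lborel)"
    using nn_integral_real_affine[of h "-1" 0] by simp
  also have "(\<integral>\<^sup>+s. h s \<partial>lborel) = truncated_power (2 - 2 * \<beta>) x {0..1} + truncated_power (- 2 * \<beta>) x {1..}"
    unfolding truncated_power_def h_def by (intro nn_integral_add) measurable
  finally show ?thesis by (simp only: mult_2)
qed

text \<open>Tonelli's theorem integrates over the frequency first. The three terms in the resulting bound for fixed \<open>x\<close> are
  integrable by the definition of a Levy measure, by the condition on large jumps, and by the condition on small jumps or its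
  logarithmic variant.\<close>

lemma kernel_profile_jump_bound:
  assumes \<nu>R: "levy_measure \<nu>R" and \<beta>: "1 / 2 < \<beta>"
    and large: "(\<integral>\<^sup>+x\<in>{x. \<bar>x\<bar> > 1}. ennreal (\<bar>x\<bar> powr (1 / \<beta>)) \<partial>\<nu>R) < \<infinity>"
    and small: "3 / 2 < \<beta> \<Longrightarrow> (\<integral>\<^sup>+x\<in>{x. \<bar>x\<bar> \<le> 1}. ennreal (\<bar>x\<bar> powr (1 / (\<beta> - 1))) \<partial>\<nu>R) < \<infinity>"
    and bdry: "\<beta> = 3 / 2 \<Longrightarrow> (\<integral>\<^sup>+x\<in>{x. \<bar>x\<bar> \<le> 1}. ennreal (x\<^sup>2 * ln (1 / \<bar>x\<bar>)) \<partial>\<nu>R) < \<infinity>"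
  shows "(\<integral>\<^sup>+s. jump_bound \<nu>R (kernel_profile \<beta> s) \<partial>lborel) < \<infinity>"
proof -
  let ?S = "\<lambda>x. truncated_power (2 - 2 * \<beta>) x {0..1}" and ?T = "\<lambda>x. truncated_power (- 2 * \<beta>) x {1..}"
  interpret \<nu>: sigma_finite_measure \<nu>R by (rule levy_measure_sigma_finite[OF \<nu>R])
  interpret pair_sigma_finite \<nu>R lborel ..
  have sets[measurable_cong]: "sets \<nu>R = sets borel" using \<nu>R by (simp add: levy_measure_def)
  define sm where "sm x = (if \<beta> < 3 / 2 then 0 else if \<beta> = 3 / 2 then x\<^sup>2 * ln (1 / \<bar>x\<bar>) else \<bar>x\<bar> powr (1 / (\<beta> - 1)))" for x :: real
  have sm_meas[measurable]: "sm \<in> borel_measurable borel" unfolding sm_def[abs_def] by measurable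
  let ?m = "\<lambda>x. ennreal (min 1 ((norm x)\<^sup>2))"
    and ?l = "\<lambda>x. ennreal (\<bar>x\<bar> powr (1 / \<beta>)) * indicator {x. \<bar>x\<bar> > 1} x"
    and ?s = "\<lambda>x. ennreal (sm x) * indicator {x. \<bar>x\<bar> \<le> 1} x"
  \<comment> \<open>at \<open>\<beta> = 3 / 2\<close> the last summand is \<open>1 / 0 = 0\<close>\<close>
  define K where "K = 4 + 1 / (2 * \<beta> - 1) + 1 / \<bar>3 - 2 * \<beta>\<bar>"
  have K: "0 \<le> K" using \<beta> by (simp add: K_def)
  have sm0: "0 \<le> sm x" if "\<bar>x\<bar> \<le> 1" for x
    using that by (cases "x = 0") (auto simp: sm_def)
  have bound: "?S x + ?T x \<le> ennreal K * (?m x + ?l x + ?s x)" for x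
  proof (cases "\<bar>x\<bar> \<le> 1")
    case True
    hence x2: "x\<^sup>2 \<le> 1" by (simp add: abs_square_le_1)
    have S: "?S x \<le> ennreal ((2 + 1 / \<bar>3 - 2 * \<beta>\<bar>) * (x\<^sup>2 + sm x))"
    proof (rule order_trans[OF truncated_power_small_frequencies ennreal_leI])
      consider "\<beta> < 3 / 2" | "\<beta> = 3 / 2" | "3 / 2 < \<beta>" by linarith
      thus "(if 1 < \<bar>x\<bar> then 2 else if \<beta> < 3 / 2 then 1 / (3 - 2 * \<beta>) * x\<^sup>2
             else if \<beta> = 3 / 2 then 2 * x\<^sup>2 + 2 * (x\<^sup>2 * ln (1 / \<bar>x\<bar>))
             else (2 + 1 / (2 * \<beta> - 3)) * \<bar>x\<bar> powr (1 / (\<beta> - 1))) \<le> (2 + 1 / \<bar>3 - 2 * \<beta>\<bar>) * (x\<^sup>2 + sm x)"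
      proof cases
        case 1
        have "1 / (3 - 2 * \<beta>) * x\<^sup>2 \<le> (2 + 1 / (3 - 2 * \<beta>)) * x\<^sup>2" by (intro mult_right_mono) auto
        thus ?thesis using 1 True by (simp add: sm_def)
      next
        case 2
        hence z: "\<bar>3 - 2 * \<beta>\<bar> = 0" by simp
        show ?thesis unfolding z using 2 True by (simp add: sm_def distrib_left)
      next
        case 3
        have "(2 + 1 / (2 * \<beta> - 3)) * sm x \<le> (2 + 1 / (2 * \<beta> - 3)) * (x\<^sup>2 + sm x)"
          using 3 by (intro mult_left_mono) auto
        thus ?thesis using 3 True by (simp add: sm_def)
      qed
    qed
    have T: "?T x \<le> ennreal ((2 + 1 / (2 * \<beta> - 1)) * x\<^sup>2)"
      using truncated_power_large_frequencies[OF \<beta>, of x] True by simp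
    have T': "(2 + 1 / (2 * \<beta> - 1)) * x\<^sup>2 \<le> (2 + 1 / (2 * \<beta> - 1)) * (x\<^sup>2 + sm x)"
      using \<beta> sm0[OF True] by (intro mult_left_mono) auto
    have "?S x + ?T x \<le>
        ennreal ((2 + 1 / \<bar>3 - 2 * \<beta>\<bar>) * (x\<^sup>2 + sm x)) + ennreal ((2 + 1 / (2 * \<beta> - 1)) * (x\<^sup>2 + sm x))"
      by (intro add_mono S order_trans[OF T] ennreal_leI T')
    also have "\<dots> = ennreal (K * (x\<^sup>2 + sm x))"
      using \<beta> sm0[OF True] by (subst ennreal_plus[symmetric]) (auto simp: K_def distrib_right intro!: mult_nonneg_nonneg add_nonneg_nonneg)
    also have "\<dots> = ennreal K * (?m x + ?l x + ?s x)"
      using True x2 sm0[OF True] K by (simp add: ennreal_mult ennreal_plus)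
    finally show ?thesis .
  next
    case False
    hence x2: "1 \<le> x\<^sup>2" using abs_le_square_iff[of 1 x] by simp
    have S: "?S x \<le> ennreal 2"
      using truncated_power_small_frequencies[of \<beta> x] False by simp
    have T: "?T x \<le> ennreal ((2 + 1 / (2 * \<beta> - 1)) * \<bar>x\<bar> powr (1 / \<beta>))"
      using truncated_power_large_frequencies[OF \<beta>, of x] False by simp
    have "?S x + ?T x \<le>
        ennreal K + ennreal (K * \<bar>x\<bar> powr (1 / \<beta>))"
      using \<beta> by (intro add_mono order_trans[OF S] order_trans[OF T] ennreal_leI mult_right_mono) (auto simp: K_def)
    also have "\<dots> = ennreal K * (?m x + ?l x + ?s x)"
      using False x2 K by (simp add: ennreal_mult distrib_left)
    finally show ?thesis .
  qed
  have "(\<integral>\<^sup>+s. jump_bound \<nu>R (kernel_profile \<beta> s) \<partial>lborel) =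
      (\<integral>\<^sup>+x. \<integral>\<^sup>+s. ennreal (min 2 ((kernel_profile \<beta> s)\<^sup>2 * x\<^sup>2)) \<partial>lborel \<partial>\<nu>R)"
    unfolding jump_bound_def by (rule Fubini') measurable
  also have "\<dots> \<le> (\<integral>\<^sup>+x. ennreal (2 * K) * (?m x + ?l x + ?s x) \<partial>\<nu>R)"
  proof (intro nn_integral_mono order_trans[OF kernel_profile_truncated])
    fix x
    have "2 * (?S x + ?T x) \<le> 2 * (ennreal K * (?m x + ?l x + ?s x))"
      by (intro mult_left_mono bound) simp
    also have "\<dots> = ennreal (2 * K) * (?m x + ?l x + ?s x)" using K by (simp add: ennreal_mult mult.assoc)
    finally show "2 * (?S x + ?T x) \<le> ennreal (2 * K) * (?m x + ?l x + ?s x)" .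
  qed
  also have "\<dots> = ennreal (2 * K) * ((\<integral>\<^sup>+x. ?m x \<partial>\<nu>R) + (\<integral>\<^sup>+x. ?l x \<partial>\<nu>R) + (\<integral>\<^sup>+x. ?s x \<partial>\<nu>R))"
    by (simp add: nn_integral_cmult nn_integral_add)
  also have "\<dots> < \<infinity>"
  proof -
    have "(\<integral>\<^sup>+x. ?m x \<partial>\<nu>R) < \<infinity>" using \<nu>R by (simp add: levy_measure_def)
    moreover have "(\<integral>\<^sup>+x. ?s x \<partial>\<nu>R) < \<infinity>"
    proof -
      consider "\<beta> < 3 / 2" | "\<beta> = 3 / 2" | "3 / 2 < \<beta>" by linarith
      thus ?thesis by cases (use small bdry in \<open>simp_all add: sm_def\<close>)
    qed
    ultimately show ?thesis using large by (simp add: ennreal_mult_less_top)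
  qed
  finally show ?thesis .
qed

lemma hflm_kernel_increment:
  "hflm_kernel \<alpha> H a b (t + h) s - hflm_kernel \<alpha> H a b h s = iexp (h * s) * hflm_kernel \<alpha> H a b t s"
proof -
  have "iexp ((t + h) * s) - 1 - (iexp (h * s) - 1) = iexp (h * s) * (iexp (t * s) - 1)"
    by (simp add: algebra_simps flip: exp_add)
  thus ?thesis unfolding hflm_kernel_def
    by (simp only: left_diff_distrib[symmetric] diff_divide_distrib[symmetric]) (simp add: mult.assoc)
qed

theorem theorem4p1:
  fixes P :: "'w measure"
    and L :: "real \<Rightarrow> 'w \<Rightarrow> complex"
    and \<Lambda> :: "real set \<Rightarrow> 'w \<Rightarrow> complex"
    and \<gamma> :: complex
    and \<nu> :: "complex measure"
    and \<nu>R :: "real measure"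
    and \<alpha> H a b :: real
  assumes "prob_space P"
    and "levy_process P L"
    and "rotationally_invariant_process P L"
    and "levy_triplet P L \<gamma> (\<lambda>_. 0) \<nu>"
    and "has_levy_measure P (\<lambda>t \<omega>. Re (L t \<omega>)) \<nu>R"
    and "levy_random_measure P L \<Lambda>"
    and "0 < \<alpha>" "\<alpha> < 2" "0 < H" "H < 1"
  shows "(cond_large_jumps \<alpha> H \<nu>R \<and> cond_small_jumps \<alpha> H \<nu>R \<and> cond_boundary \<alpha> H \<nu>R \<longrightarrow>
            (\<forall>t. levy_integrable P \<Lambda> (hflm_kernel \<alpha> H a b t))) \<and>
         (\<forall>X. (\<forall>t. has_levy_integral P \<Lambda> (hflm_kernel \<alpha> H a b t) UNIV (X t)) \<longrightarrow>
            stationary_increments P X \<and>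
            rotationally_invariant_process P X \<and>
            (\<forall>t \<theta>1 \<theta>2. let f1 = (\<lambda>s. Re (hflm_kernel \<alpha> H a b t s));
                            f2 = (\<lambda>s. Im (hflm_kernel \<alpha> H a b t s));
                            k = (\<lambda>s. hflm_exponent \<nu> (Complex (\<theta>1 * f1 s + \<theta>2 * f2 s) (\<theta>2 * f1 s - \<theta>1 * f2 s)))
               in integrable lborel k \<and>
                  (\<integral>\<omega>. exp (\<i> * complex_of_real (\<theta>1 * Re (X t \<omega>) + \<theta>2 * Im (X t \<omega>))) \<partial>P)
                    = exp (\<integral>s. k s \<partial>lborel)))"
proof -
  interpret rotation_invariant_levy P L \<Lambda> \<gamma> \<nu>
    using assms by (intro rotation_invariant_levy.intro rotation_invariant_levy_axioms.intro)
  let ?f = "hflm_kernel \<alpha> H a b" and ?\<beta> = "H + 1 / \<alpha>"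
  let ?k = "\<lambda>\<theta>1 \<theta>2 t s. hflm_exponent \<nu> (Complex (\<theta>1 * Re (?f t s) + \<theta>2 * Im (?f t s)) (\<theta>2 * Re (?f t s) - \<theta>1 * Im (?f t s)))"
  have "1 / 2 < 1 / \<alpha>" using assms(7,8) by (simp add: field_simps)
  hence \<beta>: "1 / 2 < ?\<beta>" using assms(9) by simp
  note \<nu>R = \<phi>_real_part[OF assms(5)]
  have exists_integral: "levy_integrable P \<Lambda> (?f t)"
    if "cond_large_jumps \<alpha> H \<nu>R" "cond_small_jumps \<alpha> H \<nu>R" "cond_boundary \<alpha> H \<nu>R" for t
  proof (rule levy_integrable_if_jump_bound[OF \<nu>R])
    note [measurable] = jump_bound_measurable[OF \<nu>R(1)]
    define c where "c = (\<bar>a\<bar> + \<bar>b\<bar>) * max 2 \<bar>t\<bar>"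
    have c: "0 \<le> c" by (simp add: c_def)
    have "(\<integral>\<^sup>+s. jump_bound \<nu>R (norm (?f t s)) \<partial>lborel) \<le> (\<integral>\<^sup>+s. ennreal (max 1 (c\<^sup>2)) * jump_bound \<nu>R (kernel_profile ?\<beta> s) \<partial>lborel)"
    proof (rule nn_integral_mono)
      fix s
      have "jump_bound \<nu>R (norm (?f t s)) \<le> jump_bound \<nu>R (c * kernel_profile ?\<beta> s)"
        unfolding c_def by (rule jump_bound_mono[OF _ hflm_kernel_le_profile]) simp
      also have "\<dots> \<le> ennreal (max 1 (c\<^sup>2)) * jump_bound \<nu>R (kernel_profile ?\<beta> s)"
        by (rule jump_bound_scale[OF \<nu>R(1)]) auto
      finally show "jump_bound \<nu>R (norm (?f t s)) \<le> ennreal (max 1 (c\<^sup>2)) * jump_bound \<nu>R (kernel_profile ?\<beta> s)" .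
    qed
    also have "\<dots> = ennreal (max 1 (c\<^sup>2)) * (\<integral>\<^sup>+s. jump_bound \<nu>R (kernel_profile ?\<beta> s) \<partial>lborel)"
      by (intro nn_integral_cmult) measurable
    also have "\<dots> < \<infinity>"
    proof -
      have "(\<integral>\<^sup>+s. jump_bound \<nu>R (kernel_profile ?\<beta> s) \<partial>lborel) < \<infinity>"
        using that by (intro kernel_profile_jump_bound[OF \<nu>R(1) \<beta>])
          (auto simp: cond_large_jumps_def cond_small_jumps_def cond_boundary_def)
      thus ?thesis by (simp add: ennreal_mult_less_top)
    qed
    finally show "(\<integral>\<^sup>+s. jump_bound \<nu>R (norm (?f t s)) \<partial>lborel) < \<infinity>" .
  qed measurable
  have process: "stationary_increments P X" "rotationally_invariant_process P X"
    "integrable lborel (\<lambda>s. ?k \<theta>1 \<theta>2 t s)"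
    "(\<integral>\<omega>. iexp (\<theta>1 * Re (X t \<omega>) + \<theta>2 * Im (X t \<omega>)) \<partial>P) =
      exp (\<integral>s. ?k \<theta>1 \<theta>2 t s \<partial>lborel)"
    if "\<forall>t. has_levy_integral P \<Lambda> (?f t) UNIV (X t)" for X t \<theta>1 \<theta>2
  proof -
    have X: "levy_limit (?f t) (X t)" for t using that by (intro levy_limit_integral) blast
    show "stationary_increments P X" by (rule integral_process_stationary_increments[OF X hflm_kernel_increment])
    show "rotationally_invariant_process P X" by (rule integral_process_rotationally_invariant[OF X])
    define z where "z = Complex \<theta>1 \<theta>2"
    have arg: "Complex (\<theta>1 * Re w + \<theta>2 * Im w) (\<theta>2 * Re w - \<theta>1 * Im w) = cnj w * z" for w
      by (simp add: z_def complex_eq_iff algebra_simps)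
    have inner: "\<theta>1 * Re w + \<theta>2 * Im w = z \<bullet> w" for w by (simp add: z_def inner_complex_def)
    show "integrable lborel (\<lambda>s. ?k \<theta>1 \<theta>2 t s)"
      unfolding arg exponent_eq using energy_integrable_limit[OF X, of t z] by auto
    show "(\<integral>\<omega>. iexp (\<theta>1 * Re (X t \<omega>) + \<theta>2 * Im (X t \<omega>)) \<partial>P) =
      exp (\<integral>s. ?k \<theta>1 \<theta>2 t s \<partial>lborel)"
      unfolding arg exponent_eq unfolding inner char_levy_limit[OF X] by simp
  qed
  show ?thesis unfolding Let_def using exists_integral process by blast
qed

end
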